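(* Let $R$ be a noetherian commutative ring and let $C$ be a locally projective $R$-coalgebra. 1. If $C$ is coreflexive, then the canonical $R$-linear map $\Phi_C:C\to C^{\ast\ast}$ induces an isomorphism $C\simeq C^{\ast\circ}$. 2. Let $R$ be artinian. Then $C$ is coreflexive if and only if all $R$-cofinite (two-sided) ideals of $C^{\ast}$ are closed with respect to the finite topology. 3. If $C^{\ast}$ is cofinitely $R$-cogenerated, then the following statements are equivalent: (i) $C$ is coreflexive; (ii) $C\simeq C^{\ast\circ}$ (via $\Phi_C$); (iii) every locally finite left $C^{\ast}$-module is $C$-rational.
   Context: $R$ is a commutative ring with $1\neq 0$; $\otimes,\mathrm{Hom}$ are over $R$, $L^{\ast}=\mathrm{Hom}_R(L,R)$. For an $R$-coalgebra $(C,\Delta,\varepsilon)$ (coassociative, counital), $C^{\ast}$ is an $R$-algebra under convolution $(f\star g)(c)=\sum f(c_1)g(c_2)$ with unit $\varepsilon$. $C$ is locally projective if for every $R$-module $X$ the canonical map $X\otimes C\to\mathrm{Hom}_R(C^{\ast},X)$, $\sum x_i\otimes c_i\mapsto[f\mapsto\sum x_if(c_i)]$ is injective. An ideal $I$ of $C^{\ast}$ is $R$-cofinite if $C^{\ast}/I$ is a finitely generated $R$-module. $C^{\ast\circ}=(C^{\ast})^{\circ}=\{f\in C^{\ast\ast}\mid f(I)=0\text{ for some } R\text{-cofinite two-sided ideal } I\text{ of }C^{\ast}\}$. $C^{\ast}$ is cofinitely $R$-cogenerated if $C^{\ast}/I$ embeds in a product of copies of $R$ for every $R$-cofinite ideal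 $I$. The finite topology on $C^{\ast}$ has neighbourhood basis of $0$ given by $\{f\in C^{\ast}\mid f(K)=0\}$, $K\subseteq C$ a finitely generated $R$-submodule. The cofinite topology $\mathrm{Cf}(C^{\ast})$ has neighbourhood basis of $0$ given by all $R$-cofinite two-sided ideals (equivalently, as $R$ is noetherian, all $R$-cofinite right ideals). $C$ is coreflexive if the finite topology on $C^{\ast}$ equals $\mathrm{Cf}(C^{\ast})$. A left $C^{\ast}$-module $X$ is locally finite if $C^{\ast}x$ is a finitely generated $R$-module for every $x\in X$. $X$ is $C$-rational if for every $x\in X$ there is $\sum x_i\otimes c_i\in X\otimes C$ with $gx=\sum x_ig(c_i)$ for all $g\in C^{\ast}$. *)

theory Defs
  imports
    "HOL-Algebra.Module"
    "HOL-Algebra.QuotRing"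
    "HOL-Algebra.Ring_Divisibility"
    "HOL-Analysis.Abstract_Topology"
begin

section \<open>Rings and modules\<close>

definition artinian_ring :: "('r, 'k) ring_scheme \<Rightarrow> bool" where
  "artinian_ring R \<longleftrightarrow> cring R \<and>
    (\<forall>I :: nat \<Rightarrow> 'r set. (\<forall>n. ideal (I n) R \<and> I (Suc n) \<subseteq> I n) \<longrightarrow> (\<exists>n. \<forall>m\<ge>n. I m = I n))"

text \<open>The fields \<open>mult\<close> and \<open>one\<close> of a \<open>module\<close> record play no role in its module structure;
  they are left undefined in the module constructions below.\<close>

definition base_module :: "('r, 'k) ring_scheme \<Rightarrow> ('r, 'r) module" where
  "base_module R = \<lparr>carrier = carrier R, mult = mult R, one = \<one>\<^bsub>R\<^esub>,
     zero = \<zero>\<^bsub>R\<^esub>, add = add R, smult = mult R\<rparr>"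

definition submodule_span ::
    "('r, 'k) ring_scheme \<Rightarrow> ('r, 'm, 's) module_scheme \<Rightarrow> 'm set \<Rightarrow> 'm set" where
  "submodule_span R M S = \<Inter>{N. submodule N R M \<and> S \<subseteq> N}"

definition fg_module :: "('r, 'k) ring_scheme \<Rightarrow> ('r, 'm, 's) module_scheme \<Rightarrow> bool" where
  "fg_module R M \<longleftrightarrow> (\<exists>S \<subseteq> carrier M. finite S \<and> submodule_span R M S = carrier M)"

definition quotient_module ::
    "('r, 'm, 's) module_scheme \<Rightarrow> 'm set \<Rightarrow> ('r, 'm set) module" where
  "quotient_module M N = \<lparr>carrier = a_rcosets\<^bsub>M\<^esub> N, mult = undefined, one = undefined,
     zero = N, add = set_add M, smult = (\<lambda>r X. \<Union>x\<in>X. N +>\<^bsub>M\<^esub> (r \<odot>\<^bsub>M\<^esub> x))\<rparr>"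

text \<open>Maps are extensional, so that a linear map is determined by its values on the carrier.\<close>

definition linear_maps ::
    "('r, 'k) ring_scheme \<Rightarrow> ('r, 'm, 's) module_scheme \<Rightarrow> ('r, 'n, 't) module_scheme \<Rightarrow> ('m \<Rightarrow> 'n) set"
  where
  "linear_maps R M N = {f \<in> carrier M \<rightarrow>\<^sub>E carrier N.
     (\<forall>x\<in>carrier M. \<forall>y\<in>carrier M. f (x \<oplus>\<^bsub>M\<^esub> y) = f x \<oplus>\<^bsub>N\<^esub> f y) \<and>
     (\<forall>r\<in>carrier R. \<forall>x\<in>carrier M. f (r \<odot>\<^bsub>M\<^esub> x) = r \<odot>\<^bsub>N\<^esub> f x)}"

definition linear_isos ::
    "('r, 'k) ring_scheme \<Rightarrow> ('r, 'm, 's) module_scheme \<Rightarrow> ('r, 'n, 't) module_scheme \<Rightarrow> ('m \<Rightarrow> 'n) set"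
  where
  "linear_isos R M N = {f \<in> linear_maps R M N. bij_betw f (carrier M) (carrier N)}"

definition hom_module ::
    "('r, 'k) ring_scheme \<Rightarrow> ('r, 'm, 's) module_scheme \<Rightarrow> ('r, 'n, 't) module_scheme \<Rightarrow>
     ('r, 'm \<Rightarrow> 'n) module" where
  "hom_module R M N = \<lparr>carrier = linear_maps R M N, mult = undefined, one = undefined,
     zero = (\<lambda>x\<in>carrier M. \<zero>\<^bsub>N\<^esub>),
     add = (\<lambda>f g. \<lambda>x\<in>carrier M. f x \<oplus>\<^bsub>N\<^esub> g x),
     smult = (\<lambda>r f. \<lambda>x\<in>carrier M. r \<odot>\<^bsub>N\<^esub> f x)\<rparr>"

definition dual_module ::
    "('r, 'k) ring_scheme \<Rightarrow> ('r, 'm, 's) module_scheme \<Rightarrow> ('r, 'm \<Rightarrow> 'r) module" where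
  "dual_module R M = hom_module R M (base_module R)"

definition power_module :: "('r, 'k) ring_scheme \<Rightarrow> 'i set \<Rightarrow> ('r, 'i \<Rightarrow> 'r) module" where
  "power_module R \<Lambda> = \<lparr>carrier = \<Lambda> \<rightarrow>\<^sub>E carrier R, mult = undefined, one = undefined,
     zero = (\<lambda>i\<in>\<Lambda>. \<zero>\<^bsub>R\<^esub>),
     add = (\<lambda>f g. \<lambda>i\<in>\<Lambda>. f i \<oplus>\<^bsub>R\<^esub> g i),
     smult = (\<lambda>r f. \<lambda>i\<in>\<Lambda>. r \<otimes>\<^bsub>R\<^esub> f i)\<rparr>"

text \<open>\<open>M\<close> embeds in a product of copies of \<open>R\<close>.  Drawing the index set from the type of maps
  from \<open>M\<close> to \<open>R\<close> is no restriction: in an embedding into a product over an arbitrary index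
  set, one may index the factors by the coordinate maps themselves, dropping repetitions.\<close>

definition cogenerated_by_base ::
    "('r, 'k) ring_scheme \<Rightarrow> ('r, 'm, 's) module_scheme \<Rightarrow> bool" where
  "cogenerated_by_base R M \<longleftrightarrow> (\<exists>(\<Lambda> :: ('m \<Rightarrow> 'r) set) h.
     h \<in> linear_maps R M (power_module R \<Lambda>) \<and> inj_on h (carrier M))"

section \<open>Tensor products\<close>

text \<open>Finitely supported functions on \<open>S\<close>.\<close>

definition free_module :: "('r, 'k) ring_scheme \<Rightarrow> 'p set \<Rightarrow> ('r, 'p \<Rightarrow> 'r) module" where
  "free_module R S = \<lparr>carrier = {\<phi>. range \<phi> \<subseteq> carrier R \<and>
       finite {p. \<phi> p \<noteq> \<zero>\<^bsub>R\<^esub>} \<and> (\<forall>p. p \<notin> S \<longrightarrow> \<phi> p = \<zero>\<^bsub>R\<^esub>)},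
     mult = undefined, one = undefined,
     zero = (\<lambda>p. \<zero>\<^bsub>R\<^esub>),
     add = (\<lambda>\<phi> \<psi> p. \<phi> p \<oplus>\<^bsub>R\<^esub> \<psi> p),
     smult = (\<lambda>r \<phi> p. r \<otimes>\<^bsub>R\<^esub> \<phi> p)\<rparr>"

definition single :: "('r, 'k) ring_scheme \<Rightarrow> 'p \<Rightarrow> 'p \<Rightarrow> 'r" where
  "single R p = (\<lambda>q. if q = p then \<one>\<^bsub>R\<^esub> else \<zero>\<^bsub>R\<^esub>)"

definition tensor_relations ::
    "('r, 'k) ring_scheme \<Rightarrow> ('r, 'm, 's) module_scheme \<Rightarrow> ('r, 'n, 't) module_scheme \<Rightarrow>
     ('m \<times> 'n \<Rightarrow> 'r) set" where
  "tensor_relations R M N = (let F = free_module R (carrier M \<times> carrier N) in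
     submodule_span R F
      ({single R (x \<oplus>\<^bsub>M\<^esub> x', y) \<ominus>\<^bsub>F\<^esub> (single R (x, y) \<oplus>\<^bsub>F\<^esub> single R (x', y)) | x x' y.
          x \<in> carrier M \<and> x' \<in> carrier M \<and> y \<in> carrier N} \<union>
       {single R (x, y \<oplus>\<^bsub>N\<^esub> y') \<ominus>\<^bsub>F\<^esub> (single R (x, y) \<oplus>\<^bsub>F\<^esub> single R (x, y')) | x y y'.
          x \<in> carrier M \<and> y \<in> carrier N \<and> y' \<in> carrier N} \<union>
       {single R (r \<odot>\<^bsub>M\<^esub> x, y) \<ominus>\<^bsub>F\<^esub> (r \<odot>\<^bsub>F\<^esub> single R (x, y)) | r x y.
          r \<in> carrier R \<and> x \<in> carrier M \<and> y \<in> carrier N} \<union>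
       {single R (x, r \<odot>\<^bsub>N\<^esub> y) \<ominus>\<^bsub>F\<^esub> (r \<odot>\<^bsub>F\<^esub> single R (x, y)) | r x y.
          r \<in> carrier R \<and> x \<in> carrier M \<and> y \<in> carrier N}))"

definition tensor_module ::
    "('r, 'k) ring_scheme \<Rightarrow> ('r, 'm, 's) module_scheme \<Rightarrow> ('r, 'n, 't) module_scheme \<Rightarrow>
     ('r, ('m \<times> 'n \<Rightarrow> 'r) set) module" where
  "tensor_module R M N =
     quotient_module (free_module R (carrier M \<times> carrier N)) (tensor_relations R M N)"

definition pure_tensor ::
    "('r, 'k) ring_scheme \<Rightarrow> ('r, 'm, 's) module_scheme \<Rightarrow> ('r, 'n, 't) module_scheme \<Rightarrow>
     'm \<Rightarrow> 'n \<Rightarrow> ('m \<times> 'n \<Rightarrow> 'r) set" where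
  "pure_tensor R M N x y =
     tensor_relations R M N +>\<^bsub>free_module R (carrier M \<times> carrier N)\<^esub> single R (x, y)"

text \<open>The linear map into \<open>P\<close> induced on a tensor product by a map \<open>b\<close>, sending
  the sum of the pure tensors of \<open>x\<^sub>i\<close>, \<open>y\<^sub>i\<close> to the sum of the \<open>b x\<^sub>i y\<^sub>i\<close>.  It is
  meaningful only for bilinear \<open>b\<close>: then all representatives \<open>\<phi>\<close> of a coset \<open>t\<close> give the same
  value, and the set below is a singleton.\<close>

definition tensor_lift ::
    "('r, 'k) ring_scheme \<Rightarrow> ('r, 'p, 's) module_scheme \<Rightarrow> ('m \<Rightarrow> 'n \<Rightarrow> 'p) \<Rightarrow>
     ('m \<times> 'n \<Rightarrow> 'r) set \<Rightarrow> 'p" where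
  "tensor_lift R P b t = the_elem
     ((\<lambda>\<phi>. \<Oplus>\<^bsub>P\<^esub>q\<in>{q. \<phi> q \<noteq> \<zero>\<^bsub>R\<^esub>}. \<phi> q \<odot>\<^bsub>P\<^esub> b (fst q) (snd q)) ` t)"

definition tensor_assoc ::
    "('r, 'k) ring_scheme \<Rightarrow> ('r, 'l, 's) module_scheme \<Rightarrow> ('r, 'm, 't) module_scheme \<Rightarrow>
     ('r, 'n, 'u) module_scheme \<Rightarrow>
     (('l \<times> 'm \<Rightarrow> 'r) set \<times> 'n \<Rightarrow> 'r) set \<Rightarrow> ('l \<times> ('m \<times> 'n \<Rightarrow> 'r) set \<Rightarrow> 'r) set" where
  "tensor_assoc R L M N = (let T = tensor_module R L (tensor_module R M N) in
     tensor_lift R T (\<lambda>t z. tensor_lift R T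
       (\<lambda>x y. pure_tensor R L (tensor_module R M N) x (pure_tensor R M N y z)) t))"

section \<open>Coalgebras and their dual algebras\<close>

record ('r, 'c) coalgebra = "('r, 'c) module" +
  comult :: "'c \<Rightarrow> ('c \<times> 'c \<Rightarrow> 'r) set"
  counit :: "'c \<Rightarrow> 'r"

locale coalgebra = module R C
  for R :: "('r, 'k) ring_scheme" (structure) and C :: "('r, 'c, 'e) coalgebra_scheme" (structure) +
  assumes comult_linear: "comult C \<in> linear_maps R C (tensor_module R C C)"
    and counit_linear: "counit C \<in> linear_maps R C (base_module R)"
    and coassoc: "c \<in> carrier C \<Longrightarrow>
      tensor_assoc R C C C
        (tensor_lift R (tensor_module R (tensor_module R C C) C)
           (\<lambda>x y. pure_tensor R (tensor_module R C C) C (comult C x) y) (comult C c)) =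
      tensor_lift R (tensor_module R C (tensor_module R C C))
        (\<lambda>x y. pure_tensor R C (tensor_module R C C) x (comult C y)) (comult C c)"
    and counit_left: "c \<in> carrier C \<Longrightarrow>
      tensor_lift R C (\<lambda>x y. counit C x \<odot>\<^bsub>C\<^esub> y) (comult C c) = c"
    and counit_right: "c \<in> carrier C \<Longrightarrow>
      tensor_lift R C (\<lambda>x y. counit C y \<odot>\<^bsub>C\<^esub> x) (comult C c) = c"

definition convolution ::
    "('r, 'k) ring_scheme \<Rightarrow> ('r, 'c, 'e) coalgebra_scheme \<Rightarrow> ('c \<Rightarrow> 'r) \<Rightarrow> ('c \<Rightarrow> 'r) \<Rightarrow> 'c \<Rightarrow> 'r" where
  "convolution R C f g = (\<lambda>c\<in>carrier C.
     tensor_lift R (base_module R) (\<lambda>x y. f x \<otimes>\<^bsub>R\<^esub> g y) (comult C c))"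

definition dual_algebra ::
    "('r, 'k) ring_scheme \<Rightarrow> ('r, 'c, 'e) coalgebra_scheme \<Rightarrow> ('r, 'c \<Rightarrow> 'r) module" where
  "dual_algebra R C = (dual_module R C)\<lparr>mult := convolution R C, one := counit C\<rparr>"

text \<open>The canonical map sending the sum of the pure tensors of \<open>x\<^sub>i\<close>, \<open>c\<^sub>i\<close> to
  the map taking \<open>f\<close> to the sum of the \<open>f c\<^sub>i \<odot> x\<^sub>i\<close>.\<close>

definition tensor_to_hom ::
    "('r, 'k) ring_scheme \<Rightarrow> ('r, 'x, 's) module_scheme \<Rightarrow> ('r, 'c, 'e) coalgebra_scheme \<Rightarrow>
     ('x \<times> 'c \<Rightarrow> 'r) set \<Rightarrow> ('c \<Rightarrow> 'r) \<Rightarrow> 'x" where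
  "tensor_to_hom R X C t =
     (\<lambda>f\<in>carrier (dual_module R C). tensor_lift R X (\<lambda>x c. f c \<odot>\<^bsub>X\<^esub> x) t)"

text \<open>HOL has no quantification over types, so ``every module'' is rendered as every module
  with carrier in a universe type.  Since \<open>'x\<close> is arbitrary, every module is up to isomorphism
  one over such a universe.  The other summands ensure that the universe is always large enough
  for the quantifications below not to depend on \<open>'x\<close>: they contain copies of all quotients of
  the left module \<open>C*\<close> (that is, of all cyclic modules, on which rationality of locally finite
  modules is decided) and of all quotients of the modules \<open>R^n\<close> (that is, of all finitely
  generated modules, on which local projectivity is decided).\<close>

type_synonym ('r, 'c, 'x) module_universe = "'x + ('c \<Rightarrow> 'r) set + (nat \<Rightarrow> 'r) set"

definition locally_projective ::
    "'u itself \<Rightarrow> ('r, 'k) ring_scheme \<Rightarrow> ('r, 'c, 'e) coalgebra_scheme \<Rightarrow> bool" where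
  "locally_projective (_ :: 'u itself) R C \<longleftrightarrow>
     (\<forall>X :: ('r, 'u) module. module R X \<longrightarrow>
        inj_on (tensor_to_hom R X C) (carrier (tensor_module R X C)))"

section \<open>Cofinite ideals and the finite dual\<close>

text \<open>Here \<open>A\<close> is an \<open>R\<close>-algebra, given as a record with both ring and module structure,
  and ideals are two-sided.\<close>

definition cofinite_ideal ::
    "('r, 'k) ring_scheme \<Rightarrow> ('r, 'a, 's) module_scheme \<Rightarrow> 'a set \<Rightarrow> bool" where
  "cofinite_ideal R A I \<longleftrightarrow> ideal I A \<and> fg_module R (quotient_module A I)"

definition finite_dual ::
    "('r, 'k) ring_scheme \<Rightarrow> ('r, 'a, 's) module_scheme \<Rightarrow> ('r, 'a \<Rightarrow> 'r) module" where
  "finite_dual R A = (dual_module R A)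
     \<lparr>carrier := {\<phi> \<in> carrier (dual_module R A).
        \<exists>I. cofinite_ideal R A I \<and> (\<forall>a\<in>I. \<phi> a = \<zero>\<^bsub>R\<^esub>)}\<rparr>"

definition cofinitely_cogenerated ::
    "('r, 'k) ring_scheme \<Rightarrow> ('r, 'a, 's) module_scheme \<Rightarrow> bool" where
  "cofinitely_cogenerated R A \<longleftrightarrow>
     (\<forall>I. cofinite_ideal R A I \<longrightarrow> cogenerated_by_base R (quotient_module A I))"

definition bidual_map ::
    "('r, 'k) ring_scheme \<Rightarrow> ('r, 'c, 'e) coalgebra_scheme \<Rightarrow> 'c \<Rightarrow> ('c \<Rightarrow> 'r) \<Rightarrow> 'r" where
  "bidual_map R C = (\<lambda>c\<in>carrier C. \<lambda>f\<in>carrier (dual_algebra R C). f c)"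

section \<open>The finite and the cofinite topology\<close>

text \<open>The translation-invariant topology with neighbourhood basis \<open>\<B>\<close> of zero.\<close>

definition linear_topology :: "('a, 's) ring_scheme \<Rightarrow> 'a set set \<Rightarrow> 'a topology" where
  "linear_topology A \<B> =
     topology (\<lambda>U. U \<subseteq> carrier A \<and> (\<forall>a\<in>U. \<exists>N\<in>\<B>. N +>\<^bsub>A\<^esub> a \<subseteq> U))"

lemma openin_linear_topology:
  assumes filtered: "\<And>N N'. N \<in> \<B> \<Longrightarrow> N' \<in> \<B> \<Longrightarrow> \<exists>N''\<in>\<B>. N'' \<subseteq> N \<inter> N'"
  shows "openin (linear_topology A \<B>) U \<longleftrightarrow>
    U \<subseteq> carrier A \<and> (\<forall>a\<in>U. \<exists>N\<in>\<B>. N +>\<^bsub>A\<^esub> a \<subseteq> U)"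
proof -
  define L where "L = (\<lambda>U. U \<subseteq> carrier A \<and> (\<forall>a\<in>U. \<exists>N\<in>\<B>. N +>\<^bsub>A\<^esub> a \<subseteq> U))"
  have coset_mono: "N +>\<^bsub>A\<^esub> a \<subseteq> N' +>\<^bsub>A\<^esub> a" if "N \<subseteq> N'" for N N' a
    using that by (auto simp: a_r_coset_def r_coset_def)
  have "L (S \<inter> T)" if S: "L S" and T: "L T" for S T
    unfolding L_def
  proof (intro conjI ballI)
    show "S \<inter> T \<subseteq> carrier A"
      using S by (auto simp: L_def)
  next
    fix a assume a: "a \<in> S \<inter> T"
    obtain N where N: "N \<in> \<B>" "N +>\<^bsub>A\<^esub> a \<subseteq> S"
      using S a by (auto simp: L_def)
    obtain N' where N': "N' \<in> \<B>" "N' +>\<^bsub>A\<^esub> a \<subseteq> T"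
      using T a by (auto simp: L_def)
    obtain N'' where N'': "N'' \<in> \<B>" "N'' \<subseteq> N \<inter> N'"
      using filtered[OF N(1) N'(1)] by (rule bexE)
    have "N'' +>\<^bsub>A\<^esub> a \<subseteq> S" "N'' +>\<^bsub>A\<^esub> a \<subseteq> T"
      using coset_mono[of N'' N a] coset_mono[of N'' N' a] N(2) N'(2) N''(2) by simp_all
    then show "\<exists>N\<in>\<B>. N +>\<^bsub>A\<^esub> a \<subseteq> S \<inter> T"
      by (intro bexI[OF _ N''(1)] Int_greatest)
  qed
  moreover have "L (\<Union> K)" if K: "\<forall>S\<in>K. L S" for K
    unfolding L_def
  proof (intro conjI ballI)
    show "\<Union> K \<subseteq> carrier A"
      using K by (auto simp: L_def)
  next
    fix a assume "a \<in> \<Union> K"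
    then obtain S where S: "S \<in> K" "a \<in> S" by (rule UnionE)
    have "L S"
      using K S(1) by (rule bspec)
    then obtain N where N: "N \<in> \<B>" "N +>\<^bsub>A\<^esub> a \<subseteq> S"
      using S(2) by (auto simp: L_def)
    show "\<exists>N\<in>\<B>. N +>\<^bsub>A\<^esub> a \<subseteq> \<Union> K"
      using Union_upper[OF S(1)] by (intro bexI[OF _ N(1)] order_trans[OF N(2)])
  qed
  ultimately have "istopology L"
    by (simp add: istopology_def)
  then have "openin (linear_topology A \<B>) = L"
    unfolding linear_topology_def L_def by (rule topology_inverse')
  then show ?thesis
    by (simp add: L_def)
qed

definition annihilator ::
    "('r, 'k) ring_scheme \<Rightarrow> ('r, 'c, 'e) coalgebra_scheme \<Rightarrow> 'c set \<Rightarrow> ('c \<Rightarrow> 'r) set" where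
  "annihilator R C K = {f \<in> carrier (dual_algebra R C). \<forall>c\<in>K. f c = \<zero>\<^bsub>R\<^esub>}"

definition finite_topology ::
    "('r, 'k) ring_scheme \<Rightarrow> ('r, 'c, 'e) coalgebra_scheme \<Rightarrow> ('c \<Rightarrow> 'r) topology" where
  "finite_topology R C = linear_topology (dual_algebra R C)
     {annihilator R C K | K. submodule K R C \<and> fg_module R (C\<lparr>carrier := K\<rparr>)}"

definition cofinite_topology ::
    "('r, 'k) ring_scheme \<Rightarrow> ('r, 'a, 's) module_scheme \<Rightarrow> 'a topology" where
  "cofinite_topology R A = linear_topology A {I. cofinite_ideal R A I}"

definition coreflexive ::
    "('r, 'k) ring_scheme \<Rightarrow> ('r, 'c, 'e) coalgebra_scheme \<Rightarrow> bool" where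
  "coreflexive R C \<longleftrightarrow> finite_topology R C = cofinite_topology R (dual_algebra R C)"

section \<open>Locally finite and rational modules\<close>

locale left_module = A?: ring A + X?: abelian_group X
  for A :: "('a, 'k) ring_scheme" (structure) and X :: "('a, 'x, 's) module_scheme" (structure) +
  assumes smult_closed: "\<lbrakk>a \<in> carrier A; x \<in> carrier X\<rbrakk> \<Longrightarrow> a \<odot>\<^bsub>X\<^esub> x \<in> carrier X"
    and smult_l_distr: "\<lbrakk>a \<in> carrier A; b \<in> carrier A; x \<in> carrier X\<rbrakk> \<Longrightarrow>
      (a \<oplus>\<^bsub>A\<^esub> b) \<odot>\<^bsub>X\<^esub> x = a \<odot>\<^bsub>X\<^esub> x \<oplus>\<^bsub>X\<^esub> b \<odot>\<^bsub>X\<^esub> x"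
    and smult_r_distr: "\<lbrakk>a \<in> carrier A; x \<in> carrier X; y \<in> carrier X\<rbrakk> \<Longrightarrow>
      a \<odot>\<^bsub>X\<^esub> (x \<oplus>\<^bsub>X\<^esub> y) = a \<odot>\<^bsub>X\<^esub> x \<oplus>\<^bsub>X\<^esub> a \<odot>\<^bsub>X\<^esub> y"
    and smult_assoc1: "\<lbrakk>a \<in> carrier A; b \<in> carrier A; x \<in> carrier X\<rbrakk> \<Longrightarrow>
      (a \<otimes>\<^bsub>A\<^esub> b) \<odot>\<^bsub>X\<^esub> x = a \<odot>\<^bsub>X\<^esub> (b \<odot>\<^bsub>X\<^esub> x)"
    and smult_one: "x \<in> carrier X \<Longrightarrow> \<one>\<^bsub>A\<^esub> \<odot>\<^bsub>X\<^esub> x = x"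

text \<open>The \<open>R\<close>-module underlying a module \<open>X\<close> over an \<open>R\<close>-algebra \<open>A\<close>.\<close>

definition restrict_scalars ::
    "('r, 'a, 's) module_scheme \<Rightarrow> ('a, 'x, 't) module_scheme \<Rightarrow> ('r, 'x) module" where
  "restrict_scalars A X = \<lparr>carrier = carrier X, mult = mult X, one = \<one>\<^bsub>X\<^esub>,
     zero = \<zero>\<^bsub>X\<^esub>, add = add X, smult = (\<lambda>r x. (r \<odot>\<^bsub>A\<^esub> \<one>\<^bsub>A\<^esub>) \<odot>\<^bsub>X\<^esub> x)\<rparr>"

definition locally_finite ::
    "('r, 'k) ring_scheme \<Rightarrow> ('r, 'a, 's) module_scheme \<Rightarrow> ('a, 'x, 't) module_scheme \<Rightarrow> bool" where
  "locally_finite R A X \<longleftrightarrow> (\<forall>x\<in>carrier X.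
     fg_module R ((restrict_scalars A X)\<lparr>carrier := {a \<odot>\<^bsub>X\<^esub> x | a. a \<in> carrier A}\<rparr>))"

definition rational_module ::
    "('r, 'k) ring_scheme \<Rightarrow> ('r, 'c, 'e) coalgebra_scheme \<Rightarrow> ('c \<Rightarrow> 'r, 'x, 't) module_scheme \<Rightarrow> bool"
  where
  "rational_module R C X \<longleftrightarrow> (let X\<^sub>R = restrict_scalars (dual_algebra R C) X in
     \<forall>x\<in>carrier X. \<exists>t\<in>carrier (tensor_module R X\<^sub>R C).
       \<forall>g\<in>carrier (dual_algebra R C). g \<odot>\<^bsub>X\<^esub> x = tensor_to_hom R X\<^sub>R C t g)"

definition locally_finite_imp_rational ::
    "'u itself \<Rightarrow> ('r, 'k) ring_scheme \<Rightarrow> ('r, 'c, 'e) coalgebra_scheme \<Rightarrow> bool" where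
  "locally_finite_imp_rational (_ :: 'u itself) R C \<longleftrightarrow>
     (\<forall>X :: ('c \<Rightarrow> 'r, 'u) module.
        left_module (dual_algebra R C) X \<and> locally_finite R (dual_algebra R C) X \<longrightarrow>
        rational_module R C X)"

end

theory Submission
  imports Defs
begin

text \<open>Write \<open>A\<close> for the dual algebra \<open>C\<^sup>*\<close> and \<open>ann K\<close> for the set of all \<open>f \<in> A\<close> that vanish on \<open>K \<subseteq> C\<close>.  The
sets \<open>ann K\<close> with \<open>K\<close> finite form a neighbourhood basis of zero for the finite topology.  Three facts
carry the proof.

(1) Local projectivity provides, for every finite \<open>K\<close>, an operator \<open>T c = \<Sum>\<^sub>j f\<^sub>j(c) d\<^sub>j\<close> of finite rank
that fixes \<open>K\<close> pointwise (\<open>finite_rank_fixes_finite\<close>).  Then \<open>f - f \<circ> T \<in> ann K\<close> for every \<open>f \<in> A\<close>,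
and \<open>f \<circ> T = \<Sum>\<^sub>j f(d\<^sub>j) f\<^sub>j\<close>.  So a linear form \<open>\<phi>\<close> on \<open>A\<close> that vanishes on \<open>ann K\<close> is evaluation at the
element \<open>\<Sum>\<^sub>j \<phi>(f\<^sub>j) d\<^sub>j\<close> of \<open>C\<close>, and an element \<open>x\<close> of a left \<open>A\<close>-module that is killed by \<open>ann K\<close>
satisfies \<open>f x = \<Sum>\<^sub>j f(d\<^sub>j) f\<^sub>j x\<close>, which is what rationality asks for.

(2) Over a noetherian ring every \<open>ann K\<close> contains a cofinite ideal
(\<open>cofinite_ideal_in_annihilator\<close>), because two applications of the comultiplication to the elements of \<open>K\<close>
involve only finitely many elements of \<open>C\<close>.  Hence the finite topology is always coarser than the
cofinite one, and \<open>C\<close> is coreflexive if and only if every cofinite ideal contains some \<open>ann K\<close> with \<open>K\<close>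
finite (\<open>coreflexive_iff\<close>).

(3) Finite generation passes to kernels: if a linear map sends \<open>N\<close> into a finitely generated module
over a noetherian ring, then \<open>N\<close> is finitely generated over the kernel
(\<open>finite_over_kernel\<close>).  This one statement yields cofiniteness of \<open>ann K\<close>, of intersections of
cofinite ideals, and of annihilators of finitely generated modules.

The claims follow.  If \<open>C\<close> is coreflexive, a form that vanishes on a cofinite ideal vanishes on some \<open>ann K\<close>
and is an evaluation by (1); injectivity of the canonical map is also contained in (1).  Conversely,
if every such form is an evaluation and \<open>A/I\<close> is cogenerated by \<open>R\<close>, then \<open>I = ann D\<close> with \<open>D\<close> the set of
common zeros of \<open>I\<close>, and \<open>D\<close> is finitely generated by (3).  If \<open>R\<close> is artinian, a minimal member of the
family of all \<open>I + ann K\<close> is contained in each of them, hence in their intersection, which is the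
closure of \<open>I\<close>; so a closed \<open>I\<close> contains some \<open>ann K\<close>.  If \<open>C\<close> is coreflexive and \<open>A x\<close> is finitely
generated, the annihilator of the module \<open>A x\<close> is a cofinite ideal, so it contains some \<open>ann K\<close>, and \<open>x\<close>
is rational by (1).  Conversely, rationality of the element \<open>1 + I\<close> of the cyclic module \<open>A/I\<close> means
that \<open>g + I\<close> is determined by finitely many values of \<open>g\<close>, that is, \<open>ann K \<subseteq> I\<close> for a finite \<open>K\<close>.\<close>

section \<open>Linear maps and submodules\<close>

text \<open>Linearity without extensionality, so that expressions such as \<open>\<lambda>x. g (f x)\<close> or \<open>\<lambda>f. f c\<close> qualify as they
stand.\<close>

definition is_linear ::
    "('r, 'k) ring_scheme \<Rightarrow> ('r, 'm, 's) module_scheme \<Rightarrow> ('r, 'n, 't) module_scheme \<Rightarrow> ('m \<Rightarrow> 'n) \<Rightarrow> bool"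
  where
  "is_linear R M N f \<longleftrightarrow> f \<in> carrier M \<rightarrow> carrier N \<and>
     (\<forall>x\<in>carrier M. \<forall>y\<in>carrier M. f (x \<oplus>\<^bsub>M\<^esub> y) = f x \<oplus>\<^bsub>N\<^esub> f y) \<and>
     (\<forall>r\<in>carrier R. \<forall>x\<in>carrier M. f (r \<odot>\<^bsub>M\<^esub> x) = r \<odot>\<^bsub>N\<^esub> f x)"

lemma linear_maps_iff: "f \<in> linear_maps R M N \<longleftrightarrow> is_linear R M N f \<and> f \<in> extensional (carrier M)"
  by (auto simp: linear_maps_def is_linear_def PiE_def)

lemma is_linearI:
  assumes "\<And>x. x \<in> carrier M \<Longrightarrow> f x \<in> carrier N"
    and "\<And>x y. x \<in> carrier M \<Longrightarrow> y \<in> carrier M \<Longrightarrow> f (x \<oplus>\<^bsub>M\<^esub> y) = f x \<oplus>\<^bsub>N\<^esub> f y"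
    and "\<And>r x. r \<in> carrier R \<Longrightarrow> x \<in> carrier M \<Longrightarrow> f (r \<odot>\<^bsub>M\<^esub> x) = r \<odot>\<^bsub>N\<^esub> f x"
  shows "is_linear R M N f"
  using assms by (auto simp: is_linear_def)

lemma is_linearD:
  assumes "is_linear R M N f"
  shows "\<And>x. x \<in> carrier M \<Longrightarrow> f x \<in> carrier N"
    and "\<And>x y. x \<in> carrier M \<Longrightarrow> y \<in> carrier M \<Longrightarrow> f (x \<oplus>\<^bsub>M\<^esub> y) = f x \<oplus>\<^bsub>N\<^esub> f y"
    and "\<And>r x. r \<in> carrier R \<Longrightarrow> x \<in> carrier M \<Longrightarrow> f (r \<odot>\<^bsub>M\<^esub> x) = r \<odot>\<^bsub>N\<^esub> f x"
  using assms by (auto simp: is_linear_def)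

lemma is_linear_zero_minus:
  assumes "module R M" "module R N" "is_linear R M N f"
  shows "f \<zero>\<^bsub>M\<^esub> = \<zero>\<^bsub>N\<^esub>"
    and "x \<in> carrier M \<Longrightarrow> f (\<ominus>\<^bsub>M\<^esub> x) = \<ominus>\<^bsub>N\<^esub> f x"
    and "x \<in> carrier M \<Longrightarrow> y \<in> carrier M \<Longrightarrow> f (x \<ominus>\<^bsub>M\<^esub> y) = f x \<ominus>\<^bsub>N\<^esub> f y"
proof -
  interpret M: module R M by fact
  interpret N: module R N by fact
  note f = is_linearD[OF assms(3)]
  interpret abelian_group_hom M N f
    by (intro abelian_group_homI M.abelian_group_axioms N.abelian_group_axioms group_hom.intro
        M.a_group N.a_group group_hom_axioms.intro) (auto simp: hom_def f)
  show "f \<zero>\<^bsub>M\<^esub> = \<zero>\<^bsub>N\<^esub>" by simp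
  show "x \<in> carrier M \<Longrightarrow> f (\<ominus>\<^bsub>M\<^esub> x) = \<ominus>\<^bsub>N\<^esub> f x" by simp
  show "x \<in> carrier M \<Longrightarrow> y \<in> carrier M \<Longrightarrow> f (x \<ominus>\<^bsub>M\<^esub> y) = f x \<ominus>\<^bsub>N\<^esub> f y"
    by (simp add: a_minus_def f)
qed

lemma is_linear_compose:
  assumes "is_linear R M N f" "is_linear R N P g"
  shows "is_linear R M P (\<lambda>x. g (f x))"
  using is_linearD[OF assms(1)] is_linearD[OF assms(2)] by (intro is_linearI) auto

lemma is_linear_cong:
  assumes "is_linear R M N f" "module R M" "\<And>x. x \<in> carrier M \<Longrightarrow> f x = g x"
  shows "is_linear R M N g"
proof -
  interpret module R M by fact
  show ?thesis
    using is_linearD[OF assms(1)] by (intro is_linearI) (auto simp flip: assms(3))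
qed

lemma is_linear_ident: "is_linear R M M (\<lambda>x. x)"
  by (intro is_linearI) auto

lemma submodule_vimage:
  assumes "module R M" "module R N" "is_linear R M N f" "submodule K R N" "submodule H R M"
  shows "submodule {x \<in> H. f x \<in> K} R M"
proof -
  interpret M: module R M by fact
  interpret N: module R N by fact
  note f = is_linearD[OF assms(3)] is_linear_zero_minus[OF assms(1-3)]
  note K = N.submoduleE[OF assms(4)] and H = M.submoduleE[OF assms(5)]
  have "\<zero>\<^bsub>N\<^esub> \<in> K" "\<zero>\<^bsub>M\<^esub> \<in> H"
    using submodule.axioms(1)[OF assms(4)] submodule.axioms(1)[OF assms(5)]
    by (auto dest: subgroup.one_closed)
  then show ?thesis
    using f K H by (intro M.submoduleI) (auto simp: subset_iff)
qed

context module begin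

lemma is_linear_add:
  assumes "is_linear R M' M f" "is_linear R M' M g"
  shows "is_linear R M' M (\<lambda>x. f x \<oplus>\<^bsub>M\<^esub> g x)"
  using is_linearD[OF assms(1)] is_linearD[OF assms(2)]
  by (intro is_linearI) (auto simp: smult_r_distr M.a_ac)

lemma is_linear_smult:
  assumes "is_linear R M' M f" "r \<in> carrier R"
  shows "is_linear R M' M (\<lambda>x. r \<odot>\<^bsub>M\<^esub> f x)"
proof (rule is_linearI)
  note f = is_linearD[OF assms(1)]
  show "r \<odot>\<^bsub>M\<^esub> f (s \<odot>\<^bsub>M'\<^esub> x) = s \<odot>\<^bsub>M\<^esub> (r \<odot>\<^bsub>M\<^esub> f x)"
    if "s \<in> carrier R" "x \<in> carrier M'" for s x
  proof -
    have "r \<odot>\<^bsub>M\<^esub> (s \<odot>\<^bsub>M\<^esub> f x) = (s \<otimes> r) \<odot>\<^bsub>M\<^esub> f x"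
      using that assms(2) f by (simp add: m_comm flip: smult_assoc1)
    then show ?thesis using that assms(2) f by (simp add: smult_assoc1)
  qed
qed (use is_linearD[OF assms(1)] assms(2) in \<open>auto simp: smult_r_distr\<close>)

lemma submodule_zero_closed: "submodule N R M \<Longrightarrow> \<zero>\<^bsub>M\<^esub> \<in> N"
  by (auto simp: submodule_def dest: subgroup.one_closed)

lemma submodule_minus_closed: "submodule N R M \<Longrightarrow> x \<in> N \<Longrightarrow> y \<in> N \<Longrightarrow> x \<ominus>\<^bsub>M\<^esub> y \<in> N"
  by (simp add: a_minus_def submoduleE)

lemma submodule_diff_cancel:
  assumes "submodule V R M" "x \<ominus>\<^bsub>M\<^esub> t \<in> V" "t \<in> V" "x \<in> carrier M"
  shows "x \<in> V"
proof -
  have "t \<in> carrier M" using assms(3) submoduleE(1)[OF assms(1)] by blast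
  then have "(x \<ominus>\<^bsub>M\<^esub> t) \<oplus>\<^bsub>M\<^esub> t = x" using assms(4) by (simp add: a_minus_def M.a_assoc M.l_neg)
  then show ?thesis using submoduleE(5)[OF assms(1-3)] by simp
qed

lemma minus_eq_zero_iff:
  assumes "x \<in> carrier M" "y \<in> carrier M"
  shows "x \<ominus>\<^bsub>M\<^esub> y = \<zero>\<^bsub>M\<^esub> \<longleftrightarrow> x = y"
proof
  assume "x \<ominus>\<^bsub>M\<^esub> y = \<zero>\<^bsub>M\<^esub>"
  moreover have "(x \<ominus>\<^bsub>M\<^esub> y) \<oplus>\<^bsub>M\<^esub> y = x" using assms by (simp add: a_minus_def M.a_assoc M.l_neg)
  ultimately show "x = y" using assms by simp
qed (use assms in \<open>simp add: a_minus_def M.r_neg\<close>)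

lemma submodule_Inter:
  assumes "\<F> \<noteq> {}" "\<And>N. N \<in> \<F> \<Longrightarrow> submodule N R M"
  shows "submodule (\<Inter>\<F>) R M"
proof -
  obtain N where N: "N \<in> \<F>" using assms(1) by auto
  then have "\<Inter>\<F> \<subseteq> carrier M" using submoduleE(1)[OF assms(2)[OF N]] by auto
  then show ?thesis
    using assms submoduleE[OF assms(2)] submodule_zero_closed by (intro submoduleI) auto
qed

lemma submodule_zero: "submodule {\<zero>\<^bsub>M\<^esub>} R M"
  by (intro submoduleI) auto

lemma submodule_Int: "submodule N R M \<Longrightarrow> submodule N' R M \<Longrightarrow> submodule (N \<inter> N') R M"
  using submodule_Inter[of "{N, N'}"] by auto

lemma submodule_span_submodule:
  "S \<subseteq> carrier M \<Longrightarrow> submodule (submodule_span R M S) R M"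
  unfolding submodule_span_def using carrier_is_submodule by (intro submodule_Inter) auto

lemma submodule_span_superset: "S \<subseteq> submodule_span R M S"
  by (auto simp: submodule_span_def)

lemma submodule_span_least: "submodule N R M \<Longrightarrow> S \<subseteq> N \<Longrightarrow> submodule_span R M S \<subseteq> N"
  by (auto simp: submodule_span_def)

lemma submodule_span_mono: "S \<subseteq> T \<Longrightarrow> submodule_span R M S \<subseteq> submodule_span R M T"
  by (auto simp: submodule_span_def)

lemma submodule_span_closed: "S \<subseteq> carrier M \<Longrightarrow> submodule_span R M S \<subseteq> carrier M"
  by (simp add: submodule_span_least carrier_is_submodule)

lemma submodule_sum:
  assumes "submodule N R M" "submodule P R M"
  shows "submodule (N <+>\<^bsub>M\<^esub> P) R M"
proof -
  note N = submoduleE[OF assms(1)] submodule_zero_closed[OF assms(1)]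
  note P = submoduleE[OF assms(2)] submodule_zero_closed[OF assms(2)]
  have c: "x \<in> carrier M" if "x \<in> N \<or> x \<in> P" for x using that N(1) P(1) by auto
  show ?thesis
  proof (rule submoduleI)
    show "N <+>\<^bsub>M\<^esub> P \<subseteq> carrier M" using c by (auto simp: set_add_def')
    show "\<zero>\<^bsub>M\<^esub> \<in> N <+>\<^bsub>M\<^esub> P" using N P by (force simp: set_add_def')
    show "\<ominus>\<^bsub>M\<^esub> a \<in> N <+>\<^bsub>M\<^esub> P" if "a \<in> N <+>\<^bsub>M\<^esub> P" for a
      using that N(3) P(3) c by (fastforce simp: set_add_def' M.minus_add)
    show "a \<oplus>\<^bsub>M\<^esub> b \<in> N <+>\<^bsub>M\<^esub> P" if ab: "a \<in> N <+>\<^bsub>M\<^esub> P" "b \<in> N <+>\<^bsub>M\<^esub> P" for a b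
    proof -
      obtain n p n' p' where *: "n \<in> N" "p \<in> P" "a = n \<oplus>\<^bsub>M\<^esub> p" "n' \<in> N" "p' \<in> P" "b = n' \<oplus>\<^bsub>M\<^esub> p'"
        using ab by (auto simp: set_add_def')
      then have "a \<oplus>\<^bsub>M\<^esub> b = (n \<oplus>\<^bsub>M\<^esub> n') \<oplus>\<^bsub>M\<^esub> (p \<oplus>\<^bsub>M\<^esub> p')" using c by (simp add: M.a_ac)
      moreover have "n \<oplus>\<^bsub>M\<^esub> n' \<in> N" "p \<oplus>\<^bsub>M\<^esub> p' \<in> P" using * N P by auto
      ultimately show ?thesis unfolding set_add_def' by blast
    qed
    show "r \<odot>\<^bsub>M\<^esub> a \<in> N <+>\<^bsub>M\<^esub> P" if "r \<in> carrier R" "a \<in> N <+>\<^bsub>M\<^esub> P" for r a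
      using that N(4) P(4) c by (fastforce simp: set_add_def' smult_r_distr)
  qed
qed

lemma submodule_sum_upper:
  assumes "submodule N R M" "submodule P R M"
  shows "N \<subseteq> N <+>\<^bsub>M\<^esub> P" "P \<subseteq> N <+>\<^bsub>M\<^esub> P"
proof -
  note N = submoduleE(1)[OF assms(1)] submodule_zero_closed[OF assms(1)]
  note P = submoduleE(1)[OF assms(2)] submodule_zero_closed[OF assms(2)]
  show "N \<subseteq> N <+>\<^bsub>M\<^esub> P"
  proof
    fix x assume "x \<in> N"
    then have "x = x \<oplus>\<^bsub>M\<^esub> \<zero>\<^bsub>M\<^esub>" using N by auto
    then show "x \<in> N <+>\<^bsub>M\<^esub> P" using \<open>x \<in> N\<close> P by (auto simp: set_add_def' simp del: M.r_zero)
  qed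
  show "P \<subseteq> N <+>\<^bsub>M\<^esub> P"
  proof
    fix x assume "x \<in> P"
    then have "x = \<zero>\<^bsub>M\<^esub> \<oplus>\<^bsub>M\<^esub> x" using P by auto
    then show "x \<in> N <+>\<^bsub>M\<^esub> P" using \<open>x \<in> P\<close> N by (auto simp: set_add_def' simp del: M.l_zero)
  qed
qed

lemma submodule_cyclic:
  assumes "s \<in> carrier M"
  shows "submodule {r \<odot>\<^bsub>M\<^esub> s | r. r \<in> carrier R} R M"
proof (rule submoduleI)
  show "\<zero>\<^bsub>M\<^esub> \<in> {r \<odot>\<^bsub>M\<^esub> s | r. r \<in> carrier R}" using smult_l_null[OF assms] by force
  show "\<ominus>\<^bsub>M\<^esub> a \<in> {r \<odot>\<^bsub>M\<^esub> s | r. r \<in> carrier R}" if "a \<in> {r \<odot>\<^bsub>M\<^esub> s | r. r \<in> carrier R}" for a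
    using that assms by (auto simp flip: smult_l_minus)
  show "a \<oplus>\<^bsub>M\<^esub> b \<in> {r \<odot>\<^bsub>M\<^esub> s | r. r \<in> carrier R}"
    if "a \<in> {r \<odot>\<^bsub>M\<^esub> s | r. r \<in> carrier R}" "b \<in> {r \<odot>\<^bsub>M\<^esub> s | r. r \<in> carrier R}" for a b
    using that assms by (auto simp flip: smult_l_distr)
  show "a \<odot>\<^bsub>M\<^esub> b \<in> {r \<odot>\<^bsub>M\<^esub> s | r. r \<in> carrier R}"
    if "a \<in> carrier R" "b \<in> {r \<odot>\<^bsub>M\<^esub> s | r. r \<in> carrier R}" for a b
    using that assms by (auto simp flip: smult_assoc1)
qed (use assms in auto)

lemma submodule_span_insert:
  assumes "s \<in> carrier M" "S \<subseteq> carrier M" "x \<in> submodule_span R M (insert s S)"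
  obtains r u where "r \<in> carrier R" "u \<in> submodule_span R M S" "x = r \<odot>\<^bsub>M\<^esub> s \<oplus>\<^bsub>M\<^esub> u"
proof -
  let ?L = "{r \<odot>\<^bsub>M\<^esub> s | r. r \<in> carrier R}"
  note sub = submodule_cyclic[OF assms(1)] submodule_span_submodule[OF assms(2)]
  have "s \<in> ?L" using assms(1) smult_one by force
  then have "submodule_span R M (insert s S) \<subseteq> ?L <+>\<^bsub>M\<^esub> submodule_span R M S"
    using submodule_sum_upper[OF sub] submodule_span_superset[of S]
    by (intro submodule_span_least submodule_sum sub) auto
  then show ?thesis using assms(3) that by (auto simp: set_add_def')
qed

text \<open>Submodules of \<open>R s + U\<close> are studied by a leading coefficient argument, as in Hilbert's basis
theorem: the coefficients of \<open>s\<close> that occur in \<open>P\<close> form an ideal, and \<open>P\<close> is controlled by this ideal together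
with \<open>P \<inter> U\<close>.\<close>

lemma ideal_of_coefficients:
  assumes "s \<in> carrier M" "submodule U R M" "submodule P R M"
  shows "ideal {r \<in> carrier R. \<exists>u\<in>U. r \<odot>\<^bsub>M\<^esub> s \<oplus>\<^bsub>M\<^esub> u \<in> P} R" (is "ideal ?J R")
proof -
  note U = submoduleE[OF assms(2)] submodule_zero_closed[OF assms(2)]
  note P = submoduleE[OF assms(3)] submodule_zero_closed[OF assms(3)]
  have 0: "\<zero> \<in> ?J" using assms(1) U P by force
  have 1: "r \<oplus> r' \<in> ?J" if r: "r \<in> ?J" "r' \<in> ?J" for r r'
  proof -
    obtain u u' where u: "u \<in> U" "r \<odot>\<^bsub>M\<^esub> s \<oplus>\<^bsub>M\<^esub> u \<in> P" "u' \<in> U" "r' \<odot>\<^bsub>M\<^esub> s \<oplus>\<^bsub>M\<^esub> u' \<in> P"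
      using r by auto
    have "u \<in> carrier M" "u' \<in> carrier M" using u U(1) by auto
    then have "(r \<oplus> r') \<odot>\<^bsub>M\<^esub> s \<oplus>\<^bsub>M\<^esub> (u \<oplus>\<^bsub>M\<^esub> u') = (r \<odot>\<^bsub>M\<^esub> s \<oplus>\<^bsub>M\<^esub> u) \<oplus>\<^bsub>M\<^esub> (r' \<odot>\<^bsub>M\<^esub> s \<oplus>\<^bsub>M\<^esub> u')"
      using r assms(1) by (simp add: smult_l_distr M.a_ac)
    moreover have "u \<oplus>\<^bsub>M\<^esub> u' \<in> U" "r \<oplus> r' \<in> carrier R"
      "(r \<odot>\<^bsub>M\<^esub> s \<oplus>\<^bsub>M\<^esub> u) \<oplus>\<^bsub>M\<^esub> (r' \<odot>\<^bsub>M\<^esub> s \<oplus>\<^bsub>M\<^esub> u') \<in> P"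
      using r u U(5) P(5) by auto
    ultimately show ?thesis by (metis (mono_tags, lifting) mem_Collect_eq)
  qed
  have 2: "a \<otimes> r \<in> ?J" if r: "r \<in> ?J" "a \<in> carrier R" for r a
  proof -
    obtain u where u: "u \<in> U" "r \<odot>\<^bsub>M\<^esub> s \<oplus>\<^bsub>M\<^esub> u \<in> P" using r by auto
    have "(a \<otimes> r) \<odot>\<^bsub>M\<^esub> s \<oplus>\<^bsub>M\<^esub> a \<odot>\<^bsub>M\<^esub> u = a \<odot>\<^bsub>M\<^esub> (r \<odot>\<^bsub>M\<^esub> s \<oplus>\<^bsub>M\<^esub> u)"
      using r u U(1) assms(1) by (subst smult_r_distr) (auto simp: smult_assoc1)
    moreover have "a \<odot>\<^bsub>M\<^esub> u \<in> U" "a \<otimes> r \<in> carrier R" "a \<odot>\<^bsub>M\<^esub> (r \<odot>\<^bsub>M\<^esub> s \<oplus>\<^bsub>M\<^esub> u) \<in> P"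
      using r u U(4) P(4) by auto
    ultimately show ?thesis by (metis (mono_tags, lifting) mem_Collect_eq)
  qed
  show ?thesis
  proof (rule idealI)
    show "subgroup ?J (add_monoid R)"
    proof (rule R.add.subgroupI)
      show "\<ominus> a \<in> ?J" if "a \<in> ?J" for a using 2[OF that, of "\<ominus> \<one>"] that by (simp add: R.l_minus)
    qed (use 0 1 in auto)
    show "x \<otimes> a \<in> ?J" if "a \<in> ?J" "x \<in> carrier R" for a x using 2[OF that] .
    show "a \<otimes> x \<in> ?J" if "a \<in> ?J" "x \<in> carrier R" for a x using 2[OF that] that by (simp add: m_comm)
  qed (rule ring_axioms)
qed

text \<open>Lifting generators of the coefficient ideal: finitely many elements of \<open>P\<close> realize every
coefficient that \<open>P\<close> realizes.\<close>

lemma finite_coefficient_lift: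
  assumes "noetherian_ring R" "s \<in> carrier M" "submodule U R M" "submodule P R M"
  obtains T where "finite T" "T \<subseteq> P"
    "\<And>r u. r \<in> carrier R \<Longrightarrow> u \<in> U \<Longrightarrow> r \<odot>\<^bsub>M\<^esub> s \<oplus>\<^bsub>M\<^esub> u \<in> P \<Longrightarrow>
       \<exists>t\<in>submodule_span R M T. \<exists>v\<in>U. t = r \<odot>\<^bsub>M\<^esub> s \<oplus>\<^bsub>M\<^esub> v"
proof -
  let ?J = "\<lambda>P. {r \<in> carrier R. \<exists>u\<in>U. r \<odot>\<^bsub>M\<^esub> s \<oplus>\<^bsub>M\<^esub> u \<in> P}"
  note P = submoduleE[OF assms(4)]
  obtain B where B: "B \<subseteq> carrier R" "finite B" "?J P = Idl B"
    using noetherian_ring.finetely_gen[OF assms(1) ideal_of_coefficients[OF assms(2-4)]] by metis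
  have "\<forall>r\<in>B. \<exists>p\<in>P. \<exists>u\<in>U. p = r \<odot>\<^bsub>M\<^esub> s \<oplus>\<^bsub>M\<^esub> u"
    using genideal_self[OF B(1)] B(3) by blast
  then obtain p where p: "\<And>r. r \<in> B \<Longrightarrow> p r \<in> P" "\<And>r. r \<in> B \<Longrightarrow> \<exists>u\<in>U. p r = r \<odot>\<^bsub>M\<^esub> s \<oplus>\<^bsub>M\<^esub> u"
    by metis
  let ?T = "p ` B"
  have T: "?T \<subseteq> P" "?T \<subseteq> carrier M" using p(1) P(1) by auto
  have "ideal (?J (submodule_span R M ?T)) R"
    using T by (intro ideal_of_coefficients assms submodule_span_submodule)
  moreover have "B \<subseteq> ?J (submodule_span R M ?T)"
  proof
    fix r assume r: "r \<in> B"
    then obtain u where u: "u \<in> U" "p r = r \<odot>\<^bsub>M\<^esub> s \<oplus>\<^bsub>M\<^esub> u" using p(2) by blast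
    have "p r \<in> submodule_span R M ?T" using r submodule_span_superset[of ?T] by auto
    then show "r \<in> ?J (submodule_span R M ?T)" using r u B(1) by auto
  qed
  ultimately have "Idl B \<subseteq> ?J (submodule_span R M ?T)"
    by (rule genideal_minimal)
  then have "?J P \<subseteq> ?J (submodule_span R M ?T)"
    unfolding B(3) .
  then show ?thesis using B(2) T(1) by (intro that[of ?T]) blast+
qed

text \<open>Induction on the number of generators.  An element of \<open>P\<close> differs from a combination of the
lifted elements by an element of \<open>P \<inter> U\<close>, to which the induction hypothesis applies.\<close>

lemma submodule_finitely_generated:
  assumes "noetherian_ring R" "finite S" "S \<subseteq> carrier M" "submodule P R M" "P \<subseteq> submodule_span R M S"
  shows "\<exists>T. finite T \<and> T \<subseteq> P \<and> P \<subseteq> submodule_span R M T"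
  using assms(2-)
proof (induction S arbitrary: P rule: finite_induct)
  case empty
  then show ?case by (intro exI[of _ "{}"]) auto
next
  case (insert s S)
  let ?U = "submodule_span R M S"
  have s: "s \<in> carrier M" and S: "S \<subseteq> carrier M" using insert.prems by auto
  note U = submodule_span_submodule[OF S]
  obtain T1 where T1: "finite T1" "T1 \<subseteq> P"
    "\<And>r u. r \<in> carrier R \<Longrightarrow> u \<in> ?U \<Longrightarrow> r \<odot>\<^bsub>M\<^esub> s \<oplus>\<^bsub>M\<^esub> u \<in> P \<Longrightarrow>
       \<exists>t\<in>submodule_span R M T1. \<exists>v\<in>?U. t = r \<odot>\<^bsub>M\<^esub> s \<oplus>\<^bsub>M\<^esub> v"
    using finite_coefficient_lift[OF assms(1) s U insert.prems(2)] by metis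
  obtain T2 where T2: "finite T2" "T2 \<subseteq> P \<inter> ?U" "P \<inter> ?U \<subseteq> submodule_span R M T2"
    using insert.IH[of "P \<inter> ?U"] S insert.prems U submodule_Int by auto
  have Pc: "P \<subseteq> carrier M" using submoduleE(1)[OF insert.prems(2)] .
  have Tc: "T1 \<union> T2 \<subseteq> carrier M" using T1 T2 Pc by auto
  note span = submodule_span_submodule[OF Tc]
  have "P \<subseteq> submodule_span R M (T1 \<union> T2)"
  proof
    fix x assume x: "x \<in> P"
    then obtain r u where ru: "r \<in> carrier R" "u \<in> ?U" "x = r \<odot>\<^bsub>M\<^esub> s \<oplus>\<^bsub>M\<^esub> u"
      using submodule_span_insert[OF s S] insert.prems(3) by blast
    then obtain t v where t: "t \<in> submodule_span R M T1" "v \<in> ?U" "t = r \<odot>\<^bsub>M\<^esub> s \<oplus>\<^bsub>M\<^esub> v"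
      using T1(3) x by blast
    have c: "u \<in> carrier M" "v \<in> carrier M" "r \<odot>\<^bsub>M\<^esub> s \<in> carrier M" using ru t s submoduleE(1)[OF U] by auto
    have tP: "t \<in> P" using t(1) submodule_span_least[OF insert.prems(2) T1(2)] by auto
    have eq: "x \<ominus>\<^bsub>M\<^esub> t = u \<ominus>\<^bsub>M\<^esub> v"
      using c ru(3) t(3) by (simp add: a_minus_def M.minus_add M.a_ac M.r_neg M.r_neg2 M.r_neg1)
    have "x \<ominus>\<^bsub>M\<^esub> t \<in> P" using x tP by (rule submodule_minus_closed[OF insert.prems(2)])
    moreover have "x \<ominus>\<^bsub>M\<^esub> t \<in> ?U"
      unfolding eq using ru(2) t(2) by (rule submodule_minus_closed[OF U])
    ultimately have "x \<ominus>\<^bsub>M\<^esub> t \<in> P \<inter> ?U" by blast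
    then have "x \<ominus>\<^bsub>M\<^esub> t \<in> submodule_span R M (T1 \<union> T2)" 
      using T2(3) submodule_span_mono[of T2 "T1 \<union> T2"] by auto
    moreover have "t \<in> submodule_span R M (T1 \<union> T2)" 
      using t(1) submodule_span_mono[of T1 "T1 \<union> T2"] by auto
    ultimately show "x \<in> submodule_span R M (T1 \<union> T2)" using x Pc by (blast intro: submodule_diff_cancel[OF span])
  qed
  then show ?case using T1 T2 by (intro exI[of _ "T1 \<union> T2"]) auto
qed

end

section \<open>Finite generation relative to a submodule\<close>

text \<open>\<open>P\<close> is generated by \<open>N\<close> and finitely many further elements.  For \<open>N \<subseteq> P\<close> this says that \<open>P/N\<close> is finitely
generated, without forming the quotient; for \<open>N = {}\<close> it says that \<open>P\<close> is finitely generated.\<close>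

definition finite_over ::
    "('r, 'k) ring_scheme \<Rightarrow> ('r, 'm, 's) module_scheme \<Rightarrow> 'm set \<Rightarrow> 'm set \<Rightarrow> bool" where
  "finite_over R M N P \<longleftrightarrow> (\<exists>T. finite T \<and> T \<subseteq> P \<and> P \<subseteq> submodule_span R M (T \<union> N))"

context module begin

lemma finite_over_mono: "finite_over R M N P \<Longrightarrow> N \<subseteq> N' \<Longrightarrow> finite_over R M N' P"
  unfolding finite_over_def by (meson Un_mono order_refl submodule_span_mono subset_trans)

lemma finite_over_trans:
  assumes "finite_over R M N P" "finite_over R M N' N" "N' \<subseteq> N" "N \<subseteq> P" "P \<subseteq> carrier M"
  shows "finite_over R M N' P"
proof -
  obtain T T' where T: "finite T" "T \<subseteq> P" "P \<subseteq> submodule_span R M (T \<union> N)"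
    "finite T'" "T' \<subseteq> N" "N \<subseteq> submodule_span R M (T' \<union> N')"
    using assms(1,2) unfolding finite_over_def by metis
  have c: "T \<union> T' \<union> N' \<subseteq> carrier M" using T assms by auto
  have "N \<subseteq> submodule_span R M (T \<union> T' \<union> N')"
    using T(6) submodule_span_mono[of "T' \<union> N'" "T \<union> T' \<union> N'"] by auto
  then have "submodule_span R M (T \<union> N) \<subseteq> submodule_span R M (T \<union> T' \<union> N')"
    using submodule_span_superset[of "T \<union> T' \<union> N'"]
    by (intro submodule_span_least submodule_span_submodule c) auto
  then have "P \<subseteq> submodule_span R M (T \<union> T' \<union> N')" using T(3) by simp
  moreover have "finite (T \<union> T')" "T \<union> T' \<subseteq> P" using T assms(4) by auto
  ultimately show ?thesis unfolding finite_over_def by blast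
qed

text \<open>A subset of \<open>K\<close> spans the same submodule in \<open>K\<close> as in \<open>M\<close>.\<close>

lemma submodule_fg_iff:
  assumes K: "submodule K R M"
  shows "fg_module R (M\<lparr>carrier := K\<rparr>) \<longleftrightarrow> finite_over R M {} K"
proof -
  interpret K: module R "M\<lparr>carrier := K\<rparr>"
    using submodule.submodule_is_module[OF K module_axioms] .
  note Ke = submoduleE[OF K] submodule_zero_closed[OF K]
  have minus: "\<ominus>\<^bsub>M\<lparr>carrier := K\<rparr>\<^esub> x = \<ominus>\<^bsub>M\<^esub> x" if "x \<in> K" for x
    using that Ke by (intro K.minus_equality) (auto simp: M.l_neg subset_iff)
  have 1: "submodule N R (M\<lparr>carrier := K\<rparr>)" if "submodule N R M" "N \<subseteq> K" for N
    using submoduleE[OF that(1)] submodule_zero_closed[OF that(1)] that(2) minus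
    by (intro K.submoduleI) (auto simp: subset_iff)
  have 2: "submodule N R M \<and> N \<subseteq> K" if "submodule N R (M\<lparr>carrier := K\<rparr>)" for N
    using K.submoduleE[OF that] K.submodule_zero_closed[OF that] minus Ke(1)
    by (intro conjI submoduleI) (auto simp: subset_iff)
  have 3: "submodule_span R (M\<lparr>carrier := K\<rparr>) T = submodule_span R M T" if T: "T \<subseteq> K" for T
  proof
    show "submodule_span R (M\<lparr>carrier := K\<rparr>) T \<subseteq> submodule_span R M T"
      using T Ke(1) submodule_span_superset
      by (intro K.submodule_span_least 1 submodule_span_submodule submodule_span_least K) auto
    show "submodule_span R M T \<subseteq> submodule_span R (M\<lparr>carrier := K\<rparr>) T"
      using T K.submodule_span_superset 2[OF K.submodule_span_submodule[of T]]
      by (intro submodule_span_least) auto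
  qed
  have "submodule_span R M T \<subseteq> K" if "T \<subseteq> K" for T using that by (rule submodule_span_least[OF K])
  then have "(T \<subseteq> K \<and> finite T \<and> submodule_span R M T = K) \<longleftrightarrow> (finite T \<and> T \<subseteq> K \<and> K \<subseteq> submodule_span R M T)" for T
    by auto
  then show ?thesis
    unfolding fg_module_def finite_over_def using 3 by (simp cong: conj_cong)
qed

end

lemma linear_image_submodule:
  assumes "module R M" "module R P" "is_linear R M P g" "submodule N R M"
  shows "submodule (g ` N) R P"
proof -
  interpret M: module R M by fact
  interpret P: module R P by fact
  note g = is_linearD[OF assms(3)] is_linear_zero_minus[OF assms(1-3)]
  note N = M.submoduleE[OF assms(4)] M.submodule_zero_closed[OF assms(4)]
  have c: "\<And>x. x \<in> N \<Longrightarrow> x \<in> carrier M" using N(1) by auto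
  show ?thesis
  proof (rule P.submoduleI)
    show "\<zero>\<^bsub>P\<^esub> \<in> g ` N" using N g(4) by (metis image_eqI)
    show "\<ominus>\<^bsub>P\<^esub> a \<in> g ` N" if "a \<in> g ` N" for a using that N(3) c by (auto simp flip: g)
    show "a \<oplus>\<^bsub>P\<^esub> b \<in> g ` N" if "a \<in> g ` N" "b \<in> g ` N" for a b
      using that N(5) c by (auto simp flip: g)
    show "a \<odot>\<^bsub>P\<^esub> b \<in> g ` N" if "a \<in> carrier R" "b \<in> g ` N" for a b
      using that N(4) c by (auto simp flip: g)
  qed (use g c in auto)
qed

text \<open>The image of \<open>N\<close> is a submodule of a finitely generated module, so it is finitely generated; preimages
of its generators generate \<open>N\<close> modulo the kernel.\<close>

lemma finite_over_kernel:
  assumes "noetherian_ring R" "module R M" "module R P" "is_linear R M P g" "submodule N R M"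
    "finite S" "S \<subseteq> carrier P" "g ` N \<subseteq> submodule_span R P S"
  shows "finite_over R M {x \<in> N. g x = \<zero>\<^bsub>P\<^esub>} N"
proof -
  interpret M: module R M by fact
  interpret P: module R P by fact
  note g = is_linearD[OF assms(4)] is_linear_zero_minus[OF assms(2-4)]
  note N = M.submoduleE[OF assms(5)] M.submodule_zero_closed[OF assms(5)]
  have c: "\<And>x. x \<in> N \<Longrightarrow> x \<in> carrier M" using N(1) by auto
  have img: "submodule (g ` N) R P" by (rule linear_image_submodule[OF assms(2-5)])
  obtain T0 where T0: "finite T0" "T0 \<subseteq> g ` N" "g ` N \<subseteq> submodule_span R P T0"
    using P.submodule_finitely_generated[OF assms(1,6,7) img assms(8)] by blast
  obtain T where T: "finite T" "T \<subseteq> N" "T0 = g ` T"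
    using T0(1,2) by (metis finite_subset_image)
  let ?K = "{x \<in> N. g x = \<zero>\<^bsub>P\<^esub>}"
  have Tc: "T \<union> ?K \<subseteq> carrier M" using T N(1) by auto
  let ?V = "submodule_span R M (T \<union> ?K)"
  note V = M.submodule_span_submodule[OF Tc]
  have VN: "?V \<subseteq> N" using T by (intro M.submodule_span_least assms) auto
  have imgV: "submodule (g ` ?V) R P" by (rule linear_image_submodule[OF assms(2-4) V])
  have sp: "submodule_span R P T0 \<subseteq> g ` ?V"
    using M.submodule_span_superset[of "T \<union> ?K"] T(3) by (intro P.submodule_span_least imgV) auto
  have "N \<subseteq> ?V"
  proof
    fix x assume x: "x \<in> N"
    then obtain v where v: "v \<in> ?V" "g x = g v" using T0(3) sp by blast
    have "v \<in> N" using v VN by auto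
    then have "x \<ominus>\<^bsub>M\<^esub> v \<in> ?K" using x v c g M.submodule_minus_closed[OF assms(5)]
      by (auto simp: a_minus_def P.r_neg)
    then have "x \<ominus>\<^bsub>M\<^esub> v \<in> ?V" using M.submodule_span_superset[of "T \<union> ?K"] by auto
    then show "x \<in> ?V" using v(1) c[OF x] by (rule M.submodule_diff_cancel[OF V])
  qed
  then show ?thesis unfolding finite_over_def using T by blast
qed

lemma finite_over_common_kernel:
  assumes "noetherian_ring R" "module R M" "module R P" "submodule N R M" "finite I"
    and lin: "\<And>i. i \<in> I \<Longrightarrow> is_linear R M P (g i)"
    and fg: "\<And>i. i \<in> I \<Longrightarrow>
      \<exists>S. finite S \<and> S \<subseteq> carrier P \<and> g i ` N \<subseteq> submodule_span R P S"
  shows "finite_over R M {x \<in> N. \<forall>i\<in>I. g i x = \<zero>\<^bsub>P\<^esub>} N"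
proof -
  interpret M: module R M by fact
  interpret P: module R P by fact
  let ?K = "\<lambda>I. {x \<in> N. \<forall>i\<in>I. g i x = \<zero>\<^bsub>P\<^esub>}"
  have "submodule (?K I) R M \<and> finite_over R M (?K I) N"
    using \<open>finite I\<close> lin fg
  proof (induction I rule: finite_induct)
    case empty
    have "finite_over R M N N"
      unfolding finite_over_def using M.submodule_span_superset by (intro exI[of _ "{}"]) auto
    then show ?case using assms(4) by simp
  next
    case (insert i I)
    have IH: "submodule (?K I) R M" "finite_over R M (?K I) N" using insert by auto
    have lin: "is_linear R M P (g i)" using insert by auto
    obtain S where S: "finite S" "S \<subseteq> carrier P" "g i ` N \<subseteq> submodule_span R P S"
      using insert.prems(2)[of i] by auto
    have eq: "?K (insert i I) = {x \<in> ?K I. g i x = \<zero>\<^bsub>P\<^esub>}" by auto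
    have "g i ` ?K I \<subseteq> submodule_span R P S" using S(3) by auto
    then have "finite_over R M (?K (insert i I)) (?K I)"
      unfolding eq by (rule finite_over_kernel[OF assms(1-3) lin IH(1) S(1,2)])
    moreover have "submodule (?K (insert i I)) R M"
      unfolding eq using submodule_vimage[OF assms(2,3) lin P.submodule_zero IH(1)] by simp
    ultimately show ?case
      using M.finite_over_trans[OF IH(2)] M.submoduleE(1)[OF assms(4)] by auto
  qed
  then show ?thesis by simp
qed

section \<open>Homomorphic images and quotients\<close>

text \<open>All quotients and transported modules below are surjective images under maps that respect the
operations, so the module laws are checked once.\<close>

lemma left_module_hom_image:
  assumes "left_module A M" and q: "q ` carrier M = carrier X"
    and add: "\<And>x y. x \<in> carrier M \<Longrightarrow> y \<in> carrier M \<Longrightarrow> q (x \<oplus>\<^bsub>M\<^esub> y) = q x \<oplus>\<^bsub>X\<^esub> q y"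
    and zero: "q \<zero>\<^bsub>M\<^esub> = \<zero>\<^bsub>X\<^esub>"
    and smult: "\<And>a x. a \<in> carrier A \<Longrightarrow> x \<in> carrier M \<Longrightarrow> q (a \<odot>\<^bsub>M\<^esub> x) = a \<odot>\<^bsub>X\<^esub> q x"
  shows "left_module A X"
proof -
  interpret M: left_module A M by fact
  have ex: "\<exists>x\<in>carrier M. u = q x" if "u \<in> carrier X" for u using that q by auto
  have c: "q x \<in> carrier X" if "x \<in> carrier M" for x using that q by auto
  have "abelian_group X"
  proof (rule abelian_groupI)
    show "\<zero>\<^bsub>X\<^esub> \<in> carrier X" using c[of "\<zero>\<^bsub>M\<^esub>"] zero by simp
    show "u \<oplus>\<^bsub>X\<^esub> v \<in> carrier X" if "u \<in> carrier X" "v \<in> carrier X" for u v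
      using ex[OF that(1)] ex[OF that(2)] c by (auto simp flip: add)
    show "u \<oplus>\<^bsub>X\<^esub> v \<oplus>\<^bsub>X\<^esub> w = u \<oplus>\<^bsub>X\<^esub> (v \<oplus>\<^bsub>X\<^esub> w)"
      if "u \<in> carrier X" "v \<in> carrier X" "w \<in> carrier X" for u v w
      using ex[OF that(1)] ex[OF that(2)] ex[OF that(3)] by (auto simp: M.X.a_assoc simp flip: add)
    show "u \<oplus>\<^bsub>X\<^esub> v = v \<oplus>\<^bsub>X\<^esub> u" if "u \<in> carrier X" "v \<in> carrier X" for u v
      using ex[OF that(1)] ex[OF that(2)] by (auto simp: M.X.a_comm simp flip: add)
    show "\<zero>\<^bsub>X\<^esub> \<oplus>\<^bsub>X\<^esub> u = u" if "u \<in> carrier X" for u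
      using ex[OF that] by (auto simp flip: add zero)
    show "\<exists>v\<in>carrier X. v \<oplus>\<^bsub>X\<^esub> u = \<zero>\<^bsub>X\<^esub>" if u: "u \<in> carrier X" for u
    proof -
      obtain x where x: "x \<in> carrier M" "u = q x" using ex[OF u] by auto
      then have "q (\<ominus>\<^bsub>M\<^esub> x) \<oplus>\<^bsub>X\<^esub> u = \<zero>\<^bsub>X\<^esub>" by (simp add: M.X.l_neg zero flip: add)
      then show ?thesis using c[of "\<ominus>\<^bsub>M\<^esub> x"] x by auto
    qed
  qed
  then show ?thesis
  proof (intro left_module.intro left_module_axioms.intro M.ring_axioms)
    show "a \<odot>\<^bsub>X\<^esub> u \<in> carrier X" if "a \<in> carrier A" "u \<in> carrier X" for a u
      using ex[OF that(2)] that(1) c M.smult_closed by (auto simp flip: smult)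
    show "(a \<oplus>\<^bsub>A\<^esub> b) \<odot>\<^bsub>X\<^esub> u = a \<odot>\<^bsub>X\<^esub> u \<oplus>\<^bsub>X\<^esub> b \<odot>\<^bsub>X\<^esub> u"
      if "a \<in> carrier A" "b \<in> carrier A" "u \<in> carrier X" for a b u
      using ex[OF that(3)] that(1,2) M.smult_closed by (auto simp: M.smult_l_distr simp flip: add smult)
    show "a \<odot>\<^bsub>X\<^esub> (u \<oplus>\<^bsub>X\<^esub> v) = a \<odot>\<^bsub>X\<^esub> u \<oplus>\<^bsub>X\<^esub> a \<odot>\<^bsub>X\<^esub> v"
      if "a \<in> carrier A" "u \<in> carrier X" "v \<in> carrier X" for a u v
      using ex[OF that(2)] ex[OF that(3)] that(1) M.smult_closed
      by (auto simp: M.smult_r_distr simp flip: add smult)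
    show "(a \<otimes>\<^bsub>A\<^esub> b) \<odot>\<^bsub>X\<^esub> u = a \<odot>\<^bsub>X\<^esub> (b \<odot>\<^bsub>X\<^esub> u)"
      if "a \<in> carrier A" "b \<in> carrier A" "u \<in> carrier X" for a b u
      using ex[OF that(3)] that(1,2) M.smult_closed by (auto simp: M.smult_assoc1 simp flip: smult)
    show "\<one>\<^bsub>A\<^esub> \<odot>\<^bsub>X\<^esub> u = u" if "u \<in> carrier X" for u
      using ex[OF that] by (auto simp: M.smult_one simp flip: smult)
  qed
qed

lemma module_iff_left_module: "module R M \<longleftrightarrow> cring R \<and> left_module R M"
proof
  assume "module R M"
  then interpret module R M .
  show "cring R \<and> left_module R M"
    by (intro conjI is_cring left_module.intro left_module_axioms.intro ring_axioms M.abelian_group_axioms)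
      (auto simp: smult_l_distr smult_r_distr smult_assoc1)
next
  assume a: "cring R \<and> left_module R M"
  then interpret left_module R M by simp
  show "module R M"
    using a by (intro moduleI X.abelian_group_axioms)
      (auto simp: smult_l_distr smult_r_distr smult_assoc1 smult_one smult_closed)
qed

lemma module_hom_image:
  assumes "module R M" and "q ` carrier M = carrier X"
    and "\<And>x y. x \<in> carrier M \<Longrightarrow> y \<in> carrier M \<Longrightarrow> q (x \<oplus>\<^bsub>M\<^esub> y) = q x \<oplus>\<^bsub>X\<^esub> q y"
    and "q \<zero>\<^bsub>M\<^esub> = \<zero>\<^bsub>X\<^esub>"
    and "\<And>a x. a \<in> carrier R \<Longrightarrow> x \<in> carrier M \<Longrightarrow> q (a \<odot>\<^bsub>M\<^esub> x) = a \<odot>\<^bsub>X\<^esub> q x"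
  shows "module R X"
  using assms left_module_hom_image[of R M q X] unfolding module_iff_left_module by blast

text \<open>The module structure carried over to the range of a map \<open>q\<close> whose fibres are the cosets of a submodule.
It serves to realize a quotient of \<open>M\<close> inside a prescribed type.\<close>

definition image_module :: "('a, 'm, 's) module_scheme \<Rightarrow> ('m \<Rightarrow> 'n) \<Rightarrow> ('a, 'n) module" where
  "image_module M q = (let rep = inv_into (carrier M) q in
     \<lparr>carrier = q ` carrier M, mult = undefined, one = undefined, zero = q \<zero>\<^bsub>M\<^esub>,
      add = (\<lambda>u v. q (rep u \<oplus>\<^bsub>M\<^esub> rep v)), smult = (\<lambda>a u. q (a \<odot>\<^bsub>M\<^esub> rep u))\<rparr>)"

lemma image_module:
  assumes "left_module A M"
    and ker: "\<And>x y. x \<in> carrier M \<Longrightarrow> y \<in> carrier M \<Longrightarrow> q x = q y \<longleftrightarrow> x \<ominus>\<^bsub>M\<^esub> y \<in> N"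
    and N: "\<And>x y. x \<in> N \<Longrightarrow> y \<in> N \<Longrightarrow> x \<oplus>\<^bsub>M\<^esub> y \<in> N"
      "\<And>a x. a \<in> carrier A \<Longrightarrow> x \<in> N \<Longrightarrow> a \<odot>\<^bsub>M\<^esub> x \<in> N"
  shows "left_module A (image_module M q)" (is ?module)
    and "x \<in> carrier M \<Longrightarrow> y \<in> carrier M \<Longrightarrow>
      q (x \<oplus>\<^bsub>M\<^esub> y) = q x \<oplus>\<^bsub>image_module M q\<^esub> q y" (is "?x \<Longrightarrow> ?y \<Longrightarrow> ?add")
    and "a \<in> carrier A \<Longrightarrow> x \<in> carrier M \<Longrightarrow> q (a \<odot>\<^bsub>M\<^esub> x) = a \<odot>\<^bsub>image_module M q\<^esub> q x"
      (is "_ \<Longrightarrow> _ \<Longrightarrow> ?smult")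
    and "carrier (image_module M q) = q ` carrier M"
    and "\<zero>\<^bsub>image_module M q\<^esub> = q \<zero>\<^bsub>M\<^esub>"
proof -
  interpret M: left_module A M by fact
  let ?rep = "inv_into (carrier M) q"
  have rep: "?rep (q x) \<in> carrier M" "x \<ominus>\<^bsub>M\<^esub> ?rep (q x) \<in> N" if "x \<in> carrier M" for x
  proof -
    show *: "?rep (q x) \<in> carrier M" using that by (auto intro: inv_into_into)
    have "q (?rep (q x)) = q x" using that by (auto intro: f_inv_into_f)
    then show "x \<ominus>\<^bsub>M\<^esub> ?rep (q x) \<in> N" using ker[of x "?rep (q x)"] * that by simp
  qed
  have add: "q (x \<oplus>\<^bsub>M\<^esub> y) = q x \<oplus>\<^bsub>image_module M q\<^esub> q y" if "x \<in> carrier M" "y \<in> carrier M" for x y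
  proof -
    let ?x = "?rep (q x)" and ?y = "?rep (q y)"
    have "(x \<oplus>\<^bsub>M\<^esub> y) \<ominus>\<^bsub>M\<^esub> (?x \<oplus>\<^bsub>M\<^esub> ?y) = (x \<ominus>\<^bsub>M\<^esub> ?x) \<oplus>\<^bsub>M\<^esub> (y \<ominus>\<^bsub>M\<^esub> ?y)"
      using rep(1)[OF that(1)] rep(1)[OF that(2)] that
      by (simp add: a_minus_def M.X.minus_add M.X.a_ac)
    also have "\<dots> \<in> N" using rep(2)[OF that(1)] rep(2)[OF that(2)] by (rule N(1))
    finally show ?thesis
      using that rep(1) by (simp add: image_module_def Let_def ker)
  qed
  have smult: "q (a \<odot>\<^bsub>M\<^esub> x) = a \<odot>\<^bsub>image_module M q\<^esub> q x" if "a \<in> carrier A" "x \<in> carrier M" for a x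
  proof -
    let ?x = "?rep (q x)"
    have neg: "a \<odot>\<^bsub>M\<^esub> (\<ominus>\<^bsub>M\<^esub> ?x) = \<ominus>\<^bsub>M\<^esub> (a \<odot>\<^bsub>M\<^esub> ?x)"
    proof (rule M.X.minus_equality[symmetric])
      have "a \<odot>\<^bsub>M\<^esub> \<zero>\<^bsub>M\<^esub> \<oplus>\<^bsub>M\<^esub> a \<odot>\<^bsub>M\<^esub> \<zero>\<^bsub>M\<^esub> = a \<odot>\<^bsub>M\<^esub> \<zero>\<^bsub>M\<^esub>"
        using that by (simp flip: M.smult_r_distr)
      then have "a \<odot>\<^bsub>M\<^esub> \<zero>\<^bsub>M\<^esub> = \<zero>\<^bsub>M\<^esub>"
        using that M.smult_closed by (metis M.X.add.l_cancel_one M.X.zero_closed)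
      then show "a \<odot>\<^bsub>M\<^esub> (\<ominus>\<^bsub>M\<^esub> ?x) \<oplus>\<^bsub>M\<^esub> a \<odot>\<^bsub>M\<^esub> ?x = \<zero>\<^bsub>M\<^esub>"
        using that rep(1)[OF that(2)] by (simp add: M.X.l_neg flip: M.smult_r_distr)
    qed (use that rep(1)[OF that(2)] M.smult_closed in auto)
    have "(a \<odot>\<^bsub>M\<^esub> x) \<ominus>\<^bsub>M\<^esub> (a \<odot>\<^bsub>M\<^esub> ?x) = a \<odot>\<^bsub>M\<^esub> (x \<ominus>\<^bsub>M\<^esub> ?x)"
      using that rep(1)[OF that(2)] by (simp add: a_minus_def M.smult_r_distr neg)
    also have "\<dots> \<in> N" using that(1) rep(2)[OF that(2)] by (rule N(2))
    finally show ?thesis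
      using that rep(1) M.smult_closed by (simp add: image_module_def Let_def ker)
  qed
  show "carrier (image_module M q) = q ` carrier M" "\<zero>\<^bsub>image_module M q\<^esub> = q \<zero>\<^bsub>M\<^esub>"
    by (auto simp: image_module_def Let_def)
  then show "left_module A (image_module M q)"
    using add smult by (intro left_module_hom_image[OF assms(1), of q]) auto
  show "?x \<Longrightarrow> ?y \<Longrightarrow> ?add" by (rule add)
  show "a \<in> carrier A \<Longrightarrow> ?x \<Longrightarrow> ?smult" by (rule smult)
qed

lemma base_module_simps [simp]:
  "carrier (base_module R) = carrier R" "mult (base_module R) = mult R"
  "one (base_module R) = one R" "zero (base_module R) = zero R" "add (base_module R) = add R"
  "smult (base_module R) = mult R"
  by (auto simp: base_module_def)

lemma base_module_minus [simp]:
  "a_inv (base_module R) = a_inv R" "a_minus (base_module R) = a_minus R"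
  by (auto simp: a_inv_def m_inv_def a_minus_def fun_eq_iff)

lemma restrict_scalars_simps [simp]:
  "carrier (restrict_scalars S X) = carrier X" "zero (restrict_scalars S X) = zero X"
  "add (restrict_scalars S X) = add X"
  "r \<odot>\<^bsub>restrict_scalars S X\<^esub> x = (r \<odot>\<^bsub>S\<^esub> \<one>\<^bsub>S\<^esub>) \<odot>\<^bsub>X\<^esub> x"
  by (simp_all add: restrict_scalars_def)

lemma (in ring) base_left_module: "left_module R (base_module R)"
proof (intro left_module.intro left_module_axioms.intro ring_axioms)
  show "abelian_group (base_module R)"
  proof (rule abelian_groupI)
    show "\<exists>y\<in>carrier (base_module R). y \<oplus>\<^bsub>base_module R\<^esub> x = \<zero>\<^bsub>base_module R\<^esub>"
      if "x \<in> carrier (base_module R)" for x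
      using that by (auto intro!: bexI[of _ "\<ominus> x"] simp: l_neg)
  qed (auto simp: a_assoc intro: a_comm)
qed (auto simp: m_assoc l_distr r_distr)

lemma (in cring) base_module: "module R (base_module R)"
  using base_left_module by (simp add: module_iff_left_module cring_axioms)

lemma (in cring) base_module_span: "submodule_span R (base_module R) {\<one>} = carrier R"
proof
  interpret B: module R "base_module R" by (rule base_module)
  show "submodule_span R (base_module R) {\<one>} \<subseteq> carrier R"
    using B.submodule_span_closed[of "{\<one>}"] by simp
  note sub = B.submodule_span_submodule[of "{\<one>}"]
  show "carrier R \<subseteq> submodule_span R (base_module R) {\<one>}"
  proof
    fix r assume "r \<in> carrier R"
    then show "r \<in> submodule_span R (base_module R) {\<one>}"
      using B.submoduleE(4)[OF sub, of r \<one>] B.submodule_span_superset[of "{\<one>}"] by simp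
  qed
qed

context module begin

lemma abelian_subgroup_of_submodule: "submodule N R M \<Longrightarrow> abelian_subgroup N M"
  by (intro abelian_subgroupI3 additive_subgroupI M.abelian_group_axioms) (auto simp: submodule_def)

lemma quotient_module_simps [simp]:
  "carrier (quotient_module M N) = (\<lambda>x. N +>\<^bsub>M\<^esub> x) ` carrier M"
  "\<zero>\<^bsub>quotient_module M N\<^esub> = N"
  by (auto simp: quotient_module_def A_RCOSETS_def')

lemma coset_eq_iff:
  assumes N: "submodule N R M" and x: "x \<in> carrier M" and y: "y \<in> carrier M"
  shows "N +>\<^bsub>M\<^esub> x = N +>\<^bsub>M\<^esub> y \<longleftrightarrow> x \<ominus>\<^bsub>M\<^esub> y \<in> N"
proof -
  interpret N: abelian_subgroup N M using N by (rule abelian_subgroup_of_submodule)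
  show ?thesis
    using N.a_rcos_module[OF y x] N.a_repr_independence'[of x y] N.a_rcos_self[OF x] x y
    by (auto simp: a_minus_def)
qed

lemma quotient_module_ops:
  assumes N: "submodule N R M"
  shows "x \<in> carrier M \<Longrightarrow> y \<in> carrier M \<Longrightarrow>
      N +>\<^bsub>M\<^esub> (x \<oplus>\<^bsub>M\<^esub> y) = (N +>\<^bsub>M\<^esub> x) \<oplus>\<^bsub>quotient_module M N\<^esub> (N +>\<^bsub>M\<^esub> y)"
    and "r \<in> carrier R \<Longrightarrow> x \<in> carrier M \<Longrightarrow>
      N +>\<^bsub>M\<^esub> (r \<odot>\<^bsub>M\<^esub> x) = r \<odot>\<^bsub>quotient_module M N\<^esub> (N +>\<^bsub>M\<^esub> x)"
    and "N +>\<^bsub>M\<^esub> \<zero>\<^bsub>M\<^esub> = N"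
proof -
  interpret N: abelian_subgroup N M using N by (rule abelian_subgroup_of_submodule)
  show "x \<in> carrier M \<Longrightarrow> y \<in> carrier M \<Longrightarrow>
      N +>\<^bsub>M\<^esub> (x \<oplus>\<^bsub>M\<^esub> y) = (N +>\<^bsub>M\<^esub> x) \<oplus>\<^bsub>quotient_module M N\<^esub> (N +>\<^bsub>M\<^esub> y)"
    by (simp add: quotient_module_def N.a_rcos_sum)
  show "N +>\<^bsub>M\<^esub> \<zero>\<^bsub>M\<^esub> = N" using N.a_subset by simp
  assume r: "r \<in> carrier R" and x: "x \<in> carrier M"
  have "N +>\<^bsub>M\<^esub> (r \<odot>\<^bsub>M\<^esub> y) = N +>\<^bsub>M\<^esub> (r \<odot>\<^bsub>M\<^esub> x)" if y: "y \<in> N +>\<^bsub>M\<^esub> x" for y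
  proof -
    have yc: "y \<in> carrier M" using y x N.a_elemrcos_carrier by blast
    then have "y \<ominus>\<^bsub>M\<^esub> x \<in> N" using y x N.a_rcos_module[OF x yc] by (simp add: a_minus_def)
    then have "r \<odot>\<^bsub>M\<^esub> (y \<ominus>\<^bsub>M\<^esub> x) \<in> N" using r submoduleE(4)[OF N] by blast
    then have "r \<odot>\<^bsub>M\<^esub> y \<ominus>\<^bsub>M\<^esub> r \<odot>\<^bsub>M\<^esub> x \<in> N"
      using r x yc by (simp add: a_minus_def smult_r_distr smult_r_minus)
    then show ?thesis using r x yc by (simp add: coset_eq_iff[OF N])
  qed
  then have "(\<Union>y\<in>N +>\<^bsub>M\<^esub> x. N +>\<^bsub>M\<^esub> (r \<odot>\<^bsub>M\<^esub> y)) = N +>\<^bsub>M\<^esub> (r \<odot>\<^bsub>M\<^esub> x)"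
    using N.a_rcos_self[OF x] by blast
  then show "N +>\<^bsub>M\<^esub> (r \<odot>\<^bsub>M\<^esub> x) = r \<odot>\<^bsub>quotient_module M N\<^esub> (N +>\<^bsub>M\<^esub> x)"
    by (simp add: quotient_module_def)
qed

lemma quotient_module_is_module:
  assumes "submodule N R M"
  shows "module R (quotient_module M N)"
  using quotient_module_ops[OF assms]
  by (intro module_hom_image[OF module_axioms, of "\<lambda>x. N +>\<^bsub>M\<^esub> x"]) auto

lemma quotient_projection_linear:
  assumes "submodule N R M"
  shows "is_linear R M (quotient_module M N) (\<lambda>x. N +>\<^bsub>M\<^esub> x)"
  using quotient_module_ops[OF assms] by (intro is_linearI) auto

end

lemma linear_image_span:
  assumes "module R M" "module R P" "is_linear R M P g" "S \<subseteq> carrier M"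
  shows "g ` submodule_span R M S = submodule_span R P (g ` S)"
proof
  interpret M: module R M by fact
  interpret P: module R P by fact
  have S: "g ` S \<subseteq> carrier P" using is_linearD(1)[OF assms(3)] assms(4) by auto
  have "submodule_span R M S \<subseteq> {x \<in> carrier M. g x \<in> submodule_span R P (g ` S)}"
    using assms(4) P.submodule_span_superset[of "g ` S"]
    by (intro M.submodule_span_least submodule_vimage[OF assms(1-3)] P.submodule_span_submodule S
        M.carrier_is_submodule) auto
  then show "g ` submodule_span R M S \<subseteq> submodule_span R P (g ` S)" by auto
  show "submodule_span R P (g ` S) \<subseteq> g ` submodule_span R M S"
    using M.submodule_span_superset[of S]
    by (intro P.submodule_span_least linear_image_submodule[OF assms(1-3)] M.submodule_span_submodule assms(4)) auto
qed

lemma (in module) quotient_fg_iff: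
  assumes N: "submodule N R M"
  shows "fg_module R (quotient_module M N) \<longleftrightarrow> finite_over R M N (carrier M)"
proof -
  let ?Q = "quotient_module M N" and ?q = "\<lambda>x. N +>\<^bsub>M\<^esub> x"
  interpret Q: module R ?Q using N by (rule quotient_module_is_module)
  note lin = quotient_projection_linear[OF N] and Nc = submoduleE(1)[OF N]
  have key: "submodule_span R ?Q (?q ` T) = carrier ?Q \<longleftrightarrow> carrier M \<subseteq> submodule_span R M (T \<union> N)"
    if T: "T \<subseteq> carrier M" for T
  proof
    assume *: "carrier M \<subseteq> submodule_span R M (T \<union> N)"
    have qT: "?q ` T \<subseteq> carrier ?Q" using T by auto
    have "?q x = \<zero>\<^bsub>?Q\<^esub>" if "x \<in> N" for x
      using that abelian_subgroup.a_rcos_const[OF abelian_subgroup_of_submodule[OF N]] by simp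
    then have "?q ` N \<subseteq> submodule_span R ?Q (?q ` T)"
      using Q.submodule_zero_closed[OF Q.submodule_span_submodule[OF qT]] by fastforce
    then have "?q ` (T \<union> N) \<subseteq> submodule_span R ?Q (?q ` T)"
      using Q.submodule_span_superset[of "?q ` T"] by (simp add: image_Un)
    then have "submodule_span R ?Q (?q ` (T \<union> N)) \<subseteq> submodule_span R ?Q (?q ` T)"
      using T by (intro Q.submodule_span_least Q.submodule_span_submodule) auto
    then have "?q ` submodule_span R M (T \<union> N) \<subseteq> submodule_span R ?Q (?q ` T)"
      using linear_image_span[OF module_axioms Q.module_axioms lin, of "T \<union> N"] T Nc by simp
    then have "?q ` carrier M \<subseteq> submodule_span R ?Q (?q ` T)" using * by blast
    then show "submodule_span R ?Q (?q ` T) = carrier ?Q"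
      using Q.submodule_span_closed[OF qT] by simp
  next
    assume *: "submodule_span R ?Q (?q ` T) = carrier ?Q"
    let ?V = "submodule_span R M (T \<union> N)"
    have V: "submodule ?V R M" by (rule submodule_span_submodule) (simp add: T Nc)
    show "carrier M \<subseteq> ?V"
    proof
      fix x assume x: "x \<in> carrier M"
      then have "?q x \<in> ?q ` submodule_span R M T"
        using * linear_image_span[OF module_axioms Q.module_axioms lin T] by auto
      then obtain v where v: "v \<in> submodule_span R M T" "?q x = ?q v" by auto
      have vc: "v \<in> carrier M" using v submodule_span_closed[OF T] by auto
      then have "x \<ominus>\<^bsub>M\<^esub> v \<in> N" using v(2) x by (simp add: coset_eq_iff[OF N])
      then have "x \<ominus>\<^bsub>M\<^esub> v \<in> ?V" using submodule_span_superset[of "T \<union> N"] by auto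
      moreover have "v \<in> ?V" using v(1) submodule_span_mono[of T "T \<union> N"] by auto
      ultimately show "x \<in> ?V" using x by (rule submodule_diff_cancel[OF V])
    qed
  qed
  have "fg_module R ?Q \<longleftrightarrow>
      (\<exists>T. finite T \<and> T \<subseteq> carrier M \<and> submodule_span R ?Q (?q ` T) = carrier ?Q)"
  proof
    assume "fg_module R ?Q"
    then obtain S where S: "finite S" "S \<subseteq> ?q ` carrier M" "submodule_span R ?Q S = carrier ?Q"
      unfolding fg_module_def by auto
    then obtain T where T: "T \<subseteq> carrier M" "finite T" "S = ?q ` T" by (meson finite_subset_image)
    then show "\<exists>T. finite T \<and> T \<subseteq> carrier M \<and> submodule_span R ?Q (?q ` T) = carrier ?Q"
      using S(3) by blast
  next
    assume "\<exists>T. finite T \<and> T \<subseteq> carrier M \<and> submodule_span R ?Q (?q ` T) = carrier ?Q"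
    then obtain T where T: "finite T" "T \<subseteq> carrier M" "submodule_span R ?Q (?q ` T) = carrier ?Q"
      by blast
    have "?q ` T \<subseteq> carrier ?Q" using T(2) by auto
    then show "fg_module R ?Q" unfolding fg_module_def using T(1,3) by blast
  qed
  also have "\<dots> \<longleftrightarrow> finite_over R M N (carrier M)"
    unfolding finite_over_def using key by blast
  finally show ?thesis .
qed

section \<open>The minimal condition over an artinian ring\<close>

lemma artinian_minimal_ideal:
  assumes "artinian_ring R" "\<F> \<noteq> {}" "\<And>I. I \<in> \<F> \<Longrightarrow> ideal I R"
  shows "\<exists>I\<in>\<F>. \<forall>J\<in>\<F>. J \<subseteq> I \<longrightarrow> J = I"
proof -
  let ?r = "{(J, I). ideal J R \<and> ideal I R \<and> J \<subset> I}"
  have "wf ?r"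
    unfolding wf_iff_no_infinite_down_chain
  proof
    assume "\<exists>f. \<forall>i. (f (Suc i), f i) \<in> ?r"
    then obtain f where f: "\<And>i. (f (Suc i), f i) \<in> ?r" by blast
    then have "\<forall>n. ideal (f n) R \<and> f (Suc n) \<subseteq> f n" by auto
    then obtain n where n: "\<And>m. m \<ge> n \<Longrightarrow> f m = f n" using assms(1) unfolding artinian_ring_def by blast
    have "f (Suc n) = f n" by (rule n) simp
    then show False using f[of n] by auto
  qed
  then obtain I where I: "I \<in> \<F>" "\<And>J. (J, I) \<in> ?r \<Longrightarrow> J \<notin> \<F>"
    by (rule wfE_min'[OF _ assms(2)]) blast
  have "J = I" if J: "J \<in> \<F>" "J \<subseteq> I" for J
  proof (rule ccontr)
    assume "J \<noteq> I"
    then have "(J, I) \<in> ?r" using J assms(3)[OF J(1)] assms(3)[OF I(1)] by simp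
    then show False using I(2) J(1) by blast
  qed
  then show ?thesis using I(1) by blast
qed

text \<open>The dual of the leading coefficient argument.  Among the members of the family whose coefficient ideal
is minimal, choose one whose intersection with the span of the remaining generators is minimal.  A
smaller member has the same coefficients and the same intersection, and is therefore equal to it.\<close>

lemma (in module) artinian_minimal_submodule:
  assumes "artinian_ring R" "submodule N R M" "finite S" "S \<subseteq> carrier M"
    "\<F> \<noteq> {}" "\<And>P. P \<in> \<F> \<Longrightarrow> submodule P R M \<and> N \<subseteq> P \<and> P \<subseteq> submodule_span R M (S \<union> N)"
  shows "\<exists>P\<in>\<F>. \<forall>P'\<in>\<F>. P' \<subseteq> P \<longrightarrow> P' = P"
  using assms(3-)
proof (induction S arbitrary: \<F> rule: finite_induct)
  case empty
  have "submodule_span R M ({} \<union> N) \<subseteq> N" using assms(2) by (intro submodule_span_least) auto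
  then have "\<And>P. P \<in> \<F> \<Longrightarrow> P = N" using empty.prems(3) by blast
  then show ?case using empty.prems(2) by blast
next
  case (insert s S)
  let ?U = "submodule_span R M (S \<union> N)"
  define J where "J P = {r \<in> carrier R. \<exists>u\<in>?U. r \<odot>\<^bsub>M\<^esub> s \<oplus>\<^bsub>M\<^esub> u \<in> P}" for P
  have s: "s \<in> carrier M" and S: "S \<union> N \<subseteq> carrier M" using insert.prems submoduleE(1)[OF assms(2)] by auto
  note U = submodule_span_submodule[OF S]
  have sub: "submodule P R M" "N \<subseteq> P" "P \<subseteq> submodule_span R M (insert s (S \<union> N))" if "P \<in> \<F>" for P
    using insert.prems(3)[OF that] by auto
  have "\<exists>I\<in>J ` \<F>. \<forall>I'\<in>J ` \<F>. I' \<subseteq> I \<longrightarrow> I' = I"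
    using insert.prems(2) sub(1)
    by (intro artinian_minimal_ideal[OF assms(1)]) (auto simp: J_def intro!: ideal_of_coefficients s U)
  then obtain P0 where P0: "P0 \<in> \<F>" "\<And>P. P \<in> \<F> \<Longrightarrow> J P \<subseteq> J P0 \<Longrightarrow> J P = J P0"
    unfolding bex_simps ball_simps by metis
  let ?G = "{P \<in> \<F>. J P = J P0}"
  have "\<exists>P\<in>(\<lambda>P. P \<inter> ?U) ` ?G. \<forall>P'\<in>(\<lambda>P. P \<inter> ?U) ` ?G. P' \<subseteq> P \<longrightarrow> P' = P"
  proof (rule insert.IH)
    show "S \<subseteq> carrier M" using S by simp
    show "(\<lambda>P. P \<inter> ?U) ` ?G \<noteq> {}" using P0(1) by blast
    show "submodule Q R M \<and> N \<subseteq> Q \<and> Q \<subseteq> ?U" if Q: "Q \<in> (\<lambda>P. P \<inter> ?U) ` ?G" for Q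
    proof -
      obtain P where P: "P \<in> \<F>" "Q = P \<inter> ?U" using Q by auto
      have "N \<subseteq> ?U" using submodule_span_superset[of "S \<union> N"] by simp
      then show ?thesis unfolding P(2) using sub[OF P(1)] submodule_Int[OF _ U] by blast
    qed
  qed
  then obtain Q where Q: "Q \<in> (\<lambda>P. P \<inter> ?U) ` ?G"
    and Q_min: "\<forall>P'\<in>(\<lambda>P. P \<inter> ?U) ` ?G. P' \<subseteq> Q \<longrightarrow> P' = Q"
    by (rule bexE)
  have Q_min: "P' \<inter> ?U = Q" if "P' \<in> ?G" "P' \<inter> ?U \<subseteq> Q" for P'
    using bspec[OF Q_min imageI[OF that(1)]] that(2) by (rule mp)
  from Q obtain P where P: "P \<in> ?G" "Q = P \<inter> ?U" by (meson imageE)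
  have "P' = P" if P': "P' \<in> \<F>" "P' \<subseteq> P" for P'
  proof
    have "J P' \<subseteq> J P" using P'(2) by (auto simp: J_def)
    then have "J P' \<subseteq> J P0" using P(1) by simp
    then have G: "P' \<in> ?G" using P0(2)[OF P'(1)] P'(1) by simp
    have U_eq: "P' \<inter> ?U = P \<inter> ?U" using Q_min[OF G] P'(2) unfolding P(2) by blast
    have J_eq: "J P' = J P" using P(1) G by simp
    note subs = sub(1)[OF P'(1)] sub(1)[of P]
    show "P \<subseteq> P'"
    proof
      fix x assume x: "x \<in> P"
      then have "x \<in> submodule_span R M (insert s (S \<union> N))" using sub(3) P(1) by auto
      then obtain r u where ru: "r \<in> carrier R" "u \<in> ?U" "x = r \<odot>\<^bsub>M\<^esub> s \<oplus>\<^bsub>M\<^esub> u"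
        by (rule submodule_span_insert[OF s S])
      then have "r \<in> J P" using x by (auto simp: J_def)
      then have "r \<in> J P'" using J_eq by simp
      then obtain v where v: "v \<in> ?U" "r \<odot>\<^bsub>M\<^esub> s \<oplus>\<^bsub>M\<^esub> v \<in> P'" by (auto simp: J_def)
      let ?t = "r \<odot>\<^bsub>M\<^esub> s \<oplus>\<^bsub>M\<^esub> v"
      have c: "u \<in> carrier M" "v \<in> carrier M" "r \<odot>\<^bsub>M\<^esub> s \<in> carrier M"
        using ru v s submoduleE(1)[OF U] by auto
      have eq: "x \<ominus>\<^bsub>M\<^esub> ?t = u \<ominus>\<^bsub>M\<^esub> v"
        using c ru(3) by (simp add: a_minus_def M.minus_add M.a_ac M.r_neg M.r_neg2 M.r_neg1)
      have "x \<ominus>\<^bsub>M\<^esub> ?t \<in> P" using x v(2) P'(2) P(1) by (intro submodule_minus_closed subs) auto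
      moreover have "x \<ominus>\<^bsub>M\<^esub> ?t \<in> ?U"
        unfolding eq using ru(2) v(1) by (rule submodule_minus_closed[OF U])
      ultimately have "x \<ominus>\<^bsub>M\<^esub> ?t \<in> P'" using U_eq by blast
      moreover have "x \<in> carrier M" using c ru(3) by simp
      ultimately show "x \<in> P'" using v(2) by (blast intro: submodule_diff_cancel[OF subs(1)])
    qed
  qed (use P' in auto)
  then show ?case using P(1) by blast
qed

section \<open>The universal property of the tensor product\<close>

definition is_bilinear ::
    "('r, 'k) ring_scheme \<Rightarrow> ('r, 'm, 's) module_scheme \<Rightarrow> ('r, 'n, 't) module_scheme \<Rightarrow>
     ('r, 'p, 'u) module_scheme \<Rightarrow> ('m \<Rightarrow> 'n \<Rightarrow> 'p) \<Rightarrow> bool" where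
  "is_bilinear R M N P b \<longleftrightarrow> (\<forall>y\<in>carrier N. is_linear R M P (\<lambda>x. b x y)) \<and>
     (\<forall>x\<in>carrier M. is_linear R N P (b x))"

lemma is_bilinearD:
  assumes "is_bilinear R M N P b"
  shows "y \<in> carrier N \<Longrightarrow> is_linear R M P (\<lambda>x. b x y)"
    and "x \<in> carrier M \<Longrightarrow> is_linear R N P (b x)"
    and "x \<in> carrier M \<Longrightarrow> y \<in> carrier N \<Longrightarrow> b x y \<in> carrier P"
  using assms by (auto simp: is_bilinear_def is_linear_def)

lemma is_bilinear_precompose:
  assumes b: "is_bilinear R M N P b" and f: "is_linear R M' M f" and g: "is_linear R N' N g"
  shows "is_bilinear R M' N' P (\<lambda>x y. b (f x) (g y))"
  using is_linear_compose[OF f is_bilinearD(1)[OF b]] is_linear_compose[OF g is_bilinearD(2)[OF b]]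
    is_linearD(1)[OF f] is_linearD(1)[OF g]
  by (simp add: is_bilinear_def)

lemma (in cring) mult_bilinear:
  "is_bilinear R (base_module R) (base_module R) (base_module R) (\<lambda>r s. r \<otimes> s)"
  unfolding is_bilinear_def by (intro conjI ballI is_linearI) (auto simp: l_distr r_distr m_ac)

lemma (in module) smult_bilinear: "is_bilinear R (base_module R) M M (\<lambda>r x. r \<odot>\<^bsub>M\<^esub> x)"
  unfolding is_bilinear_def
proof (intro conjI ballI)
  show "is_linear R (base_module R) M (\<lambda>r. r \<odot>\<^bsub>M\<^esub> x)" if "x \<in> carrier M" for x
    using that by (intro is_linearI) (auto simp: smult_l_distr smult_assoc1)
  show "is_linear R M M (\<lambda>x. r \<odot>\<^bsub>M\<^esub> x)" if "r \<in> carrier (base_module R)" for r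
    using that by (intro is_linear_smult is_linear_ident) simp
qed

lemma is_bilinear_flip: "is_bilinear R M N P b \<Longrightarrow> is_bilinear R N M P (\<lambda>y x. b x y)"
  by (auto simp: is_bilinear_def)

text \<open>The linear extension of \<open>b\<close> to the free module, before passing to the tensor product.\<close>

definition tensor_eval ::
    "('r, 'k) ring_scheme \<Rightarrow> ('r, 'p, 's) module_scheme \<Rightarrow> ('m \<Rightarrow> 'n \<Rightarrow> 'p) \<Rightarrow>
     ('m \<times> 'n \<Rightarrow> 'r) \<Rightarrow> 'p" where
  "tensor_eval R P b \<phi> = (\<Oplus>\<^bsub>P\<^esub>q\<in>{q. \<phi> q \<noteq> \<zero>\<^bsub>R\<^esub>}. \<phi> q \<odot>\<^bsub>P\<^esub> b (fst q) (snd q))"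

lemma tensor_lift_eval: "tensor_lift R P b t = the_elem (tensor_eval R P b ` t)"
  by (simp add: tensor_lift_def tensor_eval_def[abs_def])

lemma free_module_simps [simp]:
  "\<zero>\<^bsub>free_module R S\<^esub> = (\<lambda>p. \<zero>\<^bsub>R\<^esub>)"
  "\<phi> \<oplus>\<^bsub>free_module R S\<^esub> \<psi> = (\<lambda>p. \<phi> p \<oplus>\<^bsub>R\<^esub> \<psi> p)"
  "r \<odot>\<^bsub>free_module R S\<^esub> \<phi> = (\<lambda>p. r \<otimes>\<^bsub>R\<^esub> \<phi> p)"
  by (auto simp: free_module_def)

lemma free_carrierD:
  assumes "\<phi> \<in> carrier (free_module R S)"
  shows "\<phi> p \<in> carrier R" "finite {p. \<phi> p \<noteq> \<zero>\<^bsub>R\<^esub>}" "p \<notin> S \<Longrightarrow> \<phi> p = \<zero>\<^bsub>R\<^esub>" "{p. \<phi> p \<noteq> \<zero>\<^bsub>R\<^esub>} \<subseteq> S"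
  using assms by (auto simp: free_module_def)

lemma free_carrierI:
  assumes "\<And>p. \<phi> p \<in> carrier R" "finite D" "D \<subseteq> S" "\<And>p. p \<notin> D \<Longrightarrow> \<phi> p = \<zero>\<^bsub>R\<^esub>"
  shows "\<phi> \<in> carrier (free_module R S)"
proof -
  have "{p. \<phi> p \<noteq> \<zero>\<^bsub>R\<^esub>} \<subseteq> D" using assms(4) by blast
  then have "finite {p. \<phi> p \<noteq> \<zero>\<^bsub>R\<^esub>}" using assms(2) by (rule finite_subset)
  then show ?thesis using assms by (auto simp: free_module_def)
qed

context cring begin

lemma free_add_closed:
  assumes "\<phi> \<in> carrier (free_module R S)" "\<psi> \<in> carrier (free_module R S)"
  shows "(\<lambda>p. \<phi> p \<oplus> \<psi> p) \<in> carrier (free_module R S)"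
  by (rule free_carrierI[of _ _ "{p. \<phi> p \<noteq> \<zero>} \<union> {p. \<psi> p \<noteq> \<zero>}"])
    (simp_all add: free_carrierD[OF assms(1)] free_carrierD[OF assms(2)])

lemma free_smult_closed:
  assumes "r \<in> carrier R" "\<phi> \<in> carrier (free_module R S)"
  shows "(\<lambda>p. r \<otimes> \<phi> p) \<in> carrier (free_module R S)"
  by (rule free_carrierI[of _ _ "{p. \<phi> p \<noteq> \<zero>}"]) (simp_all add: free_carrierD[OF assms(2)] assms(1))

lemma free_module_is_module: "module R (free_module R S)"
proof (rule moduleI)
  note c = free_carrierD(1)
  have zero: "(\<lambda>p. \<zero>) \<in> carrier (free_module R S)" by (rule free_carrierI[of _ _ "{}"]) simp_all
  show "abelian_group (free_module R S)"
  proof (rule abelian_groupI)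
    show "\<exists>\<psi>\<in>carrier (free_module R S). \<psi> \<oplus>\<^bsub>free_module R S\<^esub> \<phi> = \<zero>\<^bsub>free_module R S\<^esub>"
      if \<phi>: "\<phi> \<in> carrier (free_module R S)" for \<phi>
    proof (rule bexI)
      show "(\<lambda>p. \<ominus> \<one> \<otimes> \<phi> p) \<in> carrier (free_module R S)" by (rule free_smult_closed) (use \<phi> in auto)
      show "(\<lambda>p. \<ominus> \<one> \<otimes> \<phi> p) \<oplus>\<^bsub>free_module R S\<^esub> \<phi> = \<zero>\<^bsub>free_module R S\<^esub>"
        using c[OF \<phi>] by (simp add: l_minus l_neg)
    qed
    show "\<phi> \<oplus>\<^bsub>free_module R S\<^esub> \<psi> = \<psi> \<oplus>\<^bsub>free_module R S\<^esub> \<phi>"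
      if "\<phi> \<in> carrier (free_module R S)" "\<psi> \<in> carrier (free_module R S)" for \<phi> \<psi>
      using c[OF that(1)] c[OF that(2)] by (simp add: a_comm)
  qed (simp_all add: free_add_closed zero a_assoc free_carrierD(1))
qed (simp_all add: cring_axioms free_smult_closed l_distr r_distr m_assoc free_carrierD(1))

lemma single_closed: "p \<in> S \<Longrightarrow> single R p \<in> carrier (free_module R S)"
  by (rule free_carrierI[of _ _ "{p}"]) (auto simp: single_def)

lemma free_module_span_single:
  assumes "\<phi> \<in> carrier (free_module R S)"
  shows "\<phi> \<in> submodule_span R (free_module R S) (single R ` S)"
proof -
  interpret F: module R "free_module R S" by (rule free_module_is_module)
  let ?V = "submodule_span R (free_module R S) (single R ` S)"
  have sub: "single R ` S \<subseteq> carrier (free_module R S)" by (rule image_subsetI[OF single_closed])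
  note V = F.submodule_span_submodule[OF sub]
  show ?thesis using assms
  proof (induction "card {p. \<phi> p \<noteq> \<zero>}" arbitrary: \<phi>)
    case 0
    then have "\<phi> = (\<lambda>p. \<zero>)" using free_carrierD(2)[OF 0(2)] by auto
    then show ?case using F.submodule_zero_closed[OF V] by simp
  next
    case (Suc n)
    then obtain p where p: "\<phi> p \<noteq> \<zero>" by (metis (mono_tags, lifting) Collect_empty_eq card.empty nat.distinct(1))
    let ?\<psi> = "\<lambda>q. if q = p then \<zero> else \<phi> q"
    have c: "\<phi> q \<in> carrier R" for q using free_carrierD[OF Suc.prems] by blast
    have pS: "p \<in> S" using p free_carrierD[OF Suc.prems] by blast
    have eq: "{q. ?\<psi> q \<noteq> \<zero>} = {q. \<phi> q \<noteq> \<zero>} - {p}" by auto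
    have fin: "finite {q. \<phi> q \<noteq> \<zero>}" using free_carrierD[OF Suc.prems] by blast
    have \<psi>: "?\<psi> \<in> carrier (free_module R S)"
      by (rule free_carrierI[of _ _ "{q. \<phi> q \<noteq> \<zero>}"]) (simp_all add: c fin free_carrierD(4)[OF Suc.prems])
    have "n = card {q. ?\<psi> q \<noteq> \<zero>}"
      using Suc.hyps(2) p fin unfolding eq by (simp add: card_Diff_singleton)
    then have 1: "?\<psi> \<in> ?V" using \<psi> by (rule Suc.hyps(1))
    have "\<phi> p \<odot>\<^bsub>free_module R S\<^esub> single R p \<in> ?V"
      using F.submodule_span_superset[of "single R ` S"] pS c by (intro F.submoduleE(4)[OF V]) auto
    then have "\<phi> p \<odot>\<^bsub>free_module R S\<^esub> single R p \<oplus>\<^bsub>free_module R S\<^esub> ?\<psi> \<in> ?V"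
      using 1 by (rule F.submoduleE(5)[OF V])
    moreover have "\<phi> p \<odot>\<^bsub>free_module R S\<^esub> single R p \<oplus>\<^bsub>free_module R S\<^esub> ?\<psi> = \<phi>"
      using c by (auto simp: single_def)
    ultimately show ?case by simp
  qed
qed

lemma tensor_eval_superset:
  assumes "module R P" "\<phi> \<in> carrier (free_module R S)"
    and b: "\<And>x y. (x, y) \<in> S \<Longrightarrow> b x y \<in> carrier P"
    and D: "finite D" "D \<subseteq> S" "{q. \<phi> q \<noteq> \<zero>} \<subseteq> D"
  shows "tensor_eval R P b \<phi> = (\<Oplus>\<^bsub>P\<^esub>q\<in>D. \<phi> q \<odot>\<^bsub>P\<^esub> b (fst q) (snd q))"
proof -
  interpret P: module R P by fact
  have b': "b (fst q) (snd q) \<in> carrier P" if "q \<in> D" for q using b D(2) that by (cases q) auto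
  have c: "\<phi> q \<in> carrier R" for q using free_carrierD[OF assms(2)] by blast
  show ?thesis unfolding tensor_eval_def
    using b' c D by (intro P.M.add.finprod_mono_neutral_cong_left) auto
qed

lemma tensor_eval_linear:
  assumes "module R P" and b: "\<And>x y. (x, y) \<in> S \<Longrightarrow> b x y \<in> carrier P"
  shows "is_linear R (free_module R S) P (tensor_eval R P b)"
proof (rule is_linearI)
  interpret P: module R P by fact
  interpret F: module R "free_module R S" by (rule free_module_is_module)
  have b': "b (fst q) (snd q) \<in> carrier P" if "q \<in> S" for q using b that by (cases q) auto
  have supp: "finite {q. \<phi> q \<noteq> \<zero>}" "{q. \<phi> q \<noteq> \<zero>} \<subseteq> S" "\<And>q. \<phi> q \<in> carrier R"
    if "\<phi> \<in> carrier (free_module R S)" for \<phi> using free_carrierD[OF that] by blast+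
  have sup: "tensor_eval R P b \<phi> = (\<Oplus>\<^bsub>P\<^esub>q\<in>D. \<phi> q \<odot>\<^bsub>P\<^esub> b (fst q) (snd q))"
    if "\<phi> \<in> carrier (free_module R S)" "finite D" "D \<subseteq> S" "{q. \<phi> q \<noteq> \<zero>} \<subseteq> D" for \<phi> D
    using assms(1) that(1) b that(2-) by (rule tensor_eval_superset)
  show "tensor_eval R P b \<phi> \<in> carrier P" if "\<phi> \<in> carrier (free_module R S)" for \<phi>
    unfolding tensor_eval_def using supp[OF that] b' by (intro P.M.finsum_closed) auto
  show "tensor_eval R P b (\<phi> \<oplus>\<^bsub>free_module R S\<^esub> \<psi>) = tensor_eval R P b \<phi> \<oplus>\<^bsub>P\<^esub> tensor_eval R P b \<psi>"
    if \<phi>: "\<phi> \<in> carrier (free_module R S)" and \<psi>: "\<psi> \<in> carrier (free_module R S)" for \<phi> \<psi>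
  proof -
    let ?D = "{q. \<phi> q \<noteq> \<zero>} \<union> {q. \<psi> q \<noteq> \<zero>}"
    have D: "finite ?D" "?D \<subseteq> S" using supp(1,2)[OF \<phi>] supp(1,2)[OF \<psi>] by auto
    have supp_sum: "{q. \<phi> q \<oplus> \<psi> q \<noteq> \<zero>} \<subseteq> ?D" by auto
    have sum: "\<phi> \<oplus>\<^bsub>free_module R S\<^esub> \<psi> \<in> carrier (free_module R S)" using \<phi> \<psi> by (rule F.M.a_closed)
    have "tensor_eval R P b (\<phi> \<oplus>\<^bsub>free_module R S\<^esub> \<psi>) =
      (\<Oplus>\<^bsub>P\<^esub>q\<in>?D. (\<phi> q \<oplus> \<psi> q) \<odot>\<^bsub>P\<^esub> b (fst q) (snd q))"
      using sup[OF sum D] by (simp add: supp_sum)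
    also have "\<dots> = (\<Oplus>\<^bsub>P\<^esub>q\<in>?D. \<phi> q \<odot>\<^bsub>P\<^esub> b (fst q) (snd q) \<oplus>\<^bsub>P\<^esub> \<psi> q \<odot>\<^bsub>P\<^esub> b (fst q) (snd q))"
      using supp(3)[OF \<phi>] supp(3)[OF \<psi>] b' D
      by (intro P.M.finsum_cong') (auto simp: P.smult_l_distr subset_iff)
    also have "\<dots> = (\<Oplus>\<^bsub>P\<^esub>q\<in>?D. \<phi> q \<odot>\<^bsub>P\<^esub> b (fst q) (snd q)) \<oplus>\<^bsub>P\<^esub> (\<Oplus>\<^bsub>P\<^esub>q\<in>?D. \<psi> q \<odot>\<^bsub>P\<^esub> b (fst q) (snd q))"
      using supp(3)[OF \<phi>] supp(3)[OF \<psi>] b' D by (intro P.M.finsum_addf) (auto simp: subset_iff)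
    also have "\<dots> = tensor_eval R P b \<phi> \<oplus>\<^bsub>P\<^esub> tensor_eval R P b \<psi>"
      using sup[OF \<phi> D] sup[OF \<psi> D] by simp
    finally show ?thesis .
  qed
  show "tensor_eval R P b (r \<odot>\<^bsub>free_module R S\<^esub> \<phi>) = r \<odot>\<^bsub>P\<^esub> tensor_eval R P b \<phi>"
    if r: "r \<in> carrier R" and \<phi>: "\<phi> \<in> carrier (free_module R S)" for r \<phi>
  proof -
    let ?D = "{q. \<phi> q \<noteq> \<zero>}"
    note D = supp(1,2)[OF \<phi>]
    have supp_smult: "{q. r \<otimes> \<phi> q \<noteq> \<zero>} \<subseteq> ?D" using r by auto
    have sm: "r \<odot>\<^bsub>free_module R S\<^esub> \<phi> \<in> carrier (free_module R S)" using r \<phi> by (rule F.smult_closed)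
    have "tensor_eval R P b (r \<odot>\<^bsub>free_module R S\<^esub> \<phi>) =
      (\<Oplus>\<^bsub>P\<^esub>q\<in>?D. (r \<otimes> \<phi> q) \<odot>\<^bsub>P\<^esub> b (fst q) (snd q))"
      using sup[OF sm D] by (simp add: supp_smult)
    also have "\<dots> = (\<Oplus>\<^bsub>P\<^esub>q\<in>?D. r \<odot>\<^bsub>P\<^esub> (\<phi> q \<odot>\<^bsub>P\<^esub> b (fst q) (snd q)))"
      using supp(3)[OF \<phi>] r b' D
      by (intro P.M.finsum_cong') (auto simp: P.smult_assoc1 subset_iff)
    also have "\<dots> = r \<odot>\<^bsub>P\<^esub> tensor_eval R P b \<phi>"
      unfolding tensor_eval_def using supp(3)[OF \<phi>] r b' D
      by (intro P.finsum_smult_ldistr[symmetric]) (auto simp: subset_iff)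
    finally show ?thesis .
  qed
qed

lemma tensor_eval_single:
  assumes "module R P" "\<one> \<noteq> \<zero>" "b x y \<in> carrier P"
  shows "tensor_eval R P b (single R (x, y)) = b x y"
proof -
  interpret P: module R P by fact
  have "{q. single R (x, y) q \<noteq> \<zero>} = {(x, y)}" using assms(2) by (auto simp: single_def)
  then show ?thesis using assms(3) by (simp add: tensor_eval_def single_def)
qed

end

locale tensor_pair = M: module R M + N: module R N
  for R :: "('r, 'k) ring_scheme" (structure) and M :: "('r, 'm, 's) module_scheme"
    and N :: "('r, 'n, 't) module_scheme" +
  assumes nontrivial: "\<one> \<noteq> \<zero>"
begin

abbreviation F where "F \<equiv> free_module R (carrier M \<times> carrier N)"
abbreviation T where "T \<equiv> tensor_module R M N"

interpretation F: module R F by (rule M.free_module_is_module)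

lemma single_F: "x \<in> carrier M \<Longrightarrow> y \<in> carrier N \<Longrightarrow> single R (x, y) \<in> carrier F"
  by (intro M.single_closed) simp

abbreviation relators where "relators \<equiv>
       ({single R (x \<oplus>\<^bsub>M\<^esub> x', y) \<ominus>\<^bsub>F\<^esub> (single R (x, y) \<oplus>\<^bsub>F\<^esub> single R (x', y)) | x x' y.
          x \<in> carrier M \<and> x' \<in> carrier M \<and> y \<in> carrier N} \<union>
       {single R (x, y \<oplus>\<^bsub>N\<^esub> y') \<ominus>\<^bsub>F\<^esub> (single R (x, y) \<oplus>\<^bsub>F\<^esub> single R (x, y')) | x y y'.
          x \<in> carrier M \<and> y \<in> carrier N \<and> y' \<in> carrier N} \<union>
       {single R (r \<odot>\<^bsub>M\<^esub> x, y) \<ominus>\<^bsub>F\<^esub> (r \<odot>\<^bsub>F\<^esub> single R (x, y)) | r x y.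
          r \<in> carrier R \<and> x \<in> carrier M \<and> y \<in> carrier N} \<union>
       {single R (x, r \<odot>\<^bsub>N\<^esub> y) \<ominus>\<^bsub>F\<^esub> (r \<odot>\<^bsub>F\<^esub> single R (x, y)) | r x y.
          r \<in> carrier R \<and> x \<in> carrier M \<and> y \<in> carrier N})"

lemma tensor_relations_span: "tensor_relations R M N = submodule_span R F relators"
  unfolding tensor_relations_def Let_def ..

lemma relators_closed: "relators \<subseteq> carrier F"
  using single_F by (auto simp del: free_module_simps intro!: F.M.minus_closed F.M.a_closed F.smult_closed)

lemma relations_submodule: "submodule (tensor_relations R M N) R F"
  unfolding tensor_relations_span by (rule F.submodule_span_submodule[OF relators_closed])

lemma tensor_is_module: "module R T"
  unfolding tensor_module_def by (rule F.quotient_module_is_module[OF relations_submodule])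

interpretation T: module R T by (rule tensor_is_module)

lemma tensor_class_linear: "is_linear R F T (\<lambda>\<phi>. tensor_relations R M N +>\<^bsub>F\<^esub> \<phi>)"
  unfolding tensor_module_def by (rule F.quotient_projection_linear[OF relations_submodule])

lemma tensor_carrier: "carrier T = (\<lambda>\<phi>. tensor_relations R M N +>\<^bsub>F\<^esub> \<phi>) ` carrier F"
  unfolding tensor_module_def by (rule F.quotient_module_simps)

lemma pure_tensor_closed: "x \<in> carrier M \<Longrightarrow> y \<in> carrier N \<Longrightarrow> pure_tensor R M N x y \<in> carrier T"
  unfolding pure_tensor_def tensor_carrier using single_F by blast

lemma pure_tensor_bilinear: "is_bilinear R M N T (pure_tensor R M N)"
proof -
  note q = is_linearD[OF tensor_class_linear]
  have rel: "\<rho> \<in> tensor_relations R M N" if "\<rho> \<in> relators" for \<rho>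
    unfolding tensor_relations_span using that F.submodule_span_superset[of relators] by blast
  have eq: "tensor_relations R M N +>\<^bsub>F\<^esub> \<phi> = tensor_relations R M N +>\<^bsub>F\<^esub> \<psi>"
    if "\<phi> \<ominus>\<^bsub>F\<^esub> \<psi> \<in> relators" "\<phi> \<in> carrier F" "\<psi> \<in> carrier F" for \<phi> \<psi>
    using F.coset_eq_iff[OF relations_submodule that(2,3)] rel[OF that(1)] by blast
  have 1: "pure_tensor R M N (x \<oplus>\<^bsub>M\<^esub> x') y = pure_tensor R M N x y \<oplus>\<^bsub>T\<^esub> pure_tensor R M N x' y"
    if "x \<in> carrier M" "x' \<in> carrier M" "y \<in> carrier N" for x x' y
    unfolding pure_tensor_def q(2)[OF single_F[OF that(1,3)] single_F[OF that(2,3)], symmetric]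
  proof (rule eq)
    show "single R (x \<oplus>\<^bsub>M\<^esub> x', y) \<ominus>\<^bsub>F\<^esub> (single R (x, y) \<oplus>\<^bsub>F\<^esub> single R (x', y)) \<in> relators"
      using that by blast
  qed (use that single_F in \<open>auto simp del: free_module_simps intro!: F.M.a_closed\<close>)
  have 2: "pure_tensor R M N x (y \<oplus>\<^bsub>N\<^esub> y') = pure_tensor R M N x y \<oplus>\<^bsub>T\<^esub> pure_tensor R M N x y'"
    if "x \<in> carrier M" "y \<in> carrier N" "y' \<in> carrier N" for x y y'
    unfolding pure_tensor_def q(2)[OF single_F[OF that(1,2)] single_F[OF that(1,3)], symmetric]
  proof (rule eq)
    show "single R (x, y \<oplus>\<^bsub>N\<^esub> y') \<ominus>\<^bsub>F\<^esub> (single R (x, y) \<oplus>\<^bsub>F\<^esub> single R (x, y')) \<in> relators"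
      using that by blast
  qed (use that single_F in \<open>auto simp del: free_module_simps intro!: F.M.a_closed\<close>)
  have 3: "pure_tensor R M N (r \<odot>\<^bsub>M\<^esub> x) y = r \<odot>\<^bsub>T\<^esub> pure_tensor R M N x y"
    if "r \<in> carrier R" "x \<in> carrier M" "y \<in> carrier N" for r x y
    unfolding pure_tensor_def q(3)[OF that(1) single_F[OF that(2,3)], symmetric]
  proof (rule eq)
    show "single R (r \<odot>\<^bsub>M\<^esub> x, y) \<ominus>\<^bsub>F\<^esub> (r \<odot>\<^bsub>F\<^esub> single R (x, y)) \<in> relators"
      using that by blast
  qed (use that single_F in \<open>auto simp del: free_module_simps intro!: F.smult_closed\<close>)
  have 4: "pure_tensor R M N x (r \<odot>\<^bsub>N\<^esub> y) = r \<odot>\<^bsub>T\<^esub> pure_tensor R M N x y"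
    if "r \<in> carrier R" "x \<in> carrier M" "y \<in> carrier N" for r x y
    unfolding pure_tensor_def q(3)[OF that(1) single_F[OF that(2,3)], symmetric]
  proof (rule eq)
    show "single R (x, r \<odot>\<^bsub>N\<^esub> y) \<ominus>\<^bsub>F\<^esub> (r \<odot>\<^bsub>F\<^esub> single R (x, y)) \<in> relators"
      using that by blast
  qed (use that single_F in \<open>auto simp del: free_module_simps intro!: F.smult_closed\<close>)
  show ?thesis
    unfolding is_bilinear_def using 1 2 3 4 pure_tensor_closed by (intro conjI ballI is_linearI) auto
qed

text \<open>Pure tensors generate the tensor product.  All identities between induced maps below, including
naturality and additivity in a parameter, are instances of this uniqueness.\<close>

lemma tensor_map_ext:
  assumes "module R P" "is_linear R T P f" "is_linear R T P g"
    and pure: "\<And>x y. x \<in> carrier M \<Longrightarrow> y \<in> carrier N \<Longrightarrow> f (pure_tensor R M N x y) = g (pure_tensor R M N x y)"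
    and t: "t \<in> carrier T"
  shows "f t = g t"
proof -
  interpret P: module R P by fact
  let ?q = "\<lambda>\<phi>. tensor_relations R M N +>\<^bsub>F\<^esub> \<phi>"
  note f = is_linearD[OF assms(2)] is_linear_zero_minus[OF T.module_axioms assms(1,2)]
  note g = is_linearD[OF assms(3)] is_linear_zero_minus[OF T.module_axioms assms(1,3)]
  have "submodule {t \<in> carrier T. f t = g t} R T"
    using f g by (intro T.submoduleI) auto
  then have "submodule {\<phi> \<in> carrier F. ?q \<phi> \<in> {t \<in> carrier T. f t = g t}} R F"
    by (rule submodule_vimage[OF F.module_axioms T.module_axioms tensor_class_linear _ F.carrier_is_submodule])
  moreover have "single R ` (carrier M \<times> carrier N) \<subseteq> {\<phi> \<in> carrier F. ?q \<phi> \<in> {t \<in> carrier T. f t = g t}}"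
    using single_F pure pure_tensor_closed unfolding pure_tensor_def by (auto simp del: free_module_simps)
  ultimately have "carrier F \<subseteq> {\<phi> \<in> carrier F. ?q \<phi> \<in> {t \<in> carrier T. f t = g t}}"
    using M.free_module_span_single F.submodule_span_least by (metis (no_types, lifting) subset_iff)
  then show ?thesis using t unfolding tensor_carrier by blast
qed

text \<open>Every relator is mapped to zero by the linear extension of a bilinear map, so the value does not depend
on the representative.\<close>

lemma tensor_lift_class:
  assumes "module R P" "is_bilinear R M N P b" "\<phi> \<in> carrier F"
  shows "tensor_lift R P b (tensor_relations R M N +>\<^bsub>F\<^esub> \<phi>) = tensor_eval R P b \<phi>"
proof -
  interpret P: module R P by fact
  have bl: "\<And>y. y \<in> carrier N \<Longrightarrow> is_linear R M P (\<lambda>x. b x y)" "\<And>x. x \<in> carrier M \<Longrightarrow> is_linear R N P (b x)"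
    using assms(2) by (auto simp: is_bilinear_def)
  note b = is_linearD[OF bl(1)] is_linearD[OF bl(2)]
  have lin: "is_linear R F P (tensor_eval R P b)"
    using b by (intro M.tensor_eval_linear assms(1)) auto
  note e = is_linearD[OF lin] is_linear_zero_minus[OF F.module_axioms assms(1) lin]
  have single: "tensor_eval R P b (single R (x, y)) = b x y" if "x \<in> carrier M" "y \<in> carrier N" for x y
    using that b by (intro M.tensor_eval_single assms(1) nontrivial) auto
  have self: "u \<ominus>\<^bsub>P\<^esub> u = \<zero>\<^bsub>P\<^esub>" if "u \<in> carrier P" for u
    using that by (simp add: a_minus_def P.r_neg)
  have "relators \<subseteq> {\<phi> \<in> carrier F. tensor_eval R P b \<phi> \<in> {\<zero>\<^bsub>P\<^esub>}}"
  proof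
    fix \<rho> assume \<rho>: "\<rho> \<in> relators"
    then have "\<rho> \<in> carrier F" using relators_closed by blast
    moreover have "tensor_eval R P b \<rho> = \<zero>\<^bsub>P\<^esub>"
      using \<rho> b
      by (auto simp del: free_module_simps
          simp: e(2,3,6) single single_F F.smult_closed F.M.a_closed self)
    ultimately show "\<rho> \<in> {\<phi> \<in> carrier F. tensor_eval R P b \<phi> \<in> {\<zero>\<^bsub>P\<^esub>}}" by blast
  qed
  then have "tensor_relations R M N \<subseteq> {\<phi> \<in> carrier F. tensor_eval R P b \<phi> \<in> {\<zero>\<^bsub>P\<^esub>}}"
    unfolding tensor_relations_span
    by (intro F.submodule_span_least submodule_vimage[OF F.module_axioms assms(1) lin] P.submodule_zero
        F.carrier_is_submodule)
  then have zero: "tensor_eval R P b \<rho> = \<zero>\<^bsub>P\<^esub>" "\<rho> \<in> carrier F" if "\<rho> \<in> tensor_relations R M N" for \<rho>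
    using that by blast+
  have "tensor_eval R P b ` (tensor_relations R M N +>\<^bsub>F\<^esub> \<phi>) = {tensor_eval R P b \<phi>}"
  proof
    show "tensor_eval R P b ` (tensor_relations R M N +>\<^bsub>F\<^esub> \<phi>) \<subseteq> {tensor_eval R P b \<phi>}"
    proof clarify
      fix \<psi> assume "\<psi> \<in> tensor_relations R M N +>\<^bsub>F\<^esub> \<phi>"
      then obtain \<rho> where \<rho>: "\<rho> \<in> tensor_relations R M N" "\<psi> = \<rho> \<oplus>\<^bsub>F\<^esub> \<phi>"
        unfolding a_r_coset_def' by blast
      show "tensor_eval R P b \<psi> = tensor_eval R P b \<phi>"
        unfolding \<rho>(2) e(2)[OF zero(2)[OF \<rho>(1)] assms(3)] zero(1)[OF \<rho>(1)]
        using e(1)[OF assms(3)] by (rule P.l_zero)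
    qed
    have "\<phi> \<in> tensor_relations R M N +>\<^bsub>F\<^esub> \<phi>"
      by (rule abelian_subgroup.a_rcos_self[OF F.abelian_subgroup_of_submodule[OF relations_submodule] assms(3)])
    then show "{tensor_eval R P b \<phi>} \<subseteq> tensor_eval R P b ` (tensor_relations R M N +>\<^bsub>F\<^esub> \<phi>)" by blast
  qed
  then show ?thesis unfolding tensor_lift_eval by simp
qed

lemma tensor_lift_linear:
  assumes "module R P" "is_bilinear R M N P b"
  shows "is_linear R T P (tensor_lift R P b)"
proof (rule is_linearI)
  note q = is_linearD[OF tensor_class_linear]
  have "b x y \<in> carrier P" if "x \<in> carrier M" "y \<in> carrier N" for x y
    using assms(2) that by (auto simp: is_bilinear_def is_linear_def)
  then have lin: "is_linear R F P (tensor_eval R P b)" by (intro M.tensor_eval_linear assms(1)) auto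
  note e = is_linearD[OF lin] and lift = tensor_lift_class[OF assms]
  show "tensor_lift R P b t \<in> carrier P" if "t \<in> carrier T" for t
    using that unfolding tensor_carrier by (auto simp del: free_module_simps simp: lift e)
  show "tensor_lift R P b (t \<oplus>\<^bsub>T\<^esub> u) = tensor_lift R P b t \<oplus>\<^bsub>P\<^esub> tensor_lift R P b u"
    if "t \<in> carrier T" "u \<in> carrier T" for t u
    using that unfolding tensor_carrier
    by (auto simp del: free_module_simps simp: lift e F.M.a_closed simp flip: q(2))
  show "tensor_lift R P b (r \<odot>\<^bsub>T\<^esub> t) = r \<odot>\<^bsub>P\<^esub> tensor_lift R P b t"
    if "r \<in> carrier R" "t \<in> carrier T" for r t
    using that unfolding tensor_carrier
    by (auto simp del: free_module_simps simp: lift e F.smult_closed simp flip: q(3))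
qed

lemma tensor_lift_pure:
  assumes "module R P" "is_bilinear R M N P b" "x \<in> carrier M" "y \<in> carrier N"
  shows "tensor_lift R P b (pure_tensor R M N x y) = b x y"
proof -
  have "b x y \<in> carrier P" using assms(2-) by (auto simp: is_bilinear_def is_linear_def)
  then show ?thesis unfolding pure_tensor_def
    using tensor_lift_class[OF assms(1,2) single_F[OF assms(3,4)]] M.tensor_eval_single[OF assms(1) nontrivial]
    by simp
qed

text \<open>Turns a tensor into a finite set: a bilinear map that vanishes on the pairs occurring in one representative
has zero lift.  Applied to the comultiplication or to a witness of rationality, it yields the finite subsets
of \<open>C\<close> whose annihilators are compared with ideals.\<close>

lemma tensor_finite_support:
  assumes "t \<in> carrier T"
  obtains D where "finite D" "D \<subseteq> carrier M \<times> carrier N"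
    "\<And>P b. module R P \<Longrightarrow> is_bilinear R M N P b \<Longrightarrow> (\<And>x y. (x, y) \<in> D \<Longrightarrow> b x y = \<zero>\<^bsub>P\<^esub>) \<Longrightarrow>
       tensor_lift R P b t = \<zero>\<^bsub>P\<^esub>"
proof -
  obtain \<phi> where \<phi>: "\<phi> \<in> carrier F" "t = tensor_relations R M N +>\<^bsub>F\<^esub> \<phi>"
    using assms unfolding tensor_carrier by blast
  have c: "\<phi> q \<in> carrier R" for q using free_carrierD[OF \<phi>(1)] by blast
  show ?thesis
  proof (rule that[of "{q. \<phi> q \<noteq> \<zero>}"])
    fix P b
    assume P: "module R P" and b: "is_bilinear R M N P b" and 0: "\<And>x y. (x, y) \<in> {q. \<phi> q \<noteq> \<zero>} \<Longrightarrow> b x y = \<zero>\<^bsub>P\<^esub>"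
    interpret P: module R P by fact
    have "tensor_lift R P b t = tensor_eval R P b \<phi>" unfolding \<phi>(2) by (rule tensor_lift_class[OF P b \<phi>(1)])
    also have "\<dots> = (\<Oplus>\<^bsub>P\<^esub>q\<in>{q. \<phi> q \<noteq> \<zero>}. \<zero>\<^bsub>P\<^esub>)"
      unfolding tensor_eval_def using 0 c by (intro P.M.finsum_cong') auto
    finally show "tensor_lift R P b t = \<zero>\<^bsub>P\<^esub>" by simp
  qed (use free_carrierD[OF \<phi>(1)] in auto)
qed

lemma tensor_lift_compose:
  assumes "module R P" "module R Q" "is_linear R P Q L" "is_bilinear R M N P b" "is_bilinear R M N Q b'"
    and "\<And>x y. x \<in> carrier M \<Longrightarrow> y \<in> carrier N \<Longrightarrow> L (b x y) = b' x y"
    and "t \<in> carrier T"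
  shows "L (tensor_lift R P b t) = tensor_lift R Q b' t"
proof (rule tensor_map_ext[OF assms(2) _ _ _ assms(7)])
  show "is_linear R T Q (\<lambda>t. L (tensor_lift R P b t))"
    by (rule is_linear_compose[OF tensor_lift_linear[OF assms(1,4)] assms(3)])
  show "is_linear R T Q (tensor_lift R Q b')" by (rule tensor_lift_linear[OF assms(2,5)])
qed (use assms in \<open>simp add: tensor_lift_pure\<close>)

text \<open>This is what makes iterated lifts meaningful: the map inducing \<open>(L \<otimes> M) \<otimes> N \<rightarrow> L \<otimes> (M \<otimes> N)\<close> is
itself a lift that depends linearly on the element of \<open>N\<close>.\<close>

lemma tensor_lift_parameter:
  assumes "module R P"
    and bil: "\<And>z. z \<in> carrier L \<Longrightarrow> is_bilinear R M N P (b z)"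
    and lin: "\<And>x y. x \<in> carrier M \<Longrightarrow> y \<in> carrier N \<Longrightarrow> is_linear R L P (\<lambda>z. b z x y)"
    and "module R L"
  shows "is_bilinear R T L P (\<lambda>t z. tensor_lift R P (b z) t)"
proof -
  interpret P: module R P by fact
  interpret L: module R L by fact
  note lift = tensor_lift_linear[OF assms(1) bil]
  have "is_linear R L P (\<lambda>z. tensor_lift R P (b z) t)" if t: "t \<in> carrier T" for t
  proof (rule is_linearI)
    show "tensor_lift R P (b z) t \<in> carrier P" if "z \<in> carrier L" for z
      using is_linearD(1)[OF lift[OF that] t] .
    note pure = tensor_lift_pure[OF assms(1) bil]
    show "tensor_lift R P (b (z \<oplus>\<^bsub>L\<^esub> z')) t = tensor_lift R P (b z) t \<oplus>\<^bsub>P\<^esub> tensor_lift R P (b z') t"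
      if z: "z \<in> carrier L" and z': "z' \<in> carrier L" for z z'
    proof (rule tensor_map_ext[OF assms(1) lift P.is_linear_add[OF lift[OF z] lift[OF z']] _ t])
      show "z \<oplus>\<^bsub>L\<^esub> z' \<in> carrier L" using z z' by simp
      show "tensor_lift R P (b (z \<oplus>\<^bsub>L\<^esub> z')) (pure_tensor R M N x y) =
          tensor_lift R P (b z) (pure_tensor R M N x y) \<oplus>\<^bsub>P\<^esub> tensor_lift R P (b z') (pure_tensor R M N x y)"
        if "x \<in> carrier M" "y \<in> carrier N" for x y
        using is_linearD(2)[OF lin[OF that] z z'] z z' that by (simp add: pure)
    qed
    show "tensor_lift R P (b (r \<odot>\<^bsub>L\<^esub> z)) t = r \<odot>\<^bsub>P\<^esub> tensor_lift R P (b z) t"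
      if r: "r \<in> carrier R" and z: "z \<in> carrier L" for r z
    proof (rule tensor_map_ext[OF assms(1) lift P.is_linear_smult[OF lift[OF z] r] _ t])
      show "r \<odot>\<^bsub>L\<^esub> z \<in> carrier L" using r z by simp
      show "tensor_lift R P (b (r \<odot>\<^bsub>L\<^esub> z)) (pure_tensor R M N x y) =
          r \<odot>\<^bsub>P\<^esub> tensor_lift R P (b z) (pure_tensor R M N x y)"
        if "x \<in> carrier M" "y \<in> carrier N" for x y
        using is_linearD(3)[OF lin[OF that] r z] r z that by (simp add: pure)
    qed
  qed
  then show ?thesis unfolding is_bilinear_def using lift by blast
qed

end

section \<open>The dual algebra of a coalgebra\<close>

locale nontrivial_coalgebra = coalgebra R C
  for R :: "('r, 'k) ring_scheme" (structure) and C :: "('r, 'c, 'e) coalgebra_scheme" (structure) +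
  assumes one_neq_zero: "\<one> \<noteq> \<zero>"
begin

abbreviation A where "A \<equiv> dual_algebra R C"
abbreviation B where "B \<equiv> base_module R"

interpretation B: module R B by (rule base_module)
interpretation CC: tensor_pair R C C by unfold_locales (rule one_neq_zero)

lemma dual_simps:
  "carrier A = linear_maps R C B" "zero A = (\<lambda>x\<in>carrier C. \<zero>)"
  "add A = (\<lambda>f g. \<lambda>x\<in>carrier C. f x \<oplus> g x)" "smult A = (\<lambda>r f. \<lambda>x\<in>carrier C. r \<otimes> f x)"
  "one A = counit C" "mult A = convolution R C"
  by (simp_all add: dual_algebra_def dual_module_def hom_module_def)

lemma dual_carrier: "f \<in> carrier A \<longleftrightarrow> is_linear R C B f \<and> f \<in> extensional (carrier C)"
  by (simp add: dual_simps linear_maps_iff)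

lemma dual_linear: "f \<in> carrier A \<Longrightarrow> is_linear R C B f"
  by (simp add: dual_carrier)

lemma dualD:
  assumes "f \<in> carrier A"
  shows "x \<in> carrier C \<Longrightarrow> f x \<in> carrier R"
    and "x \<in> carrier C \<Longrightarrow> y \<in> carrier C \<Longrightarrow> f (x \<oplus>\<^bsub>C\<^esub> y) = f x \<oplus> f y"
    and "r \<in> carrier R \<Longrightarrow> x \<in> carrier C \<Longrightarrow> f (r \<odot>\<^bsub>C\<^esub> x) = r \<otimes> f x"
  using is_linearD[OF dual_linear[OF assms]] by auto

lemma dual_restrict: "is_linear R C B f \<Longrightarrow> (\<lambda>x\<in>carrier C. f x) \<in> carrier A"
  unfolding dual_carrier using is_linear_cong[OF _ module_axioms, of B f "\<lambda>x\<in>carrier C. f x"] by simp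

lemma dual_eqI:
  assumes "f \<in> carrier A" "g \<in> carrier A" "\<And>x. x \<in> carrier C \<Longrightarrow> f x = g x"
  shows "f = g"
  using assms by (auto simp: dual_carrier intro: extensionalityI)

lemma dual_apply [simp]:
  assumes "x \<in> carrier C"
  shows "\<zero>\<^bsub>A\<^esub> x = \<zero>" "(f \<oplus>\<^bsub>A\<^esub> g) x = f x \<oplus> g x" "(r \<odot>\<^bsub>A\<^esub> f) x = r \<otimes> f x"
  using assms by (simp_all add: dual_simps)

lemma dual_closed:
  "\<zero>\<^bsub>A\<^esub> \<in> carrier A"
  "f \<in> carrier A \<Longrightarrow> g \<in> carrier A \<Longrightarrow> f \<oplus>\<^bsub>A\<^esub> g \<in> carrier A"
  "r \<in> carrier R \<Longrightarrow> f \<in> carrier A \<Longrightarrow> r \<odot>\<^bsub>A\<^esub> f \<in> carrier A"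
proof -
  show "\<zero>\<^bsub>A\<^esub> \<in> carrier A"
    unfolding dual_simps(2) by (rule dual_restrict, rule is_linearI) simp_all
  show "f \<in> carrier A \<Longrightarrow> g \<in> carrier A \<Longrightarrow> f \<oplus>\<^bsub>A\<^esub> g \<in> carrier A"
    unfolding dual_simps(3) using B.is_linear_add[of C f g] by (simp add: dual_restrict dual_linear)
  show "r \<in> carrier R \<Longrightarrow> f \<in> carrier A \<Longrightarrow> r \<odot>\<^bsub>A\<^esub> f \<in> carrier A"
    unfolding dual_simps(4) using B.is_linear_smult[of C f r] by (simp add: dual_restrict dual_linear)
qed

lemma dual_is_module: "module R A"
proof (rule moduleI)
  note [simp] = dual_closed
  show "abelian_group A"
  proof (rule abelian_groupI)
    show "\<exists>g\<in>carrier A. g \<oplus>\<^bsub>A\<^esub> f = \<zero>\<^bsub>A\<^esub>" if f: "f \<in> carrier A" for f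
    proof (rule bexI)
      show "(\<ominus> \<one>) \<odot>\<^bsub>A\<^esub> f \<in> carrier A" using f by simp
      show "(\<ominus> \<one>) \<odot>\<^bsub>A\<^esub> f \<oplus>\<^bsub>A\<^esub> f = \<zero>\<^bsub>A\<^esub>"
        using f dualD(1)[OF f] by (intro dual_eqI) (simp_all add: l_minus R.l_neg)
    qed
    show "f \<oplus>\<^bsub>A\<^esub> g \<oplus>\<^bsub>A\<^esub> h = f \<oplus>\<^bsub>A\<^esub> (g \<oplus>\<^bsub>A\<^esub> h)"
      if f: "f \<in> carrier A" and g: "g \<in> carrier A" and h: "h \<in> carrier A" for f g h
      using f g h dualD(1)[OF f] dualD(1)[OF g] dualD(1)[OF h] by (intro dual_eqI) (simp_all add: R.a_assoc)
    show "f \<oplus>\<^bsub>A\<^esub> g = g \<oplus>\<^bsub>A\<^esub> f" if f: "f \<in> carrier A" and g: "g \<in> carrier A" for f g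
      using f g dualD(1)[OF f] dualD(1)[OF g] by (intro dual_eqI) (simp_all add: R.a_comm)
    show "\<zero>\<^bsub>A\<^esub> \<oplus>\<^bsub>A\<^esub> f = f" if f: "f \<in> carrier A" for f
      using f dualD(1)[OF f] by (intro dual_eqI) simp_all
  qed simp_all
  show "(a \<oplus> b) \<odot>\<^bsub>A\<^esub> f = a \<odot>\<^bsub>A\<^esub> f \<oplus>\<^bsub>A\<^esub> b \<odot>\<^bsub>A\<^esub> f"
    if "a \<in> carrier R" "b \<in> carrier R" and f: "f \<in> carrier A" for a b f
    using that dualD(1)[OF f] by (intro dual_eqI) (simp_all add: l_distr)
  show "a \<odot>\<^bsub>A\<^esub> (f \<oplus>\<^bsub>A\<^esub> g) = a \<odot>\<^bsub>A\<^esub> f \<oplus>\<^bsub>A\<^esub> a \<odot>\<^bsub>A\<^esub> g"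
    if "a \<in> carrier R" and f: "f \<in> carrier A" and g: "g \<in> carrier A" for a f g
    using that dualD(1)[OF f] dualD(1)[OF g] by (intro dual_eqI) (simp_all add: r_distr)
  show "(a \<otimes> b) \<odot>\<^bsub>A\<^esub> f = a \<odot>\<^bsub>A\<^esub> (b \<odot>\<^bsub>A\<^esub> f)"
    if "a \<in> carrier R" "b \<in> carrier R" and f: "f \<in> carrier A" for a b f
    using that dualD(1)[OF f] by (intro dual_eqI) (simp_all add: m_assoc)
  show "\<one> \<odot>\<^bsub>A\<^esub> f = f" if f: "f \<in> carrier A" for f
    using f dualD(1)[OF f] by (intro dual_eqI) simp_all
qed (simp_all add: is_cring dual_closed)

lemma evaluation_linear:
  assumes x: "x \<in> carrier C"
  shows "is_linear R A B (\<lambda>f. f x)"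
proof (rule is_linearI)
  show "f x \<in> carrier B" if "f \<in> carrier A" for f using dualD(1)[OF that x] by simp
qed (simp_all add: x)

interpretation A: module R A by (rule dual_is_module)

lemma dual_minus [simp]:
  assumes "x \<in> carrier C" "f \<in> carrier A"
  shows "(\<ominus>\<^bsub>A\<^esub> f) x = \<ominus> f x" "g \<in> carrier A \<Longrightarrow> (g \<ominus>\<^bsub>A\<^esub> f) x = g x \<ominus> f x"
proof -
  note * = is_linear_zero_minus[OF A.module_axioms B.module_axioms evaluation_linear[OF assms(1)]]
  show "(\<ominus>\<^bsub>A\<^esub> f) x = \<ominus> f x" using *(2)[OF assms(2)] by simp
  then show "g \<in> carrier A \<Longrightarrow> (g \<ominus>\<^bsub>A\<^esub> f) x = g x \<ominus> f x" using assms by (simp add: a_minus_def)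
qed

lemma comult_is_linear: "is_linear R C (tensor_module R C C) (comult C)"
  using comult_linear by (simp add: linear_maps_iff)

lemma comult_closed: "c \<in> carrier C \<Longrightarrow> comult C c \<in> carrier (tensor_module R C C)"
  using is_linearD(1)[OF comult_is_linear] .

lemma product_bilinear:
  "is_linear R M B f \<Longrightarrow> is_linear R N B g \<Longrightarrow> is_bilinear R M N B (\<lambda>x y. f x \<otimes> g y)"
  by (rule is_bilinear_precompose[OF mult_bilinear])

lemma convolution_apply:
  "c \<in> carrier C \<Longrightarrow> (f \<otimes>\<^bsub>A\<^esub> g) c = tensor_lift R B (\<lambda>x y. f x \<otimes> g y) (comult C c)"
  by (simp add: dual_simps convolution_def)

lemma convolution_closed:
  assumes "f \<in> carrier A" "g \<in> carrier A"
  shows "f \<otimes>\<^bsub>A\<^esub> g \<in> carrier A"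
  unfolding dual_simps(6) convolution_def
  using assms
  by (intro dual_restrict is_linear_compose[OF comult_is_linear] CC.tensor_lift_linear B.module_axioms
      product_bilinear dual_linear)

lemma counit_in_dual: "counit C \<in> carrier A"
  using counit_linear by (simp add: dual_simps)

text \<open>Both sides arise from the two iterated comultiplications of \<open>c\<close> by applying the linear form \<open>\<Lambda>\<close> that is
induced by \<open>f(x) g(y) h(z)\<close> on \<open>C \<otimes> (C \<otimes> C)\<close>; coassociativity identifies them.\<close>

lemma convolution_assoc:
  assumes f: "f \<in> carrier A" and g: "g \<in> carrier A" and h: "h \<in> carrier A"
  shows "(f \<otimes>\<^bsub>A\<^esub> g) \<otimes>\<^bsub>A\<^esub> h = f \<otimes>\<^bsub>A\<^esub> (g \<otimes>\<^bsub>A\<^esub> h)"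
proof (rule dual_eqI)
  show "(f \<otimes>\<^bsub>A\<^esub> g) \<otimes>\<^bsub>A\<^esub> h \<in> carrier A" "f \<otimes>\<^bsub>A\<^esub> (g \<otimes>\<^bsub>A\<^esub> h) \<in> carrier A"
    using assms convolution_closed by auto
  fix c assume c: "c \<in> carrier C"
  interpret C_CC: tensor_pair R C "tensor_module R C C"
    by (intro tensor_pair.intro tensor_pair_axioms.intro module_axioms CC.tensor_is_module one_neq_zero)
  interpret CC_C: tensor_pair R "tensor_module R C C" C
    by (intro tensor_pair.intro tensor_pair_axioms.intro module_axioms CC.tensor_is_module one_neq_zero)
  let ?T2 = "tensor_module R C C" and ?T3 = "tensor_module R C (tensor_module R C C)"
  let ?p = "pure_tensor R C C" and ?p3 = "pure_tensor R C ?T2"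
  let ?p3' = "pure_tensor R ?T2 C"
  note Bm = B.module_axioms and T3 = C_CC.tensor_is_module
  define gh where "gh = tensor_lift R B (\<lambda>y z. g y \<otimes> h z)"
  define \<Lambda> where "\<Lambda> = tensor_lift R B (\<lambda>x t. f x \<otimes> gh t)"
  define bb where "bb = (\<lambda>t z. tensor_lift R ?T3 (\<lambda>x y. ?p3 x (?p y z)) t)"
  have gh: "is_linear R ?T2 B gh"
    unfolding gh_def by (intro CC.tensor_lift_linear Bm product_bilinear dual_linear g h)
  have f_gh: "is_bilinear R C ?T2 B (\<lambda>x t. f x \<otimes> gh t)" by (intro product_bilinear dual_linear f gh)
  have \<Lambda>: "is_linear R ?T3 B \<Lambda>" unfolding \<Lambda>_def by (intro C_CC.tensor_lift_linear Bm f_gh)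
  have p3_p: "is_bilinear R C C ?T3 (\<lambda>x y. ?p3 x (?p y z))" if "z \<in> carrier C" for z
    using C_CC.pure_tensor_bilinear is_linear_ident is_bilinearD(1)[OF CC.pure_tensor_bilinear that]
    by (rule is_bilinear_precompose)
  have bb: "is_bilinear R ?T2 C ?T3 bb"
    unfolding bb_def
  proof (rule CC.tensor_lift_parameter[OF T3 p3_p _ module_axioms])
    show "is_linear R C ?T3 (\<lambda>z. ?p3 x (?p y z))" if "x \<in> carrier C" "y \<in> carrier C" for x y
      using is_bilinearD(2)[OF CC.pure_tensor_bilinear that(2)] is_bilinearD(2)[OF C_CC.pure_tensor_bilinear that(1)]
      by (rule is_linear_compose)
  qed
  have asc: "tensor_assoc R C C C = tensor_lift R ?T3 bb"
    by (simp add: tensor_assoc_def bb_def Let_def)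
  have asc_lin: "is_linear R (tensor_module R ?T2 C) ?T3 (tensor_lift R ?T3 bb)"
    by (rule CC_C.tensor_lift_linear[OF T3 bb])
  have "\<Lambda> (tensor_lift R ?T3 bb (tensor_lift R (tensor_module R ?T2 C) (\<lambda>x y. ?p3' (comult C x) y) (comult C c)))
    = tensor_lift R B (\<lambda>x y. (f \<otimes>\<^bsub>A\<^esub> g) x \<otimes> h y) (comult C c)"
  proof (rule CC.tensor_lift_compose[OF CC_C.tensor_is_module Bm is_linear_compose[OF asc_lin \<Lambda>] _ _ _ comult_closed[OF c]])
    show "is_bilinear R C C (tensor_module R ?T2 C) (\<lambda>x y. ?p3' (comult C x) y)"
      by (rule is_bilinear_precompose[OF CC_C.pure_tensor_bilinear comult_is_linear is_linear_ident])
    show "is_bilinear R C C B (\<lambda>x y. (f \<otimes>\<^bsub>A\<^esub> g) x \<otimes> h y)"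
      by (intro product_bilinear dual_linear convolution_closed f g h)
    fix x z assume x: "x \<in> carrier C" and z: "z \<in> carrier C"
    have gz: "is_linear R C B (\<lambda>v. g v \<otimes> h z)"
      using dualD(1)[OF h z] dualD[OF g] by (intro is_linearI) (simp_all add: l_distr m_assoc)
    have fgh: "is_bilinear R C C B (\<lambda>u v. f u \<otimes> (g v \<otimes> h z))"
      by (rule product_bilinear[OF dual_linear[OF f] gz])
    have "tensor_lift R ?T3 bb (?p3' (comult C x) z) = bb (comult C x) z"
      by (rule CC_C.tensor_lift_pure[OF T3 bb comult_closed[OF x] z])
    then have "\<Lambda> (tensor_lift R ?T3 bb (?p3' (comult C x) z)) = \<Lambda> (bb (comult C x) z)" by simp
    also have "\<dots> = tensor_lift R B (\<lambda>u v. f u \<otimes> (g v \<otimes> h z)) (comult C x)"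
      unfolding bb_def
    proof (rule CC.tensor_lift_compose[OF T3 Bm \<Lambda> p3_p[OF z] fgh _ comult_closed[OF x]])
      fix u v assume u: "u \<in> carrier C" and v: "v \<in> carrier C"
      have "\<Lambda> (?p3 u (?p v z)) = f u \<otimes> gh (?p v z)"
        unfolding \<Lambda>_def by (rule C_CC.tensor_lift_pure[OF Bm f_gh u CC.pure_tensor_closed[OF v z]])
      also have "gh (?p v z) = g v \<otimes> h z"
        unfolding gh_def by (intro CC.tensor_lift_pure Bm product_bilinear dual_linear g h v z)
      finally show "\<Lambda> (?p3 u (?p v z)) = f u \<otimes> (g v \<otimes> h z)" .
    qed
    also have "\<dots> = h z \<otimes> tensor_lift R B (\<lambda>u v. f u \<otimes> g v) (comult C x)"
    proof (rule CC.tensor_lift_compose[symmetric, OF Bm Bm _ _ fgh _ comult_closed[OF x]])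
      show "is_linear R B B (\<lambda>r. h z \<otimes> r)"
        using is_bilinearD(2)[OF mult_bilinear, of "h z"] dualD(1)[OF h z] by simp
      show "is_bilinear R C C B (\<lambda>u v. f u \<otimes> g v)" by (intro product_bilinear dual_linear f g)
    qed (use dualD(1)[OF f] dualD(1)[OF g] dualD(1)[OF h z] in \<open>simp_all add: m_ac\<close>)
    also have "\<dots> = (f \<otimes>\<^bsub>A\<^esub> g) x \<otimes> h z"
      using dualD(1)[OF h z] dualD(1)[OF convolution_closed[OF f g] x]
      by (simp add: x m_comm flip: convolution_apply)
    finally show "\<Lambda> (tensor_lift R ?T3 bb (?p3' (comult C x) z)) = (f \<otimes>\<^bsub>A\<^esub> g) x \<otimes> h z" .
  qed
  moreover have "\<Lambda> (tensor_lift R ?T3 (\<lambda>x y. ?p3 x (comult C y)) (comult C c))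
    = tensor_lift R B (\<lambda>x y. f x \<otimes> (g \<otimes>\<^bsub>A\<^esub> h) y) (comult C c)"
  proof (rule CC.tensor_lift_compose[OF T3 Bm \<Lambda> _ _ _ comult_closed[OF c]])
    show "is_bilinear R C C ?T3 (\<lambda>x y. ?p3 x (comult C y))"
      by (rule is_bilinear_precompose[OF C_CC.pure_tensor_bilinear is_linear_ident comult_is_linear])
    show "is_bilinear R C C B (\<lambda>x y. f x \<otimes> (g \<otimes>\<^bsub>A\<^esub> h) y)"
      by (intro product_bilinear dual_linear convolution_closed f g h)
    fix x y assume x: "x \<in> carrier C" and y: "y \<in> carrier C"
    show "\<Lambda> (?p3 x (comult C y)) = f x \<otimes> (g \<otimes>\<^bsub>A\<^esub> h) y"
      unfolding \<Lambda>_def C_CC.tensor_lift_pure[OF Bm f_gh x comult_closed[OF y]]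
      by (simp add: gh_def convolution_apply y)
  qed
  ultimately show "((f \<otimes>\<^bsub>A\<^esub> g) \<otimes>\<^bsub>A\<^esub> h) c = (f \<otimes>\<^bsub>A\<^esub> (g \<otimes>\<^bsub>A\<^esub> h)) c"
    using coassoc[OF c] unfolding asc by (simp add: convolution_apply c)
qed

lemma convolution_counit:
  assumes f: "f \<in> carrier A"
  shows "counit C \<otimes>\<^bsub>A\<^esub> f = f" "f \<otimes>\<^bsub>A\<^esub> counit C = f"
proof -
  note e = counit_in_dual and Bm = B.module_axioms
  show "counit C \<otimes>\<^bsub>A\<^esub> f = f"
  proof (rule dual_eqI[OF convolution_closed[OF e f] f])
    fix c assume c: "c \<in> carrier C"
    have "f (tensor_lift R C (\<lambda>x y. counit C x \<odot>\<^bsub>C\<^esub> y) (comult C c)) =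
      tensor_lift R B (\<lambda>x y. counit C x \<otimes> f y) (comult C c)"
      using dualD[OF f] dualD[OF e]
      by (intro CC.tensor_lift_compose[OF module_axioms Bm] dual_linear f comult_closed c product_bilinear e
         is_bilinear_precompose[OF smult_bilinear] is_linear_ident) auto
    then show "(counit C \<otimes>\<^bsub>A\<^esub> f) c = f c" using c by (simp add: counit_left convolution_apply)
  qed
  show "f \<otimes>\<^bsub>A\<^esub> counit C = f"
  proof (rule dual_eqI[OF convolution_closed[OF f e] f])
    fix c assume c: "c \<in> carrier C"
    have "is_bilinear R C C C (\<lambda>x y. counit C y \<odot>\<^bsub>C\<^esub> x)"
      by (intro is_bilinear_flip[OF is_bilinear_precompose[OF smult_bilinear]] is_linear_ident dual_linear e)
    then have "f (tensor_lift R C (\<lambda>x y. counit C y \<odot>\<^bsub>C\<^esub> x) (comult C c)) =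
      tensor_lift R B (\<lambda>x y. f x \<otimes> counit C y) (comult C c)"
      using dualD[OF f] dualD[OF e]
      by (intro CC.tensor_lift_compose[OF module_axioms Bm] dual_linear f comult_closed c product_bilinear e)
        (auto simp: m_comm)
    then show "(f \<otimes>\<^bsub>A\<^esub> counit C) c = f c" using c by (simp add: counit_right convolution_apply)
  qed
qed

lemma convolution_bilinear: "is_bilinear R A A A (\<lambda>f g. f \<otimes>\<^bsub>A\<^esub> g)"
proof -
  have param: "is_bilinear R (tensor_module R C C) A B (\<lambda>t f. tensor_lift R B (\<lambda>x y. f x \<otimes> g y) t)"
    "is_bilinear R (tensor_module R C C) A B (\<lambda>t f. tensor_lift R B (\<lambda>x y. g x \<otimes> f y) t)"
    if g: "g \<in> carrier A" for g
  proof -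
    show "is_bilinear R (tensor_module R C C) A B (\<lambda>t f. tensor_lift R B (\<lambda>x y. f x \<otimes> g y) t)"
    proof (rule CC.tensor_lift_parameter[OF B.module_axioms _ _ A.module_axioms])
      show "is_bilinear R C C B (\<lambda>x y. f x \<otimes> g y)" if "f \<in> carrier A" for f
        by (intro product_bilinear dual_linear that g)
      show "is_linear R A B (\<lambda>f. f x \<otimes> g y)" if "x \<in> carrier C" "y \<in> carrier C" for x y
        using that g by (intro is_linearI) (auto simp: dualD l_distr m_assoc)
    qed
    show "is_bilinear R (tensor_module R C C) A B (\<lambda>t f. tensor_lift R B (\<lambda>x y. g x \<otimes> f y) t)"
    proof (rule CC.tensor_lift_parameter[OF B.module_axioms _ _ A.module_axioms])
      show "is_bilinear R C C B (\<lambda>x y. g x \<otimes> f y)" if "f \<in> carrier A" for f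
        by (intro product_bilinear dual_linear that g)
      show "is_linear R A B (\<lambda>f. g x \<otimes> f y)" if "x \<in> carrier C" "y \<in> carrier C" for x y
        using that g by (intro is_linearI) (auto simp: dualD r_distr m_lcomm)
    qed
  qed
  note l = is_linearD[OF is_bilinearD(2)[OF param(1) comult_closed]]
    and r = is_linearD[OF is_bilinearD(2)[OF param(2) comult_closed]]
  show ?thesis
    unfolding is_bilinear_def
    using l r by (intro conjI ballI is_linearI convolution_closed dual_eqI)
      (auto simp: convolution_closed convolution_apply)
qed

lemma dual_ring: "ring A"
proof (rule ringI)
  note bil = is_linearD[OF is_bilinearD(1)[OF convolution_bilinear]] is_linearD[OF is_bilinearD(2)[OF convolution_bilinear]]
  show "abelian_group A" by (rule A.M.abelian_group_axioms)
  show "Group.monoid A"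
    by (rule monoidI) (auto simp: convolution_closed convolution_assoc convolution_counit counit_in_dual dual_simps(5))
  show "(f \<oplus>\<^bsub>A\<^esub> g) \<otimes>\<^bsub>A\<^esub> h = f \<otimes>\<^bsub>A\<^esub> h \<oplus>\<^bsub>A\<^esub> g \<otimes>\<^bsub>A\<^esub> h"
    if "f \<in> carrier A" "g \<in> carrier A" "h \<in> carrier A" for f g h using bil(2)[OF that(3,1,2)] by simp
  show "h \<otimes>\<^bsub>A\<^esub> (f \<oplus>\<^bsub>A\<^esub> g) = h \<otimes>\<^bsub>A\<^esub> f \<oplus>\<^bsub>A\<^esub> h \<otimes>\<^bsub>A\<^esub> g"
    if "f \<in> carrier A" "g \<in> carrier A" "h \<in> carrier A" for f g h using bil(5)[OF that(3,1,2)] by simp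
qed

interpretation Ar: ring A by (rule dual_ring)

lemma dual_smult_mult:
  assumes "r \<in> carrier R" "f \<in> carrier A" "g \<in> carrier A"
  shows "(r \<odot>\<^bsub>A\<^esub> f) \<otimes>\<^bsub>A\<^esub> g = r \<odot>\<^bsub>A\<^esub> (f \<otimes>\<^bsub>A\<^esub> g)"
    and "f \<otimes>\<^bsub>A\<^esub> (r \<odot>\<^bsub>A\<^esub> g) = r \<odot>\<^bsub>A\<^esub> (f \<otimes>\<^bsub>A\<^esub> g)"
  using is_linearD(3)[OF is_bilinearD(1)[OF convolution_bilinear assms(3)] assms(1,2)]
    is_linearD(3)[OF is_bilinearD(2)[OF convolution_bilinear assms(2)] assms(1,3)] by auto

section \<open>Operators of finite rank and local projectivity\<close>

text \<open>The operators \<open>c \<mapsto> \<Sum>\<^sub>j f\<^sub>j(c) d\<^sub>j\<close>.  Building the sum one term at a time makes the passage to \<open>f \<circ> T\<close> and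
to \<open>(f \<circ> T) x\<close> an induction.\<close>

inductive finite_rank :: "('c \<Rightarrow> 'c) \<Rightarrow> bool" where
  finite_rank_zero: "finite_rank (\<lambda>c. \<zero>\<^bsub>C\<^esub>)"
| finite_rank_step: "f \<in> carrier A \<Longrightarrow> d \<in> carrier C \<Longrightarrow> finite_rank T \<Longrightarrow>
    finite_rank (\<lambda>c. f c \<odot>\<^bsub>C\<^esub> d \<oplus>\<^bsub>C\<^esub> T c)"

lemma finite_rank_linear: "finite_rank T \<Longrightarrow> is_linear R C C T"
proof (induction rule: finite_rank.induct)
  case finite_rank_zero
  show ?case by (rule is_linearI) simp_all
next
  case (finite_rank_step f d T)
  have "is_linear R C C (\<lambda>c. f c \<odot>\<^bsub>C\<^esub> d)"
    using dualD[OF finite_rank_step(1)] finite_rank_step(2)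
    by (intro is_linearI) (simp_all add: smult_l_distr smult_assoc1)
  then show ?case using finite_rank_step(4) by (rule is_linear_add)
qed

lemma finite_rank_closed: "finite_rank T \<Longrightarrow> c \<in> carrier C \<Longrightarrow> T c \<in> carrier C"
  using is_linearD(1)[OF finite_rank_linear] .

lemma finite_rank_add:
  assumes "finite_rank T" "finite_rank S"
  shows "\<exists>U. finite_rank U \<and> (\<forall>c\<in>carrier C. U c = T c \<oplus>\<^bsub>C\<^esub> S c)"
  using assms(1)
proof (induction rule: finite_rank.induct)
  case finite_rank_zero
  show ?case using assms(2) finite_rank_closed by (intro exI[of _ S]) simp
next
  case (finite_rank_step f d T)
  then obtain U where U: "finite_rank U" "\<forall>c\<in>carrier C. U c = T c \<oplus>\<^bsub>C\<^esub> S c" by blast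
  have "f c \<odot>\<^bsub>C\<^esub> d \<oplus>\<^bsub>C\<^esub> U c = f c \<odot>\<^bsub>C\<^esub> d \<oplus>\<^bsub>C\<^esub> T c \<oplus>\<^bsub>C\<^esub> S c" if "c \<in> carrier C" for c
    using that U(2) dualD(1)[OF finite_rank_step(1) that] finite_rank_step(2)
      finite_rank_closed[OF finite_rank_step(3) that] finite_rank_closed[OF assms(2) that]
    by (simp add: M.a_assoc)
  then show ?case
    using finite_rank.finite_rank_step[OF finite_rank_step(1,2) U(1)] by blast
qed

lemma finite_rank_compose:
  assumes "finite_rank T" and L: "is_linear R C C L"
  shows "\<exists>U. finite_rank U \<and> (\<forall>c\<in>carrier C. U c = L (T c))"
  using assms(1)
proof (induction rule: finite_rank.induct)
  case finite_rank_zero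
  show ?case using is_linear_zero_minus(1)[OF module_axioms module_axioms L] finite_rank.finite_rank_zero
    by (intro exI[of _ "\<lambda>c. \<zero>\<^bsub>C\<^esub>"]) simp
next
  case (finite_rank_step f d T)
  then obtain U where U: "finite_rank U" "\<forall>c\<in>carrier C. U c = L (T c)" by blast
  have "f c \<odot>\<^bsub>C\<^esub> L d \<oplus>\<^bsub>C\<^esub> U c = L (f c \<odot>\<^bsub>C\<^esub> d \<oplus>\<^bsub>C\<^esub> T c)" if "c \<in> carrier C" for c
    using that U(2) dualD(1)[OF finite_rank_step(1) that] finite_rank_step(2)
      finite_rank_closed[OF finite_rank_step(3) that]
    by (simp add: is_linearD[OF L])
  then show ?case
    using finite_rank.finite_rank_step[OF finite_rank_step(1) is_linearD(1)[OF L finite_rank_step(2)] U(1)] by blast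
qed

lemma tensor_to_hom_eq:
  assumes "f \<in> carrier A"
  shows "tensor_to_hom R X C t f = tensor_lift R X (\<lambda>x c. f c \<odot>\<^bsub>X\<^esub> x) t"
  using assms by (simp add: tensor_to_hom_def dual_algebra_def)

lemma action_bilinear:
  assumes "module R X" "f \<in> carrier A"
  shows "is_bilinear R X C X (\<lambda>x c. f c \<odot>\<^bsub>X\<^esub> x)"
proof -
  interpret X: module R X by fact
  show ?thesis
    by (rule is_bilinear_flip[OF is_bilinear_precompose[OF X.smult_bilinear dual_linear[OF assms(2)] is_linear_ident]])
qed

text \<open>A dual basis for a single element \<open>c\<close>.  Let \<open>I\<close> be the ideal of all values \<open>f(c)\<close>.  In \<open>R/I \<otimes> C\<close> the element
\<open>1 \<otimes> c\<close> is annihilated by the canonical map into \<open>Hom(C\<^sup>*, R/I)\<close>, so it is zero by local projectivity.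
On the other hand \<open>(r + I) \<otimes> d \<mapsto> r d + N\<close> is well defined on \<open>R/I \<otimes> C\<close>, where \<open>N\<close> consists of the values
\<open>T c\<close> of operators of finite rank, because \<open>I d \<subseteq> N\<close>.  Hence \<open>c \<in> N\<close>.\<close>

lemma finite_rank_fixes_point:
  assumes lp: "locally_projective TYPE(('r, 'c, 'x) module_universe) R C" and c: "c \<in> carrier C"
  shows "\<exists>T. finite_rank T \<and> T c = c"
proof -
  define I where "I = (\<lambda>f. f c) ` carrier A"
  define N where "N = {T c | T. finite_rank T}"
  have I: "submodule I R B"
    unfolding I_def
    by (rule linear_image_submodule[OF A.module_axioms B.module_axioms evaluation_linear[OF c] A.carrier_is_submodule])
  have NI: "T c \<in> N" if "finite_rank T" for T unfolding N_def using that by blast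
  have N: "submodule N R C"
  proof (rule submoduleI)
    show "N \<subseteq> carrier C" unfolding N_def using finite_rank_closed c by blast
    show "\<zero>\<^bsub>C\<^esub> \<in> N" unfolding N_def using finite_rank_zero by force
    have compose: "L x \<in> N" if "is_linear R C C L" "x \<in> N" for L x
      using that finite_rank_compose c unfolding N_def by (smt (verit, ccfv_threshold) mem_Collect_eq)
    show sm: "r \<odot>\<^bsub>C\<^esub> x \<in> N" if "r \<in> carrier R" "x \<in> N" for r x
      using is_linear_smult[OF is_linear_ident that(1)] that(2) by (rule compose)
    show "\<ominus>\<^bsub>C\<^esub> x \<in> N" if "x \<in> N" for x
      using sm[OF _ that, of "\<ominus> \<one>"] that \<open>N \<subseteq> carrier C\<close> smult_l_minus[of \<one> x] by auto
    show "x \<oplus>\<^bsub>C\<^esub> y \<in> N" if "x \<in> N" "y \<in> N" for x y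
    proof -
      obtain T S where TS: "finite_rank T" "x = T c" "finite_rank S" "y = S c"
        using \<open>x \<in> N\<close> \<open>y \<in> N\<close> unfolding N_def by blast
      obtain U where U: "finite_rank U" "\<forall>c\<in>carrier C. U c = T c \<oplus>\<^bsub>C\<^esub> S c"
        using finite_rank_add[OF TS(1,3)] by blast
      have "U c \<in> N" unfolding N_def using U(1) by blast
      then show ?thesis using U(2) c TS by simp
    qed
  qed
  have IN: "r \<odot>\<^bsub>C\<^esub> d \<in> N" if r: "r \<in> I" and d: "d \<in> carrier C" for r d
  proof -
    obtain f where f: "f \<in> carrier A" "r = f c" using r unfolding I_def by blast
    have "finite_rank (\<lambda>c. f c \<odot>\<^bsub>C\<^esub> d \<oplus>\<^bsub>C\<^esub> \<zero>\<^bsub>C\<^esub>)"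
      by (rule finite_rank_step[OF f(1) d finite_rank_zero])
    then have "f c \<odot>\<^bsub>C\<^esub> d \<oplus>\<^bsub>C\<^esub> \<zero>\<^bsub>C\<^esub> \<in> N" by (rule NI)
    then show ?thesis using f dualD(1)[OF f(1) c] d by simp
  qed
  \<comment> \<open>\<open>R/I\<close> is realized inside the universe type: a coset, a set of elements of \<open>R\<close>, is encoded as a set of
    constant functions on \<open>nat\<close>.\<close>
  define q :: "'r \<Rightarrow> ('r, 'c, 'x) module_universe" where "q r = Inr (Inr ((\<lambda>s _. s) ` (I +>\<^bsub>B\<^esub> r)))" for r
  define X where "X = image_module B q"
  have "inj ((\<lambda>s _. s) :: 'r \<Rightarrow> nat \<Rightarrow> 'r)" by (rule injI) (drule fun_cong, simp)
  then have q_eq: "q r = q s \<longleftrightarrow> r \<ominus>\<^bsub>B\<^esub> s \<in> I" if "r \<in> carrier B" "s \<in> carrier B" for r s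
    unfolding q_def using B.coset_eq_iff[OF I that] by (simp add: inj_image_eq_iff)
  note Bl = conjunct2[OF B.module_axioms[unfolded module_iff_left_module]]
  note X = image_module[OF Bl q_eq B.submoduleE(5)[OF I] B.submoduleE(4)[OF I], folded X_def]
  have X_mod: "module R X" using X(1) by (simp add: module_iff_left_module is_cring)
  interpret X: module R X by (rule X_mod)
  interpret XC: tensor_pair R X C
    by (intro tensor_pair.intro tensor_pair_axioms.intro module_axioms X_mod one_neq_zero)
  have q_lin: "is_linear R B X q" using X by (intro is_linearI) auto
  have q0: "q r = \<zero>\<^bsub>X\<^esub>" if "r \<in> I" for r
  proof -
    have r: "r \<in> carrier B" using that B.submoduleE(1)[OF I] by blast
    have "r \<ominus> \<zero> = r" using r by (simp add: a_minus_def)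
    then have "q r = q \<zero>\<^bsub>B\<^esub>" using q_eq[OF r B.M.zero_closed] that by simp
    then show ?thesis by (simp only: X(5))
  qed
  have q1: "q \<one> \<in> carrier X" using is_linearD(1)[OF q_lin, of \<one>] by simp
  let ?t = "pure_tensor R X C (q \<one>) c" and ?T = "tensor_module R X C"
  interpret XCT: module R ?T by (rule XC.tensor_is_module)
  have t: "?t \<in> carrier ?T" by (rule XC.pure_tensor_closed[OF q1 c])
  have tt: "tensor_to_hom R X C ?t = tensor_to_hom R X C \<zero>\<^bsub>?T\<^esub>"
  proof
    fix f
    show "tensor_to_hom R X C ?t f = tensor_to_hom R X C \<zero>\<^bsub>?T\<^esub> f"
    proof (cases "f \<in> carrier A")
      case True
      note bil = action_bilinear[OF X_mod True]
      have "tensor_to_hom R X C ?t f = f c \<odot>\<^bsub>X\<^esub> q \<one>"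
        unfolding tensor_to_hom_eq[OF True] by (rule XC.tensor_lift_pure[OF X_mod bil q1 c])
      also have "\<dots> = q (f c)"
        using is_linearD(3)[OF q_lin, of "f c" \<one>] dualD(1)[OF True c] by simp
      also have "\<dots> = \<zero>\<^bsub>X\<^esub>" using True unfolding I_def by (intro q0[unfolded I_def] imageI)
      also have "\<dots> = tensor_to_hom R X C \<zero>\<^bsub>?T\<^esub> f"
        unfolding tensor_to_hom_eq[OF True]
        by (rule is_linear_zero_minus(1)[symmetric, OF XCT.module_axioms X_mod XC.tensor_lift_linear[OF X_mod bil]])
      finally show ?thesis .
    qed (simp add: tensor_to_hom_def dual_algebra_def)
  qed
  have inj: "inj_on (tensor_to_hom R X C) (carrier ?T)"
    using lp X_mod unfolding locally_projective_def by blast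
  have t0: "?t = \<zero>\<^bsub>?T\<^esub>" by (rule inj_onD[OF inj tt t XCT.M.zero_closed])
  let ?Q = "quotient_module C N"
  \<comment> \<open>The map induced by \<open>(r + I, d) \<mapsto> r d + N\<close>, written with representatives.\<close>
  define rep where "rep = inv_into (carrier R) q"
  define b where "b u d = N +>\<^bsub>C\<^esub> (rep u \<odot>\<^bsub>C\<^esub> d)" for u d
  have Q: "module R ?Q" by (rule quotient_module_is_module[OF N])
  note p = quotient_projection_linear[OF N]
  have b_q: "b (q r) d = N +>\<^bsub>C\<^esub> (r \<odot>\<^bsub>C\<^esub> d)" if r: "r \<in> carrier R" and d: "d \<in> carrier C" for r d
  proof -
    have rep: "rep (q r) \<in> carrier R" "q (rep (q r)) = q r"
      unfolding rep_def using r by (auto intro: inv_into_into f_inv_into_f)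
    then have "rep (q r) \<ominus>\<^bsub>B\<^esub> r \<in> I" using q_eq[of "rep (q r)" r] r by simp
    then have "(rep (q r) \<ominus>\<^bsub>B\<^esub> r) \<odot>\<^bsub>C\<^esub> d \<in> N" using d by (rule IN)
    then have "rep (q r) \<odot>\<^bsub>C\<^esub> d \<ominus>\<^bsub>C\<^esub> r \<odot>\<^bsub>C\<^esub> d \<in> N"
      using rep(1) r d by (simp add: a_minus_def smult_l_distr smult_l_minus)
    then show ?thesis unfolding b_def using rep(1) r d by (simp add: coset_eq_iff[OF N])
  qed
  have b_bil: "is_bilinear R X C ?Q b"
    unfolding is_bilinear_def
  proof (intro conjI ballI)
    have uq: "\<exists>r\<in>carrier R. u = q r" if "u \<in> carrier X" for u using that X(4) by auto
    show "is_linear R C ?Q (b u)" if u: "u \<in> carrier X" for u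
    proof -
      obtain r where r: "r \<in> carrier R" "u = q r" using uq[OF u] by blast
      have "is_linear R C ?Q (\<lambda>d. N +>\<^bsub>C\<^esub> (r \<odot>\<^bsub>C\<^esub> d))"
        by (rule is_linear_compose[OF is_linear_smult[OF is_linear_ident r(1)] p])
      then show ?thesis by (rule is_linear_cong[OF _ module_axioms]) (simp add: r b_q)
    qed
    show "is_linear R X ?Q (\<lambda>u. b u d)" if d: "d \<in> carrier C" for d
    proof (rule is_linearI)
      have lin: "is_linear R B ?Q (\<lambda>r. N +>\<^bsub>C\<^esub> (r \<odot>\<^bsub>C\<^esub> d))"
        using is_bilinearD(1)[OF smult_bilinear d] p by (rule is_linear_compose)
      note lin = is_linearD[OF lin, simplified]
      show "b u d \<in> carrier ?Q" if "u \<in> carrier X" for u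
        using uq[OF that] lin(1) b_q[OF _ d] by auto
      show "b (u \<oplus>\<^bsub>X\<^esub> v) d = b u d \<oplus>\<^bsub>?Q\<^esub> b v d" if u: "u \<in> carrier X" and v: "v \<in> carrier X" for u v
      proof -
        obtain r s where rs: "r \<in> carrier R" "u = q r" "s \<in> carrier R" "v = q s" using uq[OF u] uq[OF v] by blast
        have "u \<oplus>\<^bsub>X\<^esub> v = q (r \<oplus> s)" using is_linearD(2)[OF q_lin, of r s] rs by simp
        then show ?thesis using rs lin(2)[OF rs(1,3)] b_q[OF _ d] by simp
      qed
      show "b (r \<odot>\<^bsub>X\<^esub> u) d = r \<odot>\<^bsub>?Q\<^esub> b u d" if r: "r \<in> carrier R" and u: "u \<in> carrier X" for r u
      proof -
        obtain s where s: "s \<in> carrier R" "u = q s" using uq[OF u] by blast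
        have "r \<odot>\<^bsub>X\<^esub> u = q (r \<otimes> s)" using is_linearD(3)[OF q_lin, of r s] r s by simp
        then show ?thesis using r s lin(3)[OF r s(1)] b_q[OF _ d] by simp
      qed
    qed
  qed
  have "N +>\<^bsub>C\<^esub> c = b (q \<one>) c" using b_q[OF _ c, of \<one>] c by simp
  also have "\<dots> = tensor_lift R ?Q b ?t" by (rule XC.tensor_lift_pure[symmetric, OF Q b_bil q1 c])
  also have "\<dots> = N"
    unfolding t0 is_linear_zero_minus(1)[OF XCT.module_axioms Q XC.tensor_lift_linear[OF Q b_bil]] by simp
  finally have "N +>\<^bsub>C\<^esub> c = N" .
  moreover have "c \<in> N +>\<^bsub>C\<^esub> c"
    by (rule abelian_subgroup.a_rcos_self[OF abelian_subgroup_of_submodule[OF N] c])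
  ultimately have "c \<in> N" by simp
  then obtain T where "finite_rank T" "c = T c" unfolding N_def by blast
  then show ?thesis by (intro exI[of _ T]) simp
qed

text \<open>If \<open>T\<close> fixes \<open>K\<close> and \<open>S\<close> fixes \<open>k - T k\<close>, then \<open>U = T + S - S T\<close> fixes \<open>K\<close> and \<open>k\<close>, since
\<open>1 - U = (1 - S) (1 - T)\<close>.\<close>

lemma finite_rank_fixes_finite:
  assumes lp: "locally_projective TYPE(('r, 'c, 'x) module_universe) R C"
    and "finite K" "K \<subseteq> carrier C"
  shows "\<exists>T. finite_rank T \<and> (\<forall>k\<in>K. T k = k)"
  using assms(2,3)
proof (induction K rule: finite_induct)
  case empty
  show ?case using finite_rank_zero by blast
next
  case (insert k K)
  have k: "k \<in> carrier C" and K: "\<And>x. x \<in> K \<Longrightarrow> x \<in> carrier C" using insert.prems by auto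
  obtain T where T: "finite_rank T" "\<forall>k\<in>K. T k = k" using insert by auto
  have Tc: "T c \<in> carrier C" if "c \<in> carrier C" for c using finite_rank_closed[OF T(1) that] .
  have kT: "k \<ominus>\<^bsub>C\<^esub> T k \<in> carrier C" using k Tc by simp
  obtain S where S: "finite_rank S" "S (k \<ominus>\<^bsub>C\<^esub> T k) = k \<ominus>\<^bsub>C\<^esub> T k"
    using finite_rank_fixes_point[OF lp kT] by blast
  have Sc: "S c \<in> carrier C" if "c \<in> carrier C" for c using finite_rank_closed[OF S(1) that] .
  note S_lin = is_linearD[OF finite_rank_linear[OF S(1)]]
    is_linear_zero_minus[OF module_axioms module_axioms finite_rank_linear[OF S(1)]]
  have "is_linear R C C (\<lambda>c. (\<ominus> \<one>) \<odot>\<^bsub>C\<^esub> S c)"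
    by (rule is_linear_smult[OF finite_rank_linear[OF S(1)]]) simp
  then have "is_linear R C C (\<lambda>c. \<ominus>\<^bsub>C\<^esub> S c)"
    using Sc smult_l_minus[of \<one>] by (elim is_linear_cong[OF _ module_axioms]) simp
  then obtain V where V: "finite_rank V" "\<forall>c\<in>carrier C. V c = \<ominus>\<^bsub>C\<^esub> S (T c)"
    using finite_rank_compose[OF T(1)] by blast
  obtain W where W: "finite_rank W" "\<forall>c\<in>carrier C. W c = S c \<oplus>\<^bsub>C\<^esub> V c"
    using finite_rank_add[OF S(1) V(1)] by blast
  obtain U where U: "finite_rank U" "\<forall>c\<in>carrier C. U c = T c \<oplus>\<^bsub>C\<^esub> W c"
    using finite_rank_add[OF T(1) W(1)] by blast
  have Uc: "U c = T c \<oplus>\<^bsub>C\<^esub> S (c \<ominus>\<^bsub>C\<^esub> T c)" if "c \<in> carrier C" for c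
    using that Tc[OF that] Sc U(2) V(2) W(2) by (simp add: S_lin(6)) (simp add: a_minus_def)
  have "U k = k"
    using Uc[OF k] k Tc[OF k] by (simp add: S(2)) (simp add: a_minus_def M.a_ac M.r_neg M.r_neg1 M.r_neg2)
  moreover have "U x = x" if "x \<in> K" for x
    using Uc[OF K[OF that]] K[OF that] T(2) that by (simp add: a_minus_def M.r_neg S_lin(4))
  ultimately show ?case using U(1) by blast
qed

abbreviation ann where "ann \<equiv> annihilator R C"
abbreviation pullback where "pullback T f \<equiv> (\<lambda>c\<in>carrier C. f (T c))"

lemma precompose_in_dual:
  assumes "finite_rank T" "f \<in> carrier A"
  shows "pullback T f \<in> carrier A"
  by (rule dual_restrict[OF is_linear_compose[OF finite_rank_linear[OF assms(1)] dual_linear[OF assms(2)]]])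

lemma precompose_step:
  assumes "f \<in> carrier A" "g \<in> carrier A" "d \<in> carrier C" "finite_rank T"
  shows "(\<lambda>c\<in>carrier C. f (g c \<odot>\<^bsub>C\<^esub> d \<oplus>\<^bsub>C\<^esub> T c)) = f d \<odot>\<^bsub>A\<^esub> g \<oplus>\<^bsub>A\<^esub> (pullback T f)"
proof (rule dual_eqI)
  show "(\<lambda>c\<in>carrier C. f (g c \<odot>\<^bsub>C\<^esub> d \<oplus>\<^bsub>C\<^esub> T c)) \<in> carrier A"
    by (rule precompose_in_dual[OF finite_rank_step[OF assms(2-4)] assms(1)])
  show "f d \<odot>\<^bsub>A\<^esub> g \<oplus>\<^bsub>A\<^esub> (pullback T f) \<in> carrier A"
    using assms precompose_in_dual dualD(1)[OF assms(1,3)] by (intro dual_closed)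
  fix c assume c: "c \<in> carrier C"
  show "(\<lambda>c\<in>carrier C. f (g c \<odot>\<^bsub>C\<^esub> d \<oplus>\<^bsub>C\<^esub> T c)) c = (f d \<odot>\<^bsub>A\<^esub> g \<oplus>\<^bsub>A\<^esub> (pullback T f)) c"
    using c assms(3) dualD(1)[OF assms(2) c] finite_rank_closed[OF assms(4) c] dualD(1)[OF assms(1,3)]
    by (simp add: dualD(2,3)[OF assms(1)] m_comm)
qed

text \<open>For \<open>T = \<Sum>\<^sub>j f\<^sub>j(-) d\<^sub>j\<close> the value is \<open>\<phi>(f \<circ> T) = \<Sum>\<^sub>j f(d\<^sub>j) \<phi>(f\<^sub>j)\<close>, so the element of \<open>C\<close> is
\<open>\<Sum>\<^sub>j \<phi>(f\<^sub>j) d\<^sub>j\<close>.\<close>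

lemma functional_of_finite_rank:
  assumes "finite_rank T" and \<phi>: "is_linear R A B \<phi>"
  shows "\<exists>d\<in>carrier C. \<forall>f\<in>carrier A. \<phi> (pullback T f) = f d"
  using assms(1)
proof (induction rule: finite_rank.induct)
  case finite_rank_zero
  have "(\<lambda>c\<in>carrier C. f \<zero>\<^bsub>C\<^esub>) = \<zero>\<^bsub>A\<^esub>" "f \<zero>\<^bsub>C\<^esub> = \<zero>" if f: "f \<in> carrier A" for f
    using is_linear_zero_minus(1)[OF module_axioms B.module_axioms dual_linear[OF f]] by (simp_all add: dual_simps)
  then show ?case
    using is_linear_zero_minus(1)[OF A.module_axioms B.module_axioms \<phi>] by (intro bexI[of _ "\<zero>\<^bsub>C\<^esub>"]) simp_all
next
  case (finite_rank_step g d T)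
  note g = finite_rank_step(1) and d = finite_rank_step(2) and T = finite_rank_step(3)
  obtain e where e: "e \<in> carrier C" "\<forall>f\<in>carrier A. \<phi> (pullback T f) = f e"
    using finite_rank_step(4) by blast
  have \<phi>g: "\<phi> g \<in> carrier R" using is_linearD(1)[OF \<phi> g] by simp
  show ?case
  proof (intro bexI[of _ "\<phi> g \<odot>\<^bsub>C\<^esub> d \<oplus>\<^bsub>C\<^esub> e"] ballI)
    show "\<phi> g \<odot>\<^bsub>C\<^esub> d \<oplus>\<^bsub>C\<^esub> e \<in> carrier C" using \<phi>g d e(1) by simp
    fix f assume f: "f \<in> carrier A"
    have fd: "f d \<in> carrier R" using dualD(1)[OF f d] .
    have "\<phi> (f d \<odot>\<^bsub>A\<^esub> g \<oplus>\<^bsub>A\<^esub> (pullback T f)) = f d \<otimes> \<phi> g \<oplus> f e"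
      using e(2) f g fd is_linearD(2)[OF \<phi> dual_closed(3)[OF fd g] precompose_in_dual[OF T f]]
        is_linearD(3)[OF \<phi> fd g] by simp
    also have "\<dots> = f (\<phi> g \<odot>\<^bsub>C\<^esub> d \<oplus>\<^bsub>C\<^esub> e)"
      using \<phi>g d e(1) fd by (simp add: dualD(2,3)[OF f] m_comm)
    finally show "\<phi> (\<lambda>c\<in>carrier C. f (g c \<odot>\<^bsub>C\<^esub> d \<oplus>\<^bsub>C\<^esub> T c)) = f (\<phi> g \<odot>\<^bsub>C\<^esub> d \<oplus>\<^bsub>C\<^esub> e)"
      unfolding precompose_step[OF f g d T] .
  qed
qed

lemma annihilatorD:
  assumes "f \<in> ann K"
  shows "f \<in> carrier A" "c \<in> K \<Longrightarrow> f c = \<zero>"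
  using assms by (auto simp: annihilator_def)

lemma annihilator_submodule:
  assumes "K \<subseteq> carrier C"
  shows "submodule (ann K) R A"
proof -
  have K: "c \<in> carrier C" if "c \<in> K" for c using that assms by auto
  show ?thesis
    by (rule A.submoduleI) (auto simp: annihilator_def K dual_closed A.M.zero_closed)
qed

lemma minus_precompose_in_annihilator:
  assumes "finite_rank T" "\<forall>k\<in>K. T k = k" "K \<subseteq> carrier C" "f \<in> carrier A"
  shows "f \<ominus>\<^bsub>A\<^esub> (pullback T f) \<in> ann K"
proof -
  have P: "pullback T f \<in> carrier A" using precompose_in_dual assms by blast
  have "(f \<ominus>\<^bsub>A\<^esub> (pullback T f)) k = \<zero>" if k: "k \<in> K" for k
  proof -
    have kc: "k \<in> carrier C" using k assms(3) by auto
    then show ?thesis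
      using assms(2) k dualD(1)[OF assms(4) kc] dual_minus(2)[OF kc P assms(4)]
      by (simp add: a_minus_def R.r_neg)
  qed
  then show ?thesis
    unfolding annihilator_def using A.M.minus_closed[OF assms(4) P] by blast
qed

text \<open>Such a form is continuous for the finite topology, and continuous forms are evaluations: \<open>\<phi>\<close> does not
distinguish \<open>f\<close> from \<open>f \<circ> T\<close> when \<open>T\<close> fixes \<open>K\<close>.\<close>

lemma functional_vanishing_on_annihilator:
  assumes lp: "locally_projective TYPE(('r, 'c, 'x) module_universe) R C"
    and K: "finite K" "K \<subseteq> carrier C"
    and \<phi>: "is_linear R A B \<phi>" and van: "\<And>f. f \<in> ann K \<Longrightarrow> \<phi> f = \<zero>"
  shows "\<exists>d\<in>carrier C. \<forall>f\<in>carrier A. \<phi> f = f d"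
proof -
  obtain T where T: "finite_rank T" "\<forall>k\<in>K. T k = k"
    using finite_rank_fixes_finite[OF lp K] by blast
  obtain d where d: "d \<in> carrier C" "\<forall>f\<in>carrier A. \<phi> (pullback T f) = f d"
    using functional_of_finite_rank[OF T(1) \<phi>] by blast
  have "\<phi> f = f d" if f: "f \<in> carrier A" for f
  proof -
    note P = precompose_in_dual[OF T(1) f]
    have "\<phi> f \<ominus> \<phi> (pullback T f) = \<zero>"
      using van[OF minus_precompose_in_annihilator[OF T K(2) f]]
        is_linear_zero_minus(3)[OF A.module_axioms B.module_axioms \<phi> f P] by simp
    then show ?thesis
      using d(2) f is_linearD(1)[OF \<phi> f] is_linearD(1)[OF \<phi> P] by simp
  qed
  then show ?thesis using d(1) by blast
qed

text \<open>An element at which all forms vanish is annihilated by all operators of finite rank, one of which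
fixes it.\<close>

lemma dual_separates_points:
  assumes lp: "locally_projective TYPE(('r, 'c, 'x) module_universe) R C"
    and c: "c \<in> carrier C" and zero: "\<And>f. f \<in> carrier A \<Longrightarrow> f c = \<zero>"
  shows "c = \<zero>\<^bsub>C\<^esub>"
proof -
  have "T c = \<zero>\<^bsub>C\<^esub>" if "finite_rank T" for T
    using that
  proof (induction rule: finite_rank.induct)
    case (finite_rank_step f d T)
    then show ?case using zero[OF finite_rank_step(1)] by simp
  qed simp
  then show ?thesis using finite_rank_fixes_point[OF lp c] by metis
qed

section \<open>Cofinite ideals\<close>

lemma ideal_submodule:
  assumes "ideal I A"
  shows "submodule I R A"
proof -
  interpret I: ideal I A by fact
  show ?thesis
  proof (rule A.submoduleI)
    show "r \<odot>\<^bsub>A\<^esub> f \<in> I" if r: "r \<in> carrier R" and f: "f \<in> I" for r f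
    proof -
      have fc: "f \<in> carrier A" using f by (rule I.a_Hcarr)
      have "(r \<odot>\<^bsub>A\<^esub> \<one>\<^bsub>A\<^esub>) \<otimes>\<^bsub>A\<^esub> f \<in> I"
        using f dual_closed(3)[OF r Ar.one_closed] by (rule I.I_l_closed)
      then show ?thesis by (simp add: dual_smult_mult(1)[OF r Ar.one_closed fc] Ar.l_one[OF fc])
    qed
  qed (use I.a_subset I.a_closed I.a_inv_closed I.zero_closed in auto)
qed

lemma cofinite_ideal_iff:
  "cofinite_ideal R A I \<longleftrightarrow> ideal I A \<and> finite_over R A I (carrier A)"
  unfolding cofinite_ideal_def using A.quotient_fg_iff[OF ideal_submodule] by blast

text \<open>\<open>I/(I \<inter> J)\<close> embeds into the noetherian module \<open>A/J\<close>.\<close>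

lemma cofinite_ideal_Int:
  assumes "noetherian_ring R" "cofinite_ideal R A I" "cofinite_ideal R A J"
  shows "cofinite_ideal R A (I \<inter> J)"
proof -
  have I: "ideal I A" "finite_over R A I (carrier A)" and J: "ideal J A" "fg_module R (quotient_module A J)"
    using assms(2,3) cofinite_ideal_iff unfolding cofinite_ideal_def by auto
  note Is = ideal_submodule[OF I(1)] and Js = ideal_submodule[OF J(1)]
  let ?Q = "quotient_module A J"
  interpret Q: module R ?Q by (rule A.quotient_module_is_module[OF Js])
  note Ic = A.submoduleE(1)[OF Is]
  obtain S where S: "finite S" "S \<subseteq> carrier ?Q" "submodule_span R ?Q S = carrier ?Q"
    using J(2) unfolding fg_module_def by blast
  have "(\<lambda>f. J +>\<^bsub>A\<^esub> f) ` I \<subseteq> submodule_span R ?Q S"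
    unfolding S(3) using Ic by auto
  then have "finite_over R A {f \<in> I. J +>\<^bsub>A\<^esub> f = \<zero>\<^bsub>?Q\<^esub>} I"
    by (rule finite_over_kernel[OF assms(1) A.module_axioms Q.module_axioms A.quotient_projection_linear[OF Js] Is S(1,2)])
  moreover have "{f \<in> I. J +>\<^bsub>A\<^esub> f = \<zero>\<^bsub>?Q\<^esub>} = I \<inter> J"
    using abelian_subgroup.a_rcos_const[OF A.abelian_subgroup_of_submodule[OF Js]]
      abelian_subgroup.a_rcos_self[OF A.abelian_subgroup_of_submodule[OF Js]] Ic by auto
  ultimately have "finite_over R A (I \<inter> J) (carrier A)"
    using A.finite_over_trans[OF I(2)] Ic by auto
  moreover have "ideal (I \<inter> J) A" using Ar.i_intersect I(1) J(1) by blast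
  ultimately show ?thesis unfolding cofinite_ideal_iff by blast
qed

lemma finite_over_annihilator:
  assumes "noetherian_ring R" "finite Y" "Y \<subseteq> carrier C"
  shows "finite_over R A (ann Y) (carrier A)"
proof -
  have "finite_over R A {f \<in> carrier A. \<forall>y\<in>Y. f y = \<zero>\<^bsub>B\<^esub>} (carrier A)"
  proof (rule finite_over_common_kernel[OF assms(1) A.module_axioms B.module_axioms A.carrier_is_submodule assms(2)])
    fix y assume "y \<in> Y"
    then have y: "y \<in> carrier C" using assms(3) by auto
    show "is_linear R A B (\<lambda>f. f y)" by (rule evaluation_linear[OF y])
    show "\<exists>S. finite S \<and> S \<subseteq> carrier B \<and> (\<lambda>f. f y) ` carrier A \<subseteq> submodule_span R B S"
      using dualD(1)[OF _ y] by (intro exI[of _ "{\<one>}"]) (auto simp: base_module_span)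
  qed
  then show ?thesis by (simp add: annihilator_def)
qed

lemma convolution_finite_support:
  assumes c: "c \<in> carrier C"
  obtains D where "finite D" "D \<subseteq> carrier C \<times> carrier C"
    "\<And>f g. f \<in> carrier A \<Longrightarrow> g \<in> carrier A \<Longrightarrow> (\<And>x y. (x, y) \<in> D \<Longrightarrow> f x \<otimes> g y = \<zero>) \<Longrightarrow>
      (f \<otimes>\<^bsub>A\<^esub> g) c = \<zero>"
proof -
  obtain D where D: "finite D" "D \<subseteq> carrier C \<times> carrier C"
    "\<And>P b. module R P \<Longrightarrow> is_bilinear R C C P b \<Longrightarrow> (\<And>x y. (x, y) \<in> D \<Longrightarrow> b x y = \<zero>\<^bsub>P\<^esub>) \<Longrightarrow>
       tensor_lift R P b (comult C c) = zero (P :: ('r, 'r) module)"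
    using CC.tensor_finite_support[OF comult_closed[OF c]] by blast
  have "(f \<otimes>\<^bsub>A\<^esub> g) c = \<zero>"
    if "f \<in> carrier A" "g \<in> carrier A" "\<And>x y. (x, y) \<in> D \<Longrightarrow> f x \<otimes> g y = \<zero>" for f g
    using D(3)[OF B.module_axioms product_bilinear[OF dual_linear[OF that(1)] dual_linear[OF that(2)]]] that(3)
    by (simp add: convolution_apply[OF c])
  then show ?thesis by (rule that[OF D(1,2)])
qed

text \<open>The ideal \<open>I\<close> of all \<open>f\<close> with \<open>(a f b)(c) = 0\<close> for all \<open>a\<close>, \<open>b\<close> and all \<open>c \<in> K\<close> is the annihilator of the
subbimodule generated by \<open>K\<close>.  The value \<open>(a f b)(c)\<close> only involves the values of \<open>f\<close> at the finite set \<open>Y\<close>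
of middle factors of the twofold comultiplication of \<open>c\<close>, so \<open>ann Y \<subseteq> I\<close> and \<open>I\<close> is cofinite.\<close>

lemma cofinite_ideal_in_annihilator:
  assumes noeth: "noetherian_ring R" and K: "finite K" "K \<subseteq> carrier C"
  shows "\<exists>I. cofinite_ideal R A I \<and> I \<subseteq> ann K"
proof -
  define I where "I = {f \<in> carrier A. \<forall>c\<in>K. \<forall>a\<in>carrier A. \<forall>b\<in>carrier A. ((a \<otimes>\<^bsub>A\<^esub> f) \<otimes>\<^bsub>A\<^esub> b) c = \<zero>}"
  have Kc: "c \<in> carrier C" if "c \<in> K" for c using that K(2) by auto
  have I_iff: "f \<in> I \<longleftrightarrow> f \<in> carrier A \<and> (\<forall>c\<in>K. \<forall>a\<in>carrier A. \<forall>b\<in>carrier A. ((a \<otimes>\<^bsub>A\<^esub> f) \<otimes>\<^bsub>A\<^esub> b) c = \<zero>)" for f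
    unfolding I_def by blast
  have "ideal I A"
  proof (rule idealI[OF dual_ring])
    show "subgroup I (add_monoid A)"
    proof (rule A.M.add.subgroupI)
      show "I \<subseteq> carrier A" by (auto simp: I_iff)
      have "\<zero>\<^bsub>A\<^esub> \<in> I" using Kc by (simp add: I_iff)
      then show "I \<noteq> {}" by blast
      show "\<ominus>\<^bsub>A\<^esub> f \<in> I" if "f \<in> I" for f
        using that Kc by (simp add: I_iff Ar.l_minus Ar.r_minus)
      show "f \<oplus>\<^bsub>A\<^esub> g \<in> I" if "f \<in> I" "g \<in> I" for f g
        using that Kc by (simp add: I_iff Ar.l_distr Ar.r_distr)
    qed
    show "x \<otimes>\<^bsub>A\<^esub> f \<in> I" if "f \<in> I" "x \<in> carrier A" for f x
      using that by (simp add: I_iff flip: Ar.m_assoc)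
    show "f \<otimes>\<^bsub>A\<^esub> x \<in> I" if "f \<in> I" "x \<in> carrier A" for f x
    proof -
      have "((a \<otimes>\<^bsub>A\<^esub> (f \<otimes>\<^bsub>A\<^esub> x)) \<otimes>\<^bsub>A\<^esub> b) = ((a \<otimes>\<^bsub>A\<^esub> f) \<otimes>\<^bsub>A\<^esub> (x \<otimes>\<^bsub>A\<^esub> b))"
        if "a \<in> carrier A" "b \<in> carrier A" for a b
        using that \<open>f \<in> I\<close> \<open>x \<in> carrier A\<close> by (simp add: I_iff Ar.m_assoc)
      then show ?thesis using that by (simp add: I_iff)
    qed
  qed
  moreover have "I \<subseteq> ann K"
  proof
    fix f assume f: "f \<in> I"
    then have fc: "f \<in> carrier A" by (simp add: I_iff)
    have "f c = \<zero>" if "c \<in> K" for c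
    proof -
      have "((\<one>\<^bsub>A\<^esub> \<otimes>\<^bsub>A\<^esub> f) \<otimes>\<^bsub>A\<^esub> \<one>\<^bsub>A\<^esub>) c = \<zero>" using f that Ar.one_closed unfolding I_iff by blast
      then show ?thesis using fc by simp
    qed
    then show "f \<in> ann K" using fc by (simp add: annihilator_def)
  qed
  moreover have "finite_over R A I (carrier A)"
  proof -
    have "\<exists>D. finite D \<and> D \<subseteq> carrier C \<times> carrier C \<and> (\<forall>f\<in>carrier A. \<forall>g\<in>carrier A.
      (\<forall>x y. (x, y) \<in> D \<longrightarrow> f x \<otimes> g y = \<zero>) \<longrightarrow> (f \<otimes>\<^bsub>A\<^esub> g) c = \<zero>)" if "c \<in> carrier C" for c
      using convolution_finite_support[OF that] by metis
    then obtain D where D: "\<And>c. c \<in> carrier C \<Longrightarrow> finite (D c)"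
      "\<And>c. c \<in> carrier C \<Longrightarrow> D c \<subseteq> carrier C \<times> carrier C"
      "\<And>c f g. c \<in> carrier C \<Longrightarrow> f \<in> carrier A \<Longrightarrow> g \<in> carrier A \<Longrightarrow>
        \<forall>x y. (x, y) \<in> D c \<longrightarrow> f x \<otimes> g y = \<zero> \<Longrightarrow> (f \<otimes>\<^bsub>A\<^esub> g) c = \<zero>"
      by metis
    let ?X = "\<Union>c\<in>K. fst ` D c"
    let ?Y = "\<Union>x\<in>?X. snd ` D x"
    have Dx: "x \<in> carrier C" "y \<in> carrier C" if "c \<in> carrier C" "(x, y) \<in> D c" for x y c
      using D(2)[OF that(1)] that(2) by auto
    have X: "x \<in> carrier C" if x: "x \<in> ?X" for x
    proof -
      obtain c p where p: "c \<in> K" "p \<in> D c" "x = fst p" using x by blast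
      then show ?thesis using Dx(1)[OF Kc, of c "fst p" "snd p"] by simp
    qed
    have Yc: "?Y \<subseteq> carrier C"
    proof
      fix y assume "y \<in> ?Y"
      then obtain x p where p: "x \<in> ?X" "p \<in> D x" "y = snd p" by blast
      then show "y \<in> carrier C" using Dx(2)[OF X, of x "fst p" "snd p"] by simp
    qed
    have "finite ?X" by (rule finite_UN_I[OF K(1) finite_imageI[OF D(1)[OF Kc]]])
    then have "finite ?Y" by (rule finite_UN_I[OF _ finite_imageI[OF D(1)[OF X]]])
    note Y = this Yc
    have "ann ?Y \<subseteq> I"
    proof
      fix f assume f: "f \<in> ann ?Y"
      note fc = annihilatorD(1)[OF f] and f0 = annihilatorD(2)[OF f]
      have inner: "(a \<otimes>\<^bsub>A\<^esub> f) x = \<zero>" if "a \<in> carrier A" "x \<in> ?X" for a x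
      proof (rule D(3)[OF X[OF that(2)] that(1) fc], intro allI impI)
        note x = X[OF that(2)]
        fix u v assume uv: "(u, v) \<in> D x"
        then have "v \<in> snd ` D x" by (rule image_eqI[rotated]) simp
        then have "v \<in> ?Y" using that(2) by blast
        then have "f v = \<zero>" by (rule f0)
        moreover have "u \<in> carrier C" using Dx(1)[OF x uv] .
        ultimately show "a u \<otimes> f v = \<zero>" using dualD(1)[OF that(1)] by simp
      qed
      have "((a \<otimes>\<^bsub>A\<^esub> f) \<otimes>\<^bsub>A\<^esub> b) c = \<zero>" if "c \<in> K" "a \<in> carrier A" "b \<in> carrier A" for a b c
      proof (rule D(3)[OF Kc[OF that(1)] Ar.m_closed[OF that(2) fc] that(3)], intro allI impI)
        fix x y assume xy: "(x, y) \<in> D c"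
        then have "x \<in> fst ` D c" by (rule image_eqI[rotated]) simp
        then have "x \<in> ?X" using that(1) by blast
        then have "(a \<otimes>\<^bsub>A\<^esub> f) x = \<zero>" by (rule inner[OF that(2)])
        moreover have "y \<in> carrier C" using Dx(2)[OF Kc[OF that(1)] xy] .
        ultimately show "(a \<otimes>\<^bsub>A\<^esub> f) x \<otimes> b y = \<zero>" using dualD(1)[OF that(3)] by simp
      qed
      then show "f \<in> I" using fc by (simp add: I_iff)
    qed
    then show ?thesis by (rule A.finite_over_mono[OF finite_over_annihilator[OF noeth Y]])
  qed
  ultimately show ?thesis unfolding cofinite_ideal_iff by blast
qed

section \<open>The finite and the cofinite topology\<close>

lemma annihilator_span:
  assumes "S \<subseteq> carrier C"
  shows "ann (submodule_span R C S) = ann S"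
proof
  show "ann (submodule_span R C S) \<subseteq> ann S"
    using submodule_span_superset[of S] by (auto simp: annihilator_def)
  show "ann S \<subseteq> ann (submodule_span R C S)"
  proof
    fix f assume f: "f \<in> ann S"
    note fc = annihilatorD(1)[OF f]
    have "submodule {c \<in> carrier C. f c \<in> {\<zero>\<^bsub>B\<^esub>}} R C"
      by (rule submodule_vimage[OF module_axioms B.module_axioms dual_linear[OF fc] B.submodule_zero carrier_is_submodule])
    then have "submodule_span R C S \<subseteq> {c \<in> carrier C. f c \<in> {\<zero>\<^bsub>B\<^esub>}}"
      using assms annihilatorD(2)[OF f] by (intro submodule_span_least) auto
    then show "f \<in> ann (submodule_span R C S)" using fc by (auto simp: annihilator_def)
  qed
qed

text \<open>A form that vanishes on generators of \<open>K\<close> vanishes on \<open>K\<close>.\<close>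

lemma finite_topology_basis:
  "{ann K | K. submodule K R C \<and> fg_module R (C\<lparr>carrier := K\<rparr>)} =
    {ann S | S. finite S \<and> S \<subseteq> carrier C}"
proof (intro subset_antisym subsetI)
  fix N assume "N \<in> {ann K | K. submodule K R C \<and> fg_module R (C\<lparr>carrier := K\<rparr>)}"
  then obtain K where K: "N = ann K" "submodule K R C" "fg_module R (C\<lparr>carrier := K\<rparr>)" by blast
  then obtain S where S: "finite S" "S \<subseteq> K" "K \<subseteq> submodule_span R C S"
    using submodule_fg_iff[OF K(2)] unfolding finite_over_def by auto
  then have "K = submodule_span R C S" using submodule_span_least[OF K(2)] by blast
  moreover have "S \<subseteq> carrier C" using S(2) submoduleE(1)[OF K(2)] by blast
  ultimately show "N \<in> {ann S | S. finite S \<and> S \<subseteq> carrier C}"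
    using K(1) annihilator_span S(1) by blast
next
  fix N assume "N \<in> {ann S | S. finite S \<and> S \<subseteq> carrier C}"
  then obtain S where S: "N = ann S" "finite S" "S \<subseteq> carrier C" by blast
  let ?K = "submodule_span R C S"
  have K: "submodule ?K R C" by (rule submodule_span_submodule[OF S(3)])
  have "finite_over R C {} ?K"
    unfolding finite_over_def using S(2) submodule_span_superset by (intro exI[of _ S]) auto
  then have "fg_module R (C\<lparr>carrier := ?K\<rparr>)" using submodule_fg_iff[OF K] by blast
  then show "N \<in> {ann K | K. submodule K R C \<and> fg_module R (C\<lparr>carrier := K\<rparr>)}"
    using K S annihilator_span by blast
qed

lemma openin_finite_topology:
  "openin (finite_topology R C) U \<longleftrightarrow>
    U \<subseteq> carrier A \<and> (\<forall>a\<in>U. \<exists>S. finite S \<and> S \<subseteq> carrier C \<and> ann S +>\<^bsub>A\<^esub> a \<subseteq> U)"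
proof -
  have "openin (finite_topology R C) U \<longleftrightarrow> U \<subseteq> carrier A \<and>
      (\<forall>a\<in>U. \<exists>N\<in>{ann S | S. finite S \<and> S \<subseteq> carrier C}. N +>\<^bsub>A\<^esub> a \<subseteq> U)"
    unfolding finite_topology_def finite_topology_basis
  proof (rule openin_linear_topology)
    fix N N' assume "N \<in> {ann S | S. finite S \<and> S \<subseteq> carrier C}"
      "N' \<in> {ann S | S. finite S \<and> S \<subseteq> carrier C}"
    then obtain S S' where S: "N = ann S" "finite S" "S \<subseteq> carrier C"
      "N' = ann S'" "finite S'" "S' \<subseteq> carrier C" by blast
    then have "ann (S \<union> S') \<in> {ann S | S. finite S \<and> S \<subseteq> carrier C}" by blast
    moreover have "ann (S \<union> S') \<subseteq> N \<inter> N'" using S by (auto simp: annihilator_def)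
    ultimately show "\<exists>N''\<in>{ann S | S. finite S \<and> S \<subseteq> carrier C}. N'' \<subseteq> N \<inter> N'" by blast
  qed
  then show ?thesis by blast
qed

lemma openin_cofinite_topology:
  assumes "noetherian_ring R"
  shows "openin (cofinite_topology R A) U \<longleftrightarrow>
    U \<subseteq> carrier A \<and> (\<forall>a\<in>U. \<exists>I. cofinite_ideal R A I \<and> I +>\<^bsub>A\<^esub> a \<subseteq> U)"
proof -
  have "openin (cofinite_topology R A) U \<longleftrightarrow>
    U \<subseteq> carrier A \<and> (\<forall>a\<in>U. \<exists>I\<in>{I. cofinite_ideal R A I}. I +>\<^bsub>A\<^esub> a \<subseteq> U)"
    unfolding cofinite_topology_def
    using cofinite_ideal_Int[OF assms] by (intro openin_linear_topology) blast
  then show ?thesis by blast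
qed

lemma coset_mono: "N \<subseteq> N' \<Longrightarrow> N +>\<^bsub>A\<^esub> a \<subseteq> N' +>\<^bsub>A\<^esub> a"
  by (auto simp: a_r_coset_def r_coset_def)

text \<open>Only one of the two inclusions between the topologies is a condition; the other is
\<open>cofinite_ideal_in_annihilator\<close>.\<close>

lemma coreflexive_iff:
  assumes "noetherian_ring R"
  shows "coreflexive R C \<longleftrightarrow>
    (\<forall>I. cofinite_ideal R A I \<longrightarrow> (\<exists>S. finite S \<and> S \<subseteq> carrier C \<and> ann S \<subseteq> I))"
proof
  assume cr: "coreflexive R C"
  show "\<forall>I. cofinite_ideal R A I \<longrightarrow> (\<exists>S. finite S \<and> S \<subseteq> carrier C \<and> ann S \<subseteq> I)"
  proof (intro allI impI)
    fix I assume I: "cofinite_ideal R A I"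
    then have Is: "submodule I R A" using ideal_submodule cofinite_ideal_iff by blast
    note Ic = A.submoduleE(1)[OF Is]
    have "I +>\<^bsub>A\<^esub> a \<subseteq> I" if "a \<in> I" for a
      using abelian_subgroup.a_rcos_const[OF A.abelian_subgroup_of_submodule[OF Is] that] by simp
    then have "openin (cofinite_topology R A) I"
      unfolding openin_cofinite_topology[OF assms] using Ic I by blast
    then have "openin (finite_topology R C) I" using cr by (simp add: coreflexive_def)
    then obtain S where S: "finite S" "S \<subseteq> carrier C" "ann S +>\<^bsub>A\<^esub> \<zero>\<^bsub>A\<^esub> \<subseteq> I"
      unfolding openin_finite_topology using A.submodule_zero_closed[OF Is] by blast
    then show "\<exists>S. finite S \<and> S \<subseteq> carrier C \<and> ann S \<subseteq> I"
      using A.submoduleE(1)[OF annihilator_submodule[OF S(2)]] by (intro exI[of _ S]) simp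
  qed
next
  assume open_I: "\<forall>I. cofinite_ideal R A I \<longrightarrow> (\<exists>S. finite S \<and> S \<subseteq> carrier C \<and> ann S \<subseteq> I)"
  have "openin (finite_topology R C) U \<longleftrightarrow> openin (cofinite_topology R A) U" for U
    unfolding openin_finite_topology openin_cofinite_topology[OF assms]
    using open_I cofinite_ideal_in_annihilator[OF assms] coset_mono by (meson subset_trans)
  then show "coreflexive R C" unfolding coreflexive_def topology_eq by blast
qed

section \<open>Locally finite and rational modules\<close>

lemma scalar_central:
  assumes "r \<in> carrier R" "f \<in> carrier A"
  shows "(r \<odot>\<^bsub>A\<^esub> \<one>\<^bsub>A\<^esub>) \<otimes>\<^bsub>A\<^esub> f = r \<odot>\<^bsub>A\<^esub> f" "f \<otimes>\<^bsub>A\<^esub> (r \<odot>\<^bsub>A\<^esub> \<one>\<^bsub>A\<^esub>) = r \<odot>\<^bsub>A\<^esub> f"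
  using dual_smult_mult(1)[OF assms(1) Ar.one_closed assms(2)]
    dual_smult_mult(2)[OF assms(1) assms(2) Ar.one_closed] assms(2) by simp_all

lemma restrict_scalars_module:
  assumes "left_module A X"
  shows "module R (restrict_scalars A X)" (is "module R ?X")
proof (rule moduleI)
  interpret X: left_module A X by fact
  note one = Ar.one_closed
  show "cring R" by (rule is_cring)
  show "abelian_group ?X"
  proof (rule abelian_groupI)
    show "\<exists>y\<in>carrier ?X. y \<oplus>\<^bsub>?X\<^esub> x = \<zero>\<^bsub>?X\<^esub>"
      if "x \<in> carrier ?X" for x
      using that by (intro bexI[of _ "\<ominus>\<^bsub>X\<^esub> x"]) (simp_all add: X.X.l_neg)
  qed (simp_all add: X.X.a_assoc, simp add: X.X.a_comm)
  show "r \<odot>\<^bsub>?X\<^esub> x \<in> carrier ?X"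
    if "r \<in> carrier R" "x \<in> carrier ?X" for r x
    using that by (simp add: X.smult_closed dual_closed(3) one)
  show "(r \<oplus> s) \<odot>\<^bsub>?X\<^esub> x = r \<odot>\<^bsub>?X\<^esub> x \<oplus>\<^bsub>?X\<^esub> s \<odot>\<^bsub>?X\<^esub> x"
    if "r \<in> carrier R" "s \<in> carrier R" "x \<in> carrier ?X" for r s x
    using that by (simp add: A.smult_l_distr X.smult_l_distr dual_closed(3) one)
  show "r \<odot>\<^bsub>?X\<^esub> (x \<oplus>\<^bsub>?X\<^esub> y) = r \<odot>\<^bsub>?X\<^esub> x \<oplus>\<^bsub>?X\<^esub> r \<odot>\<^bsub>?X\<^esub> y"
    if "r \<in> carrier R" "x \<in> carrier ?X" "y \<in> carrier ?X" for r x y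
    using that by (simp add: X.smult_r_distr dual_closed(3) one)
  show "(r \<otimes> s) \<odot>\<^bsub>?X\<^esub> x = r \<odot>\<^bsub>?X\<^esub> (s \<odot>\<^bsub>?X\<^esub> x)"
    if "r \<in> carrier R" "s \<in> carrier R" "x \<in> carrier ?X" for r s x
    using that by (simp add: A.smult_assoc1 scalar_central(1) dual_closed(3) one flip: X.smult_assoc1)
  show "\<one> \<odot>\<^bsub>?X\<^esub> x = x" if "x \<in> carrier ?X" for x
    using that by (simp add: A.smult_one[OF one] X.smult_one)
qed

lemma orbit_map_linear:
  assumes "left_module A X" "x \<in> carrier X"
  shows "is_linear R A (restrict_scalars A X) (\<lambda>f. f \<odot>\<^bsub>X\<^esub> x)"
proof -
  interpret X: left_module A X by fact
  show ?thesis
    using assms(2)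
    by (intro is_linearI)
      (simp_all add: X.smult_closed X.smult_l_distr dual_closed(3) scalar_central(1) flip: X.smult_assoc1)
qed

text \<open>Linear over \<open>R\<close> because the scalars \<open>r \<odot> 1\<close> are central in \<open>A\<close>.\<close>

lemma homothety_linear:
  assumes "left_module A X" "f \<in> carrier A"
  shows "is_linear R (restrict_scalars A X) (restrict_scalars A X) (\<lambda>x. f \<odot>\<^bsub>X\<^esub> x)"
proof -
  interpret X: left_module A X by fact
  show ?thesis
    using assms(2)
    by (intro is_linearI)
      (simp_all add: X.smult_closed X.smult_r_distr dual_closed(3) scalar_central flip: X.smult_assoc1)
qed

text \<open>For \<open>T = \<Sum>\<^sub>j f\<^sub>j(-) d\<^sub>j\<close> the tensor is \<open>\<Sum>\<^sub>j (f\<^sub>j x) \<otimes> d\<^sub>j\<close>.\<close>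

lemma tensor_of_finite_rank:
  assumes X: "left_module A X" and x: "x \<in> carrier X" and "finite_rank T"
  shows "\<exists>t\<in>carrier (tensor_module R (restrict_scalars A X) C).
    \<forall>f\<in>carrier A. (pullback T f) \<odot>\<^bsub>X\<^esub> x = tensor_to_hom R (restrict_scalars A X) C t f"
  using assms(3)
proof (induction rule: finite_rank.induct)
  let ?X = "restrict_scalars A X"
  interpret X: left_module A X by fact
  have X_mod: "module R ?X" by (rule restrict_scalars_module[OF X])
  interpret XR: module R ?X by (rule X_mod)
  interpret XC: tensor_pair R ?X C
    by (intro tensor_pair.intro tensor_pair_axioms.intro module_axioms X_mod one_neq_zero)
  let ?T = "tensor_module R ?X C"
  interpret XCT: module R ?T by (rule XC.tensor_is_module)
  note orbit = is_linearD[OF orbit_map_linear[OF X x]]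
    is_linear_zero_minus[OF A.module_axioms X_mod orbit_map_linear[OF X x]]
  {
    case finite_rank_zero
    have "(\<lambda>c\<in>carrier C. f \<zero>\<^bsub>C\<^esub>) \<odot>\<^bsub>X\<^esub> x = tensor_to_hom R ?X C \<zero>\<^bsub>?T\<^esub> f" if f: "f \<in> carrier A" for f
    proof -
      have "(\<lambda>c\<in>carrier C. f \<zero>\<^bsub>C\<^esub>) = \<zero>\<^bsub>A\<^esub>"
        using is_linear_zero_minus(1)[OF module_axioms B.module_axioms dual_linear[OF f]] by (simp add: dual_simps)
      then have "(\<lambda>c\<in>carrier C. f \<zero>\<^bsub>C\<^esub>) \<odot>\<^bsub>X\<^esub> x = \<zero>\<^bsub>?X\<^esub>" by (simp only: orbit(4))
      then show ?thesis
        unfolding tensor_to_hom_eq[OF f]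
          is_linear_zero_minus(1)[OF XCT.module_axioms X_mod XC.tensor_lift_linear[OF X_mod action_bilinear[OF X_mod f]]] .
    qed
    then show ?case using XCT.M.zero_closed by blast
  next
    case (finite_rank_step g d T)
    note g = finite_rank_step(1) and d = finite_rank_step(2) and T = finite_rank_step(3)
    obtain t where t: "t \<in> carrier ?T"
      "\<forall>f\<in>carrier A. (pullback T f) \<odot>\<^bsub>X\<^esub> x = tensor_to_hom R ?X C t f"
      using finite_rank_step(4) by blast
    have gx: "g \<odot>\<^bsub>X\<^esub> x \<in> carrier ?X" using orbit(1)[OF g] .
    let ?p = "pure_tensor R ?X C (g \<odot>\<^bsub>X\<^esub> x) d"
    have p: "?p \<in> carrier ?T" by (rule XC.pure_tensor_closed[OF gx d])
    have "(\<lambda>c\<in>carrier C. f (g c \<odot>\<^bsub>C\<^esub> d \<oplus>\<^bsub>C\<^esub> T c)) \<odot>\<^bsub>X\<^esub> x = tensor_to_hom R ?X C (?p \<oplus>\<^bsub>?T\<^esub> t) f"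
      if f: "f \<in> carrier A" for f
    proof -
      note bil = action_bilinear[OF X_mod f]
      have fd: "f d \<in> carrier R" using dualD(1)[OF f d] .
      have "tensor_to_hom R ?X C (?p \<oplus>\<^bsub>?T\<^esub> t) f = tensor_to_hom R ?X C ?p f \<oplus>\<^bsub>?X\<^esub> tensor_to_hom R ?X C t f"
        unfolding tensor_to_hom_eq[OF f]
        by (rule is_linearD(2)[OF XC.tensor_lift_linear[OF X_mod bil] p t(1)])
      also have "tensor_to_hom R ?X C ?p f = f d \<odot>\<^bsub>?X\<^esub> (g \<odot>\<^bsub>X\<^esub> x)"
        unfolding tensor_to_hom_eq[OF f] by (rule XC.tensor_lift_pure[OF X_mod bil gx d])
      also have "tensor_to_hom R ?X C t f = (pullback T f) \<odot>\<^bsub>X\<^esub> x" using t(2) f by simp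
      also have "f d \<odot>\<^bsub>?X\<^esub> (g \<odot>\<^bsub>X\<^esub> x) \<oplus>\<^bsub>?X\<^esub> (pullback T f) \<odot>\<^bsub>X\<^esub> x =
          (f d \<odot>\<^bsub>A\<^esub> g \<oplus>\<^bsub>A\<^esub> (pullback T f)) \<odot>\<^bsub>X\<^esub> x"
        unfolding orbit(2)[OF dual_closed(3)[OF fd g] precompose_in_dual[OF T f]] orbit(3)[OF fd g] ..
      finally show ?thesis unfolding precompose_step[OF f g d T] by simp
    qed
    then show ?case using XCT.M.a_closed[OF p t(1)] by blast
  }
qed

text \<open>The annihilator \<open>J\<close> of the module \<open>Y = A x\<close> is the common kernel of the actions on finitely many
\<open>R\<close>-generators of \<open>Y\<close>, hence a cofinite ideal.  It contains some \<open>ann K\<close>, so \<open>f\<close> and \<open>f \<circ> T\<close> act in the same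
way on \<open>x\<close> when \<open>T\<close> fixes \<open>K\<close>.\<close>

lemma coreflexive_imp_rational:
  assumes noeth: "noetherian_ring R"
    and lp: "locally_projective TYPE(('r, 'c, 'x) module_universe) R C"
    and cr: "coreflexive R C" and X: "left_module A X" and lf: "locally_finite R A X"
  shows "rational_module R C X"
proof -
  let ?X = "restrict_scalars A X"
  interpret X: left_module A X by fact
  have X_mod: "module R ?X" by (rule restrict_scalars_module[OF X])
  interpret XR: module R ?X by (rule X_mod)
  have "\<exists>t\<in>carrier (tensor_module R ?X C). \<forall>g\<in>carrier A. g \<odot>\<^bsub>X\<^esub> x = tensor_to_hom R ?X C t g"
    if x: "x \<in> carrier X" for x
  proof -
    define Y where "Y = (\<lambda>f. f \<odot>\<^bsub>X\<^esub> x) ` carrier A"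
    define J where "J = {f \<in> carrier A. \<forall>y\<in>Y. f \<odot>\<^bsub>X\<^esub> y = \<zero>\<^bsub>X\<^esub>}"
    note orbit = orbit_map_linear[OF X x]
    have Y: "submodule Y R ?X"
      unfolding Y_def by (rule linear_image_submodule[OF A.module_axioms X_mod orbit A.carrier_is_submodule])
    have Yc: "y \<in> carrier X" if "y \<in> Y" for y using XR.submoduleE(1)[OF Y] that by auto
    have AY: "f \<odot>\<^bsub>X\<^esub> y \<in> Y" if "f \<in> carrier A" "y \<in> Y" for f y
    proof -
      obtain g where g: "g \<in> carrier A" "y = g \<odot>\<^bsub>X\<^esub> x" using \<open>y \<in> Y\<close> unfolding Y_def by blast
      have "f \<odot>\<^bsub>X\<^esub> y = (f \<otimes>\<^bsub>A\<^esub> g) \<odot>\<^bsub>X\<^esub> x" using that(1) g x by (simp add: X.smult_assoc1)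
      then show ?thesis unfolding Y_def using Ar.m_closed[OF that(1) g(1)] by blast
    qed
    have xY: "x \<in> Y" unfolding Y_def using X.smult_one[OF x] Ar.one_closed by (metis image_eqI)
    have "{f \<odot>\<^bsub>X\<^esub> x | f. f \<in> carrier A} = Y" unfolding Y_def by blast
    then have "fg_module R (?X\<lparr>carrier := Y\<rparr>)" using lf x unfolding locally_finite_def by auto
    then obtain S where S: "finite S" "S \<subseteq> Y" "Y \<subseteq> submodule_span R ?X S"
      using XR.submodule_fg_iff[OF Y] unfolding finite_over_def by auto
    have zero_linear: "f \<odot>\<^bsub>X\<^esub> \<zero>\<^bsub>X\<^esub> = \<zero>\<^bsub>X\<^esub>" if "f \<in> carrier A" for f
      using is_linear_zero_minus(1)[OF X_mod X_mod homothety_linear[OF X that]] by simp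
    have "ideal J A"
    proof (rule idealI[OF dual_ring])
      show "subgroup J (add_monoid A)"
      proof (rule A.M.add.subgroupI)
        have z: "\<zero>\<^bsub>A\<^esub> \<odot>\<^bsub>X\<^esub> y = \<zero>\<^bsub>X\<^esub>" "f \<in> carrier A \<Longrightarrow> (\<ominus>\<^bsub>A\<^esub> f) \<odot>\<^bsub>X\<^esub> y = \<ominus>\<^bsub>?X\<^esub> (f \<odot>\<^bsub>X\<^esub> y)"
          if "y \<in> Y" for y f
          using is_linear_zero_minus[OF A.module_axioms X_mod orbit_map_linear[OF X Yc[OF that]]] by simp_all
        have z0: "\<ominus>\<^bsub>?X\<^esub> \<zero>\<^bsub>X\<^esub> = \<zero>\<^bsub>X\<^esub>" using XR.M.add.inv_one by (simp add: a_inv_def)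
        show "J \<subseteq> carrier A" unfolding J_def by blast
        show "J \<noteq> {}" unfolding J_def using z(1) A.M.zero_closed by blast
        show "\<ominus>\<^bsub>A\<^esub> f \<in> J" if "f \<in> J" for f
          using that z(2) z0 unfolding J_def by simp
        show "f \<oplus>\<^bsub>A\<^esub> g \<in> J" if "f \<in> J" "g \<in> J" for f g
          using that Yc unfolding J_def by (simp add: X.smult_l_distr)
      qed
      show "g \<otimes>\<^bsub>A\<^esub> f \<in> J" if "f \<in> J" "g \<in> carrier A" for f g
        using that Yc zero_linear unfolding J_def by (simp add: X.smult_assoc1)
      show "f \<otimes>\<^bsub>A\<^esub> g \<in> J" if "f \<in> J" "g \<in> carrier A" for f g
        using that Yc AY unfolding J_def by (simp add: X.smult_assoc1)
    qed
    moreover have "finite_over R A J (carrier A)"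
    proof -
      have "finite_over R A {f \<in> carrier A. \<forall>s\<in>S. f \<odot>\<^bsub>X\<^esub> s = \<zero>\<^bsub>?X\<^esub>} (carrier A)"
      proof (rule finite_over_common_kernel[OF noeth A.module_axioms X_mod A.carrier_is_submodule S(1)])
        fix s assume "s \<in> S"
        then have s: "s \<in> Y" using S(2) by blast
        show "is_linear R A ?X (\<lambda>f. f \<odot>\<^bsub>X\<^esub> s)" by (rule orbit_map_linear[OF X Yc[OF s]])
        have "(\<lambda>f. f \<odot>\<^bsub>X\<^esub> s) ` carrier A \<subseteq> submodule_span R ?X S" using AY[OF _ s] S(3) by blast
        moreover have "S \<subseteq> carrier ?X" using S(2) Yc by auto
        ultimately show "\<exists>S. finite S \<and> S \<subseteq> carrier ?X \<and> (\<lambda>f. f \<odot>\<^bsub>X\<^esub> s) ` carrier A \<subseteq> submodule_span R ?X S"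
          using S(1) by blast
      qed
      moreover have "{f \<in> carrier A. \<forall>s\<in>S. f \<odot>\<^bsub>X\<^esub> s = \<zero>\<^bsub>?X\<^esub>} \<subseteq> J"
      proof clarify
        fix f assume f: "f \<in> carrier A" and fS: "\<forall>s\<in>S. f \<odot>\<^bsub>X\<^esub> s = \<zero>\<^bsub>?X\<^esub>"
        have "submodule_span R ?X S \<subseteq> {y \<in> carrier ?X. f \<odot>\<^bsub>X\<^esub> y \<in> {\<zero>\<^bsub>?X\<^esub>}}"
        proof (rule XR.submodule_span_least)
          show "submodule {y \<in> carrier ?X. f \<odot>\<^bsub>X\<^esub> y \<in> {\<zero>\<^bsub>?X\<^esub>}} R ?X"
            by (rule submodule_vimage[OF X_mod X_mod homothety_linear[OF X f] XR.submodule_zero XR.carrier_is_submodule])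
          show "S \<subseteq> {y \<in> carrier ?X. f \<odot>\<^bsub>X\<^esub> y \<in> {\<zero>\<^bsub>?X\<^esub>}}" using S(2) Yc fS by auto
        qed
        then have "f \<odot>\<^bsub>X\<^esub> y = \<zero>\<^bsub>X\<^esub>" if "y \<in> Y" for y using S(3) that by auto
        then show "f \<in> J" unfolding J_def using f by blast
      qed
      ultimately show ?thesis by (rule A.finite_over_mono)
    qed
    ultimately have "cofinite_ideal R A J" unfolding cofinite_ideal_iff by blast
    then obtain K where K: "finite K" "K \<subseteq> carrier C" "ann K \<subseteq> J"
      using cr coreflexive_iff[OF noeth] by blast
    obtain T where T: "finite_rank T" "\<forall>k\<in>K. T k = k"
      using finite_rank_fixes_finite[OF lp K(1,2)] by blast
    obtain t where t: "t \<in> carrier (tensor_module R ?X C)"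
      "\<forall>f\<in>carrier A. (pullback T f) \<odot>\<^bsub>X\<^esub> x = tensor_to_hom R ?X C t f"
      using tensor_of_finite_rank[OF X x T(1)] by blast
    have "f \<odot>\<^bsub>X\<^esub> x = (pullback T f) \<odot>\<^bsub>X\<^esub> x" if f: "f \<in> carrier A" for f
    proof -
      note P = precompose_in_dual[OF T(1) f]
      have "f \<ominus>\<^bsub>A\<^esub> (pullback T f) \<in> J"
        using minus_precompose_in_annihilator[OF T K(2) f] K(3) by blast
      then have "(f \<ominus>\<^bsub>A\<^esub> (pullback T f)) \<odot>\<^bsub>X\<^esub> x = \<zero>\<^bsub>?X\<^esub>"
        unfolding J_def using xY by simp
      then have "f \<odot>\<^bsub>X\<^esub> x \<ominus>\<^bsub>?X\<^esub> (pullback T f) \<odot>\<^bsub>X\<^esub> x = \<zero>\<^bsub>?X\<^esub>"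
        using is_linear_zero_minus(3)[OF A.module_axioms X_mod orbit f P] by simp
      then show ?thesis
        using is_linearD(1)[OF orbit f] is_linearD(1)[OF orbit P] XR.minus_eq_zero_iff by blast
    qed
    then show ?thesis using t by auto
  qed
  then show ?thesis unfolding rational_module_def Let_def by blast
qed

text \<open>The test module is \<open>A/I\<close>.  If \<open>\<Sum> x\<^sub>i \<otimes> c\<^sub>i\<close> witnesses rationality of \<open>1 + I\<close>, then
\<open>g + I = \<Sum> g(c\<^sub>i) x\<^sub>i\<close>, so a form that vanishes at all \<open>c\<^sub>i\<close> lies in \<open>I\<close>.\<close>

lemma locally_finite_rational_imp_coreflexive:
  assumes noeth: "noetherian_ring R"
    and rat: "locally_finite_imp_rational TYPE(('r, 'c, 'x) module_universe) R C"
  shows "coreflexive R C"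
  unfolding coreflexive_iff[OF noeth]
proof (intro allI impI)
  fix I assume I: "cofinite_ideal R A I"
  then have id: "ideal I A" and fin: "finite_over R A I (carrier A)" using cofinite_ideal_iff by auto
  note Is = ideal_submodule[OF id]
  note Ic = A.submoduleE(1)[OF Is]
  let ?M = "Defs.base_module A"
  define q :: "('c \<Rightarrow> 'r) \<Rightarrow> ('r, 'c, 'x) module_universe" where "q f = Inr (Inl (I +>\<^bsub>A\<^esub> f))" for f
  define X where "X = image_module ?M q"
  have q_eq: "q f = q g \<longleftrightarrow> f \<ominus>\<^bsub>?M\<^esub> g \<in> I" if "f \<in> carrier ?M" "g \<in> carrier ?M" for f g
    using that A.coset_eq_iff[OF Is, of f g] by (simp add: q_def)
  have I_add: "f \<oplus>\<^bsub>?M\<^esub> g \<in> I" if "f \<in> I" "g \<in> I" for f g using A.submoduleE(5)[OF Is that] by simp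
  have I_mult: "a \<odot>\<^bsub>?M\<^esub> f \<in> I" if "a \<in> carrier A" "f \<in> I" for a f
    using ideal.I_l_closed[OF id that(2,1)] by simp
  note X = image_module[OF Ar.base_left_module q_eq I_add I_mult, folded X_def]
  note X_left = X(1)
  let ?X = "restrict_scalars A X"
  interpret X: left_module A X by (rule X_left)
  have X_mod: "module R ?X" by (rule restrict_scalars_module[OF X_left])
  interpret XR: module R ?X by (rule X_mod)
  have q_lin: "is_linear R A ?X q"
  proof (rule is_linearI)
    show "q (r \<odot>\<^bsub>A\<^esub> f) = r \<odot>\<^bsub>?X\<^esub> q f" if "r \<in> carrier R" "f \<in> carrier A" for r f
      using X(3)[of "r \<odot>\<^bsub>A\<^esub> \<one>\<^bsub>A\<^esub>" f] that dual_closed(3)[OF that(1) Ar.one_closed] by (simp add: scalar_central(1))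
  qed (use X(2,4) in auto)
  have q0: "q f = \<zero>\<^bsub>X\<^esub> \<longleftrightarrow> f \<in> I" if "f \<in> carrier A" for f
  proof -
    have z: "\<zero>\<^bsub>X\<^esub> = q \<zero>\<^bsub>A\<^esub>" using X(5) by simp
    show ?thesis unfolding z using q_eq[of f "\<zero>\<^bsub>A\<^esub>"] that by (simp add: a_minus_def)
  qed
  have lf: "locally_finite R A X"
    unfolding locally_finite_def
  proof
    fix x assume x: "x \<in> carrier X"
    note orbit = orbit_map_linear[OF X_left x]
    let ?Y = "(\<lambda>f. f \<odot>\<^bsub>X\<^esub> x) ` carrier A"
    have Y: "submodule ?Y R ?X"
      by (rule linear_image_submodule[OF A.module_axioms X_mod orbit A.carrier_is_submodule])
    obtain S where S: "finite S" "S \<subseteq> carrier A" "carrier A \<subseteq> submodule_span R A (S \<union> I)"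
      using fin unfolding finite_over_def by blast
    \<comment> \<open>\<open>S \<union> I\<close> may be infinite, but its image is finite because \<open>I\<close> goes to zero.\<close>
    have "q ` I \<subseteq> {\<zero>\<^bsub>X\<^esub>}" using q0 Ic by blast
    then have gen: "finite (q ` (S \<union> I))" using S(1) finite_subset[of "q ` I"] by (simp add: image_Un)
    have genc: "q ` (S \<union> I) \<subseteq> carrier ?X" using is_linearD(1)[OF q_lin] S(2) Ic by blast
    have "carrier ?X \<subseteq> submodule_span R ?X (q ` (S \<union> I))"
    proof -
      have "S \<union> I \<subseteq> carrier A" using S(2) Ic by simp
      then have "q ` carrier A \<subseteq> submodule_span R ?X (q ` (S \<union> I))"
        using image_mono[OF S(3), of q] linear_image_span[OF A.module_axioms X_mod q_lin] by simp
      then show ?thesis using X(4) by simp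
    qed
    then have "?Y \<subseteq> submodule_span R ?X (q ` (S \<union> I))" using XR.submoduleE(1)[OF Y] by blast
    then have "finite_over R ?X {} ?Y"
      using XR.submodule_finitely_generated[OF noeth gen genc Y] by (simp add: finite_over_def)
    then have "fg_module R (?X\<lparr>carrier := ?Y\<rparr>)" using XR.submodule_fg_iff[OF Y] by blast
    moreover have "?Y = {a \<odot>\<^bsub>X\<^esub> x | a. a \<in> carrier A}" by blast
    ultimately show "fg_module R (?X\<lparr>carrier := {a \<odot>\<^bsub>X\<^esub> x | a. a \<in> carrier A}\<rparr>)" by simp
  qed
  have "rational_module R C X"
    using rat X_left lf unfolding locally_finite_imp_rational_def by blast
  moreover have q1: "q \<one>\<^bsub>A\<^esub> \<in> carrier X" using is_linearD(1)[OF q_lin Ar.one_closed] by simp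
  ultimately obtain t where t: "t \<in> carrier (tensor_module R ?X C)"
    "\<forall>g\<in>carrier A. g \<odot>\<^bsub>X\<^esub> q \<one>\<^bsub>A\<^esub> = tensor_to_hom R ?X C t g"
    unfolding rational_module_def Let_def by blast
  interpret XC: tensor_pair R ?X C
    by (intro tensor_pair.intro tensor_pair_axioms.intro module_axioms X_mod one_neq_zero)
  obtain D where D: "finite D" "D \<subseteq> carrier ?X \<times> carrier C"
    "\<And>P b. module R P \<Longrightarrow> is_bilinear R ?X C P b \<Longrightarrow> (\<And>x y. (x, y) \<in> D \<Longrightarrow> b x y = \<zero>\<^bsub>P\<^esub>) \<Longrightarrow>
       tensor_lift R P b t = zero (P :: ('r, ('r, 'c, 'x) module_universe) module)"
    using XC.tensor_finite_support[OF t(1)] by blast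
  show "\<exists>S. finite S \<and> S \<subseteq> carrier C \<and> ann S \<subseteq> I"
  proof (intro exI conjI subsetI)
    show "finite (snd ` D)" using D(1) by simp
    show "c \<in> carrier C" if "c \<in> snd ` D" for c using that D(2) by auto
    fix g assume g: "g \<in> ann (snd ` D)"
    note gc = annihilatorD(1)[OF g]
    have "tensor_lift R ?X (\<lambda>x c. g c \<odot>\<^bsub>?X\<^esub> x) t = \<zero>\<^bsub>?X\<^esub>"
    proof (rule D(3)[OF X_mod action_bilinear[OF X_mod gc]])
      fix x c assume xc: "(x, c) \<in> D"
      then have "c \<in> snd ` D" by (rule image_eqI[rotated]) simp
      then have "g c = \<zero>" by (rule annihilatorD(2)[OF g])
      moreover have "x \<in> carrier ?X" using xc D(2) by auto
      ultimately show "g c \<odot>\<^bsub>?X\<^esub> x = \<zero>\<^bsub>?X\<^esub>" using XR.smult_l_null by simp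
    qed
    then have "g \<odot>\<^bsub>X\<^esub> q \<one>\<^bsub>A\<^esub> = \<zero>\<^bsub>X\<^esub>" using t(2) gc by (simp add: tensor_to_hom_eq)
    moreover have "g \<odot>\<^bsub>X\<^esub> q \<one>\<^bsub>A\<^esub> = q g" using X(3)[of g "\<one>\<^bsub>A\<^esub>"] gc by simp
    ultimately show "g \<in> I" using q0[OF gc] by simp
  qed
qed

section \<open>The finite dual\<close>

lemma finite_dual_carrier:
  "\<phi> \<in> carrier (finite_dual R A) \<longleftrightarrow> is_linear R A B \<phi> \<and> \<phi> \<in> extensional (carrier A) \<and>
    (\<exists>I. cofinite_ideal R A I \<and> (\<forall>a\<in>I. \<phi> a = \<zero>))"
  by (simp add: finite_dual_def dual_module_def hom_module_def linear_maps_iff)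

lemma finite_dual_ops:
  "add (finite_dual R A) = (\<lambda>\<phi> \<psi>. \<lambda>f\<in>carrier A. \<phi> f \<oplus> \<psi> f)"
  "smult (finite_dual R A) = (\<lambda>r \<phi>. \<lambda>f\<in>carrier A. r \<otimes> \<phi> f)"
  by (simp_all add: finite_dual_def dual_module_def hom_module_def)

lemma bidual_map_apply [simp]:
  "c \<in> carrier C \<Longrightarrow> bidual_map R C c = (\<lambda>f\<in>carrier A. f c)"
  by (simp add: bidual_map_def)

text \<open>Evaluations lie in the finite dual by \<open>cofinite_ideal_in_annihilator\<close>, and the canonical map is injective
by \<open>dual_separates_points\<close>; only surjectivity is a condition.\<close>

lemma bidual_map_iso_iff:
  assumes noeth: "noetherian_ring R"
    and lp: "locally_projective TYPE(('r, 'c, 'x) module_universe) R C"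
  shows "bidual_map R C \<in> linear_isos R C (finite_dual R A) \<longleftrightarrow>
    (\<forall>\<phi> I. is_linear R A B \<phi> \<longrightarrow> cofinite_ideal R A I \<longrightarrow> (\<forall>f\<in>I. \<phi> f = \<zero>) \<longrightarrow>
      (\<exists>c\<in>carrier C. \<forall>f\<in>carrier A. \<phi> f = f c))" (is "_ \<longleftrightarrow> ?represented")
proof -
  have closed: "(\<lambda>f\<in>carrier A. f c) \<in> carrier (finite_dual R A)" if c: "c \<in> carrier C" for c
  proof -
    obtain I where I: "cofinite_ideal R A I" "I \<subseteq> ann {c}"
      using cofinite_ideal_in_annihilator[OF noeth, of "{c}"] c by auto
    have "is_linear R A B (\<lambda>f\<in>carrier A. f c)"
      by (rule is_linear_cong[OF evaluation_linear[OF c] A.module_axioms]) simp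
    moreover have "\<forall>f\<in>I. (\<lambda>f\<in>carrier A. f c) f = \<zero>"
      using I(2) annihilatorD[of _ "{c}"] by auto
    ultimately show ?thesis
      unfolding finite_dual_carrier using I(1) by (intro conjI exI[of _ I]) simp_all
  qed
  have linear: "bidual_map R C \<in> linear_maps R C (finite_dual R A)"
    unfolding linear_maps_iff
  proof (intro conjI is_linearI)
    show "bidual_map R C c \<in> carrier (finite_dual R A)" if "c \<in> carrier C" for c
      using that closed by simp
    show "bidual_map R C (c \<oplus>\<^bsub>C\<^esub> d) = bidual_map R C c \<oplus>\<^bsub>finite_dual R A\<^esub> bidual_map R C d"
      if "c \<in> carrier C" "d \<in> carrier C" for c d
    proof -
      have "(\<lambda>f\<in>carrier A. f (c \<oplus>\<^bsub>C\<^esub> d)) = (\<lambda>f\<in>carrier A. f c \<oplus> f d)"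
        by (rule restrict_ext) (rule dualD(2)[OF _ that])
      moreover have "\<dots> = (\<lambda>f\<in>carrier A. bidual_map R C c f \<oplus> bidual_map R C d f)"
        by (rule restrict_ext) (simp add: that)
      ultimately show ?thesis using that by (simp add: finite_dual_ops)
    qed
    show "bidual_map R C (r \<odot>\<^bsub>C\<^esub> c) = r \<odot>\<^bsub>finite_dual R A\<^esub> bidual_map R C c"
      if "r \<in> carrier R" "c \<in> carrier C" for r c
    proof -
      have "(\<lambda>f\<in>carrier A. f (r \<odot>\<^bsub>C\<^esub> c)) = (\<lambda>f\<in>carrier A. r \<otimes> f c)"
        by (rule restrict_ext) (rule dualD(3)[OF _ that])
      moreover have "\<dots> = (\<lambda>f\<in>carrier A. r \<otimes> bidual_map R C c f)"
        by (rule restrict_ext) (simp add: that)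
      ultimately show ?thesis using that by (simp add: finite_dual_ops)
    qed
    show "bidual_map R C \<in> extensional (carrier C)" by (simp add: bidual_map_def)
  qed
  have inj: "inj_on (bidual_map R C) (carrier C)"
  proof (rule inj_onI)
    fix c d assume c: "c \<in> carrier C" and d: "d \<in> carrier C" and eq: "bidual_map R C c = bidual_map R C d"
    have fcd: "f c = f d" if "f \<in> carrier A" for f
      using fun_cong[OF eq, of f] c d that by simp
    have "f (c \<ominus>\<^bsub>C\<^esub> d) = \<zero>" if f: "f \<in> carrier A" for f
      using is_linear_zero_minus(3)[OF module_axioms B.module_axioms dual_linear[OF f] c d]
        fcd[OF f] dualD(1)[OF f d] by (simp add: a_minus_def R.r_neg)
    then have "c \<ominus>\<^bsub>C\<^esub> d = \<zero>\<^bsub>C\<^esub>" using dual_separates_points[OF lp M.minus_closed[OF c d]] by blast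
    then show "c = d" using minus_eq_zero_iff[OF c d] by blast
  qed
  have surj: "carrier (finite_dual R A) \<subseteq> bidual_map R C ` carrier C \<longleftrightarrow> ?represented"
  proof
    assume sub: "carrier (finite_dual R A) \<subseteq> bidual_map R C ` carrier C"
    show ?represented
    proof (intro allI impI)
      fix \<phi> I assume \<phi>: "is_linear R A B \<phi>" and I: "cofinite_ideal R A I" and van: "\<forall>f\<in>I. \<phi> f = \<zero>"
      have Ic: "I \<subseteq> carrier A"
        using I A.submoduleE(1)[OF ideal_submodule] unfolding cofinite_ideal_iff by blast
      have "is_linear R A B (\<lambda>f\<in>carrier A. \<phi> f)"
        by (rule is_linear_cong[OF \<phi> A.module_axioms]) simp
      then have "(\<lambda>f\<in>carrier A. \<phi> f) \<in> carrier (finite_dual R A)"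
        unfolding finite_dual_carrier using I van Ic by auto
      then obtain c where c: "c \<in> carrier C" "(\<lambda>f\<in>carrier A. \<phi> f) = (\<lambda>f\<in>carrier A. f c)"
        using sub by auto
      have "\<phi> f = f c" if "f \<in> carrier A" for f using fun_cong[OF c(2), of f] that by simp
      then show "\<exists>c\<in>carrier C. \<forall>f\<in>carrier A. \<phi> f = f c" using c(1) by blast
    qed
  next
    assume rep: ?represented
    show "carrier (finite_dual R A) \<subseteq> bidual_map R C ` carrier C"
    proof
      fix \<phi> assume "\<phi> \<in> carrier (finite_dual R A)"
      then obtain I where \<phi>: "is_linear R A B \<phi>" "\<phi> \<in> extensional (carrier A)" "cofinite_ideal R A I" "\<forall>f\<in>I. \<phi> f = \<zero>"
        unfolding finite_dual_carrier by blast
      then obtain c where c: "c \<in> carrier C" "\<forall>f\<in>carrier A. \<phi> f = f c" using rep by blast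
      have "\<phi> = bidual_map R C c"
        using \<phi>(2) c by (auto intro!: extensionalityI[of _ "carrier A"])
      then show "\<phi> \<in> bidual_map R C ` carrier C" using c(1) by blast
    qed
  qed
  have "bidual_map R C ` carrier C \<subseteq> carrier (finite_dual R A)" using closed by auto
  then show ?thesis
    unfolding linear_isos_def bij_betw_def using linear inj surj by blast
qed

lemma coreflexive_imp_bidual_iso:
  assumes noeth: "noetherian_ring R"
    and lp: "locally_projective TYPE(('r, 'c, 'x) module_universe) R C"
    and cr: "coreflexive R C"
  shows "bidual_map R C \<in> linear_isos R C (finite_dual R A)"
  unfolding bidual_map_iso_iff[OF noeth lp]
proof (intro allI impI)
  fix \<phi> I assume \<phi>: "is_linear R A B \<phi>" and I: "cofinite_ideal R A I" and van: "\<forall>f\<in>I. \<phi> f = \<zero>"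
  obtain S where S: "finite S" "S \<subseteq> carrier C" "ann S \<subseteq> I"
    using cr coreflexive_iff[OF noeth] I by blast
  show "\<exists>c\<in>carrier C. \<forall>f\<in>carrier A. \<phi> f = f c"
    using S(3) van by (intro functional_vanishing_on_annihilator[OF lp S(1,2) \<phi>]) blast
qed

section \<open>Closed cofinite ideals\<close>

lemma topspace_finite_topology: "topspace (finite_topology R C) = carrier A"
proof
  show "topspace (finite_topology R C) \<subseteq> carrier A"
    using openin_topspace[of "finite_topology R C"] unfolding openin_finite_topology by blast
  have "ann {} +>\<^bsub>A\<^esub> a \<subseteq> carrier A" if "a \<in> carrier A" for a
    using that A.M.a_r_coset_subset_G[OF A.submoduleE(1)[OF annihilator_submodule]] by blast
  then have "openin (finite_topology R C) (carrier A)"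
    unfolding openin_finite_topology by blast
  then show "carrier A \<subseteq> topspace (finite_topology R C)" by (rule openin_subset)
qed

lemma closedin_finite_topology:
  assumes "submodule I R A"
  shows "closedin (finite_topology R C) I \<longleftrightarrow>
    (\<forall>a\<in>carrier A - I. \<exists>S. finite S \<and> S \<subseteq> carrier C \<and> (ann S +>\<^bsub>A\<^esub> a) \<inter> I = {})"
proof -
  have "ann S +>\<^bsub>A\<^esub> a \<subseteq> carrier A" if "a \<in> carrier A" "S \<subseteq> carrier C" for a S
    using that A.M.a_r_coset_subset_G[OF A.submoduleE(1)[OF annihilator_submodule]] by blast
  then have *: "ann S +>\<^bsub>A\<^esub> a \<subseteq> carrier A - I \<longleftrightarrow> (ann S +>\<^bsub>A\<^esub> a) \<inter> I = {}"
    if "a \<in> carrier A - I" "S \<subseteq> carrier C" for a S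
    using that by blast
  show ?thesis
    unfolding closedin_def topspace_finite_topology openin_finite_topology
    using A.submoduleE(1)[OF assms] * by (simp cong: conj_cong)
qed

text \<open>Translates between closures and sums: \<open>a\<close> lies in the closure of \<open>I\<close> if and only if it lies in \<open>I + ann K\<close>
for every finite \<open>K\<close>.\<close>

lemma coset_meets_iff:
  assumes N: "submodule N R A" and I: "submodule I R A" and a: "a \<in> carrier A"
  shows "(N +>\<^bsub>A\<^esub> a) \<inter> I \<noteq> {} \<longleftrightarrow> a \<in> I <+>\<^bsub>A\<^esub> N"
proof
  assume "(N +>\<^bsub>A\<^esub> a) \<inter> I \<noteq> {}"
  then obtain n where n: "n \<in> N" "n \<oplus>\<^bsub>A\<^esub> a \<in> I" unfolding a_r_coset_def' by auto
  have nc: "n \<in> carrier A" using n(1) A.submoduleE(1)[OF N] by blast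
  have "a = (n \<oplus>\<^bsub>A\<^esub> a) \<oplus>\<^bsub>A\<^esub> (\<ominus>\<^bsub>A\<^esub> n)" using nc a by (simp add: A.M.a_ac A.M.r_neg A.M.r_neg2 A.M.r_neg1)
  then show "a \<in> I <+>\<^bsub>A\<^esub> N" using n A.submoduleE(3)[OF N n(1)] unfolding set_add_def' by blast
next
  assume "a \<in> I <+>\<^bsub>A\<^esub> N"
  then obtain i n where i: "i \<in> I" "n \<in> N" "a = i \<oplus>\<^bsub>A\<^esub> n" unfolding set_add_def' by blast
  have c: "i \<in> carrier A" "n \<in> carrier A" using i A.submoduleE(1)[OF N] A.submoduleE(1)[OF I] by auto
  then have "(\<ominus>\<^bsub>A\<^esub> n) \<oplus>\<^bsub>A\<^esub> a = i" unfolding i(3) by (simp add: A.M.a_ac A.M.r_neg A.M.r_neg2 A.M.r_neg1)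
  then have "i \<in> N +>\<^bsub>A\<^esub> a" using A.submoduleE(3)[OF N i(2)] unfolding a_r_coset_def' by blast
  then show "(N +>\<^bsub>A\<^esub> a) \<inter> I \<noteq> {}" using i(1) by blast
qed

text \<open>An ideal that contains some \<open>ann K\<close> is an open subgroup, hence closed.  Conversely, let \<open>I + ann S\<close> be minimal
among all \<open>I + ann S'\<close>.  Enlarging \<open>S\<close> does not change it, so it is contained in every \<open>I + ann S'\<close> and
therefore in the closure of \<open>I\<close>.\<close>

lemma coreflexive_iff_cofinite_closed:
  assumes noeth: "noetherian_ring R" and art: "artinian_ring R"
  shows "coreflexive R C \<longleftrightarrow> (\<forall>I. cofinite_ideal R A I \<longrightarrow> closedin (finite_topology R C) I)"
proof
  assume cr: "coreflexive R C"
  show "\<forall>I. cofinite_ideal R A I \<longrightarrow> closedin (finite_topology R C) I"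
  proof (intro allI impI)
    fix I assume I: "cofinite_ideal R A I"
    then have Is: "submodule I R A" using ideal_submodule cofinite_ideal_iff by blast
    obtain S where S: "finite S" "S \<subseteq> carrier C" "ann S \<subseteq> I"
      using cr coreflexive_iff[OF noeth] I by blast
    have "I <+>\<^bsub>A\<^esub> ann S \<subseteq> I"
      using S(3) A.submoduleE(5)[OF Is] unfolding set_add_def' by blast
    then have "(ann S +>\<^bsub>A\<^esub> a) \<inter> I = {}" if "a \<in> carrier A - I" for a
      using coset_meets_iff[OF annihilator_submodule[OF S(2)] Is, of a] that by blast
    then show "closedin (finite_topology R C) I"
      unfolding closedin_finite_topology[OF Is] using S(1,2) by blast
  qed
next
  assume cl: "\<forall>I. cofinite_ideal R A I \<longrightarrow> closedin (finite_topology R C) I"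
  show "coreflexive R C"
    unfolding coreflexive_iff[OF noeth]
  proof (intro allI impI)
    fix I assume I: "cofinite_ideal R A I"
    then have Is: "submodule I R A" and fin: "finite_over R A I (carrier A)"
      using ideal_submodule cofinite_ideal_iff by auto
    obtain T where T: "finite T" "T \<subseteq> carrier A" "carrier A \<subseteq> submodule_span R A (T \<union> I)"
      using fin unfolding finite_over_def by blast
    let ?N = "\<lambda>S. I <+>\<^bsub>A\<^esub> ann S"
    let ?F = "?N ` {S. finite S \<and> S \<subseteq> carrier C}"
    have "\<exists>P\<in>?F. \<forall>P'\<in>?F. P' \<subseteq> P \<longrightarrow> P' = P"
    proof (rule A.artinian_minimal_submodule[OF art Is T(1,2)])
      show "?F \<noteq> {}" by blast
      show "submodule P R A \<and> I \<subseteq> P \<and> P \<subseteq> submodule_span R A (T \<union> I)" if P: "P \<in> ?F" for P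
      proof -
        obtain S where S: "S \<subseteq> carrier C" "P = ?N S" using P by blast
        have "submodule P R A" unfolding S(2) by (rule A.submodule_sum[OF Is annihilator_submodule[OF S(1)]])
        moreover have "I \<subseteq> P" unfolding S(2) by (rule A.submodule_sum_upper[OF Is annihilator_submodule[OF S(1)]])
        ultimately show ?thesis using T(3) A.submoduleE(1) by blast
      qed
    qed
    then obtain P where P: "P \<in> ?F" and P_min: "\<forall>P'\<in>?F. P' \<subseteq> P \<longrightarrow> P' = P"
      by (rule bexE)
    from P obtain S where "S \<in> {S. finite S \<and> S \<subseteq> carrier C}" and PS: "P = ?N S" by (rule imageE)
    then have S: "finite S" "S \<subseteq> carrier C" by simp_all
    have min: "?N S' = ?N S" if "finite S'" "S' \<subseteq> carrier C" "?N S' \<subseteq> ?N S" for S'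
    proof -
      have "?N S' \<in> ?F" by (rule imageI) (simp add: that(1,2))
      from bspec[OF P_min this] show ?thesis unfolding PS using that(3) by (rule mp)
    qed
    note Ns = A.submodule_sum[OF Is annihilator_submodule[OF S(2)]]
    have "?N S \<subseteq> I"
    proof
      fix a assume a: "a \<in> ?N S"
      then have ac: "a \<in> carrier A" using A.submoduleE(1)[OF Ns] by blast
      show "a \<in> I"
      proof (rule ccontr)
        assume "a \<notin> I"
        then obtain S' where S': "finite S'" "S' \<subseteq> carrier C" "(ann S' +>\<^bsub>A\<^esub> a) \<inter> I = {}"
          using cl I ac closedin_finite_topology[OF Is] by blast
        have mono: "ann (S \<union> S') \<subseteq> ann S" "ann (S \<union> S') \<subseteq> ann S'"
          by (auto simp: annihilator_def)
        have "?N (S \<union> S') \<subseteq> ?N S" using mono(1) unfolding set_add_def' by blast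
        then have "?N (S \<union> S') = ?N S" using S S' by (intro min) simp_all
        then have "a \<in> ?N (S \<union> S')" using a by simp
        then have "a \<in> ?N S'" using mono(2) unfolding set_add_def' by blast
        then show False
          using S'(3) coset_meets_iff[OF annihilator_submodule[OF S'(2)] Is ac] by blast
      qed
    qed
    moreover have "ann S \<subseteq> ?N S" by (rule A.submodule_sum_upper[OF Is annihilator_submodule[OF S(2)]])
    ultimately show "\<exists>S. finite S \<and> S \<subseteq> carrier C \<and> ann S \<subseteq> I" using S by blast
  qed
qed

section \<open>Cogenerated quotients\<close>

text \<open>The form is a coordinate of the embedding of \<open>A/I\<close> into a product of copies of \<open>R\<close>.\<close>

lemma cogenerated_separates:
  assumes I: "ideal I A" and cog: "cogenerated_by_base R (quotient_module A I)"
    and f: "f \<in> carrier A" "f \<notin> I"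
  obtains \<phi> where "is_linear R A B \<phi>" "\<And>g. g \<in> I \<Longrightarrow> \<phi> g = \<zero>" "\<phi> f \<noteq> \<zero>"
proof -
  note Is = ideal_submodule[OF I]
  let ?Q = "quotient_module A I" and ?q = "\<lambda>g. I +>\<^bsub>A\<^esub> g"
  interpret Q: module R ?Q by (rule A.quotient_module_is_module[OF Is])
  note q = A.quotient_projection_linear[OF Is]
  obtain \<Lambda> :: "(('c \<Rightarrow> 'r) set \<Rightarrow> 'r) set" and h where
    h: "h \<in> linear_maps R ?Q (power_module R \<Lambda>)" "inj_on h (carrier ?Q)"
    using cog unfolding cogenerated_by_base_def by blast
  note h_lin = h(1)[unfolded linear_maps_iff, THEN conjunct1]
  have comp: "is_linear R A B (\<lambda>g. h (?q g) i)" if i: "i \<in> \<Lambda>" for i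
  proof (rule is_linear_compose[OF is_linear_compose[OF q h_lin]])
    show "is_linear R (power_module R \<Lambda>) B (\<lambda>v. v i)"
      using i by (intro is_linearI) (auto simp: power_module_def)
  qed
  have qI: "?q g = ?q \<zero>\<^bsub>A\<^esub>" if "g \<in> I" for g
    using that A.submoduleE(1)[OF Is] A.coset_eq_iff[OF Is, of g "\<zero>\<^bsub>A\<^esub>"] by (auto simp: a_minus_def)
  have "?q f \<noteq> ?q \<zero>\<^bsub>A\<^esub>"
    using A.coset_eq_iff[OF Is f(1), of "\<zero>\<^bsub>A\<^esub>"] f by (simp add: a_minus_def)
  moreover have qc: "?q f \<in> carrier ?Q" "?q \<zero>\<^bsub>A\<^esub> \<in> carrier ?Q"
    using is_linearD(1)[OF q f(1)] is_linearD(1)[OF q A.M.zero_closed] by auto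
  ultimately have "h (?q f) \<noteq> h (?q \<zero>\<^bsub>A\<^esub>)" using h(2) by (meson inj_onD)
  moreover have "h (?q f) \<in> extensional \<Lambda>" "h (?q \<zero>\<^bsub>A\<^esub>) \<in> extensional \<Lambda>"
    using is_linearD(1)[OF h_lin qc(1)] is_linearD(1)[OF h_lin qc(2)] by (simp_all add: power_module_def PiE_def)
  ultimately obtain i where i: "i \<in> \<Lambda>" "h (?q f) i \<noteq> h (?q \<zero>\<^bsub>A\<^esub>) i"
    by (meson extensionalityI)
  note zero = is_linear_zero_minus(1)[OF A.module_axioms B.module_axioms comp[OF i(1)]]
  show ?thesis
  proof (rule that[OF comp[OF i(1)]])
    show "h (?q g) i = \<zero>" if "g \<in> I" for g using qI[OF that] zero by simp
    show "h (?q f) i \<noteq> \<zero>" using i(2) zero by simp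
  qed
qed

text \<open>Let \<open>D\<close> be the set of common zeros of \<open>I\<close>.  A form on \<open>A\<close> that vanishes on \<open>I\<close> is an evaluation at an element of
\<open>D\<close>, and these forms separate the elements of \<open>A\<close> from \<open>I\<close>; hence \<open>ann D \<subseteq> I\<close>.  Moreover \<open>D\<close> is finitely
generated, since an element of \<open>D\<close> is determined by its values under finitely many forms that generate \<open>A\<close>
modulo \<open>I\<close>.\<close>

lemma bidual_iso_imp_coreflexive:
  assumes noeth: "noetherian_ring R"
    and lp: "locally_projective TYPE(('r, 'c, 'x) module_universe) R C"
    and cog: "cofinitely_cogenerated R A"
    and iso: "bidual_map R C \<in> linear_isos R C (finite_dual R A)"
  shows "coreflexive R C"
  unfolding coreflexive_iff[OF noeth]
proof (intro allI impI)
  fix I assume I: "cofinite_ideal R A I"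
  then have id: "ideal I A" and fin: "finite_over R A I (carrier A)"
    using cofinite_ideal_iff by auto
  note Is = ideal_submodule[OF id]
  note Ic = A.submoduleE(1)[OF Is]
  have "submodule {c \<in> carrier C. f c \<in> {\<zero>\<^bsub>B\<^esub>}} R C" if "f \<in> carrier A" for f
    by (rule submodule_vimage[OF module_axioms B.module_axioms dual_linear[OF that] B.submodule_zero carrier_is_submodule])
  then have ker: "submodule {c \<in> carrier C. f c = \<zero>} R C" if "f \<in> carrier A" for f
    using that by simp
  define D where "D = {c \<in> carrier C. \<forall>f\<in>I. f c = \<zero>}"
  have "D = \<Inter>(insert (carrier C) ((\<lambda>f. {c \<in> carrier C. f c = \<zero>}) ` I))"
    unfolding D_def by auto
  moreover have "submodule \<dots> R C"
    using ker Ic carrier_is_submodule by (intro submodule_Inter) blast+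
  ultimately have D: "submodule D R C" by simp
  obtain S where S: "finite S" "S \<subseteq> carrier A" "carrier A \<subseteq> submodule_span R A (S \<union> I)"
    using fin unfolding finite_over_def by blast
  have "finite_over R C {c \<in> D. \<forall>s\<in>S. s c = \<zero>\<^bsub>B\<^esub>} D"
  proof (rule finite_over_common_kernel[OF noeth module_axioms B.module_axioms D S(1)])
    fix s assume "s \<in> S"
    then have s: "s \<in> carrier A" using S(2) by blast
    show "is_linear R C B s" by (rule dual_linear[OF s])
    show "\<exists>S. finite S \<and> S \<subseteq> carrier B \<and> s ` D \<subseteq> submodule_span R B S"
      using dualD(1)[OF s] submoduleE(1)[OF D] by (intro exI[of _ "{\<one>}"]) (auto simp: base_module_span)
  qed
  moreover have "{c \<in> D. \<forall>s\<in>S. s c = \<zero>\<^bsub>B\<^esub>} \<subseteq> {\<zero>\<^bsub>C\<^esub>}"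
  proof clarify
    fix c assume c: "c \<in> D" and cS: "\<forall>s\<in>S. s c = \<zero>\<^bsub>B\<^esub>"
    have cc: "c \<in> carrier C" using c unfolding D_def by simp
    have "S \<union> I \<subseteq> ann {c}"
      using c cS S(2) Ic unfolding D_def annihilator_def by auto
    then have "carrier A \<subseteq> ann {c}"
      using S(3) A.submodule_span_least[OF annihilator_submodule] cc by blast
    then have "f c = \<zero>" if "f \<in> carrier A" for f using that annihilatorD(2)[of f "{c}" c] by blast
    then show "c = \<zero>\<^bsub>C\<^esub>" by (rule dual_separates_points[OF lp cc])
  qed
  ultimately have "finite_over R C {\<zero>\<^bsub>C\<^esub>} D" by (rule finite_over_mono)
  then obtain K where K: "finite K" "K \<subseteq> D" "D \<subseteq> submodule_span R C (K \<union> {\<zero>\<^bsub>C\<^esub>})"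
    unfolding finite_over_def by blast
  have Dc: "D \<subseteq> carrier C" using submoduleE(1)[OF D] .
  show "\<exists>S. finite S \<and> S \<subseteq> carrier C \<and> ann S \<subseteq> I"
  proof (intro exI conjI subsetI)
    show "finite (K \<union> {\<zero>\<^bsub>C\<^esub>})" using K(1) by simp
    show Kc: "c \<in> carrier C" if "c \<in> K \<union> {\<zero>\<^bsub>C\<^esub>}" for c using that K(2) Dc by auto
    fix f assume "f \<in> ann (K \<union> {\<zero>\<^bsub>C\<^esub>})"
    then have f: "f \<in> ann (submodule_span R C (K \<union> {\<zero>\<^bsub>C\<^esub>}))"
      using annihilator_span[of "K \<union> {\<zero>\<^bsub>C\<^esub>}"] Kc by blast
    note fc = annihilatorD(1)[OF f]
    show "f \<in> I"
    proof (rule ccontr)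
      assume "f \<notin> I"
      moreover have "cogenerated_by_base R (quotient_module A I)"
        using cog I unfolding cofinitely_cogenerated_def by blast
      ultimately obtain \<phi> where \<phi>: "is_linear R A B \<phi>" "\<And>g. g \<in> I \<Longrightarrow> \<phi> g = \<zero>" "\<phi> f \<noteq> \<zero>"
        using cogenerated_separates[OF id _ fc] by metis
      then obtain c where c: "c \<in> carrier C" "\<forall>g\<in>carrier A. \<phi> g = g c"
        using iso I unfolding bidual_map_iso_iff[OF noeth lp] by blast
      then have "c \<in> D" unfolding D_def using \<phi>(2) Ic by force
      then have "f c = \<zero>" using annihilatorD(2)[OF f] K(3) by blast
      then show False using \<phi>(3) c(2) fc by simp
    qed
  qed
qed

end

section \<open>Characterizations of coreflexivity\<close>

theorem corollary5p18:
  fixes R :: "('r, 'k) ring_scheme" (structure)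
    and C :: "('r, 'c, 'e) coalgebra_scheme"
  assumes "cring R" and "\<one> \<noteq> \<zero>" and "noetherian_ring R"
    and "coalgebra R C"
    and "locally_projective TYPE(('r, 'c, 'x) module_universe) R C"
  shows
    "(coreflexive R C \<longrightarrow>
        bidual_map R C \<in> linear_isos R C (finite_dual R (dual_algebra R C))) \<and>
     (artinian_ring R \<longrightarrow>
        (coreflexive R C \<longleftrightarrow>
          (\<forall>I. cofinite_ideal R (dual_algebra R C) I \<longrightarrow> closedin (finite_topology R C) I))) \<and>
     (cofinitely_cogenerated R (dual_algebra R C) \<longrightarrow>
        (coreflexive R C \<longleftrightarrow>
          bidual_map R C \<in> linear_isos R C (finite_dual R (dual_algebra R C))) \<and>
        (bidual_map R C \<in> linear_isos R C (finite_dual R (dual_algebra R C)) \<longleftrightarrow>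
          locally_finite_imp_rational TYPE(('r, 'c, 'x) module_universe) R C))"
proof -
  interpret nontrivial_coalgebra R C
    using assms(2,4) by (intro nontrivial_coalgebra.intro nontrivial_coalgebra_axioms.intro)
  note noeth = assms(3) and lp = assms(5)
  have "locally_finite_imp_rational TYPE(('r, 'c, 'x) module_universe) R C \<longleftrightarrow> coreflexive R C"
    using locally_finite_rational_imp_coreflexive[OF noeth] coreflexive_imp_rational[OF noeth lp]
    unfolding locally_finite_imp_rational_def by blast
  then show ?thesis
    using coreflexive_imp_bidual_iso[OF noeth lp] coreflexive_iff_cofinite_closed[OF noeth]
      bidual_iso_imp_coreflexive[OF noeth lp] by blast
qed

end
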